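(* Let $p>1$, $\bar p=\max\{p,p/(p-1)\}$, and let $f=g+\bar h\in\mathbf{h}^p(\mathbf{U})$ be a complex harmonic mapping, where $g,h$ are holomorphic on $\mathbf{U}$ and $h(0)=0$. Then $\tilde f=-i(g-\bar h)\in\mathbf{h}^p(\mathbf{U})$ and $$\|\tilde f\|_{\mathbf{h}^p}\le \cot\frac{\pi}{2\bar p}\,\|f\|_{\mathbf{h}^p},$$ and this inequality is sharp. In other words, the norm of the operator $\mathcal{H}:\mathbf{h}^p(\mathbf{U},\mathbf{C})\to\mathbf{h}^p(\mathbf{U},\mathbf{C})$, $\mathcal{H}f=\tilde f$ (equivalently, of the Hilbert transform $\mathcal{H}:L^p(\mathbf{T},\mathbf{C})\to L^p(\mathbf{T},\mathbf{C})$), is $$\|\mathcal{H}\|_p=\begin{cases}\tan\frac{\pi}{2p}, & p\le 2,\\ \cot\frac{\pi}{2p}, & p>2.\end{cases}$$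
   Context: $\mathbf{U}$ is the open unit disk in $\mathbf{C}$, $\mathbf{T}$ the unit circle, $\sigma$ the normalized (probability) arc-length measure on $\mathbf{T}$. For $p>1$, $\mathbf{h}^p=\mathbf{h}^p(\mathbf{U})=\mathbf{h}^p(\mathbf{U},\mathbf{C})$ is the class of complex-valued harmonic functions $f$ on $\mathbf{U}$ with $\|f\|_{\mathbf{h}^p}=\sup_{0<r<1}\left(\int_{\mathbf{T}}|f(r\zeta)|^p\,d\sigma(\zeta)\right)^{1/p}<\infty$. Every complex harmonic $f$ on $\mathbf{U}$ is uniquely written as $f=g+\bar h$ with $g,h$ holomorphic and $h(0)=0$; its harmonic conjugate is $\tilde f:=-i(g-\bar h)$. The (periodic) Hilbert transform of $\chi\in L^p(\mathbf{T},\mathbf{C})$ is the boundary function of $\tilde f$, where $f$ is the Poisson extension of $\chi$; that is, $\mathcal{H}[\chi](e^{i\tau})=-i\sum_{k\in\mathbf{Z}}\mathrm{sign}(k)\,\widehat\chi(k)e^{ik\tau}$ with $\widehat\chi(k)=\frac1{2\pi}\int_0^{2\pi}\chi(e^{it})e^{-ikt}dt$ and the convention $\mathrm{sign}(0)=1$. *)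

theory Defs
  imports "HOL-Complex_Analysis.Complex_Analysis"
begin

abbreviation unit_disk :: "complex set" where
  "unit_disk \<equiv> ball 0 1"

definition circle_measure :: "complex measure" where
  "circle_measure =
     distr (uniform_measure lborel {0..2 * pi}) (restrict_space borel (sphere 0 1)) cis"

text \<open>
  Complex-valued harmonic functions: twice continuously (real) differentiable functions with
  vanishing Laplacian. Here fx, fy are the first and fxx, fxy, fyx, fyy the second partial
  derivatives with respect to z = x + iy, where fxy is the derivative of fx in direction y.
\<close>

definition complex_harmonic_on :: "(complex \<Rightarrow> complex) \<Rightarrow> complex set \<Rightarrow> bool" where
  "complex_harmonic_on f S \<longleftrightarrow>
     (\<exists>fx fy fxx fxy fyx fyy.
        (\<forall>z\<in>S. (f has_derivative (\<lambda>v. Re v *\<^sub>R fx z + Im v *\<^sub>R fy z)) (at z) \<and>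
               (fx has_derivative (\<lambda>v. Re v *\<^sub>R fxx z + Im v *\<^sub>R fxy z)) (at z) \<and>
               (fy has_derivative (\<lambda>v. Re v *\<^sub>R fyx z + Im v *\<^sub>R fyy z)) (at z) \<and>
               fxx z + fyy z = 0) \<and>
        continuous_on S fxx \<and> continuous_on S fxy \<and>
        continuous_on S fyx \<and> continuous_on S fyy)"

definition hp_mean :: "real \<Rightarrow> (complex \<Rightarrow> complex) \<Rightarrow> real \<Rightarrow> real" where
  "hp_mean p f r = (\<integral>\<zeta>. norm (f (of_real r * \<zeta>)) powr p \<partial>circle_measure) powr (1 / p)"

definition hp_space :: "real \<Rightarrow> (complex \<Rightarrow> complex) set" where
  "hp_space p = {f. complex_harmonic_on f unit_disk \<and> bdd_above (hp_mean p f ` {0<..<1})}"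

definition hp_norm :: "real \<Rightarrow> (complex \<Rightarrow> complex) \<Rightarrow> real" where
  "hp_norm p f = (SUP r\<in>{0<..<1}. hp_mean p f r)"

definition canonical_decomp ::
    "(complex \<Rightarrow> complex) \<Rightarrow> (complex \<Rightarrow> complex) \<Rightarrow> (complex \<Rightarrow> complex) \<Rightarrow> bool" where
  "canonical_decomp f g h \<longleftrightarrow>
     g holomorphic_on unit_disk \<and> h holomorphic_on unit_disk \<and> h 0 = 0 \<and>
     (\<forall>z\<in>unit_disk. f z = g z + cnj (h z))"

text \<open>
  The harmonic conjugate of f = g + cnj h is -i (g - cnj h). For f harmonic on the unit disk the
  decomposition is unique there. Functions on the disk are total functions whose values outside
  the disk are irrelevant; the conjugate is set to 0 there.
\<close>

definition harmonic_conjugate :: "(complex \<Rightarrow> complex) \<Rightarrow> complex \<Rightarrow> complex" where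
  "harmonic_conjugate f z =
     (if z \<in> unit_disk
      then THE w. \<exists>g h. canonical_decomp f g h \<and> w = - \<i> * (g z - cnj (h z))
      else 0)"

definition poisson_extension :: "(complex \<Rightarrow> complex) \<Rightarrow> complex \<Rightarrow> complex" where
  "poisson_extension \<phi> z =
     (\<integral>\<zeta>. ((1 - (norm z)\<^sup>2) / (norm (\<zeta> - z))\<^sup>2) *\<^sub>R \<phi> \<zeta> \<partial>circle_measure)"

text \<open>
  Radial boundary values. The radial limit of the functions used below exists at almost every
  point of the circle; on the exceptional null set the boundary function is set to 0.
\<close>

definition boundary_function :: "(complex \<Rightarrow> complex) \<Rightarrow> complex \<Rightarrow> complex" where
  "boundary_function F \<zeta> =
     (if \<exists>L. ((\<lambda>r. F (of_real r * \<zeta>)) \<longlongrightarrow> L) (at_left (1::real))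
      then Lim (at_left (1::real)) (\<lambda>r. F (of_real r * \<zeta>))
      else 0)"

definition hilbert_transform :: "(complex \<Rightarrow> complex) \<Rightarrow> complex \<Rightarrow> complex" where
  "hilbert_transform \<phi> = boundary_function (harmonic_conjugate (poisson_extension \<phi>))"

text \<open>
  The space L^p of the circle, as functions rather than as classes modulo null sets: its
  "norm" is a seminorm, and the Hilbert transform only depends on the class of its argument.
\<close>

definition Lp_circle :: "real \<Rightarrow> (complex \<Rightarrow> complex) set" where
  "Lp_circle p = {\<phi>. \<phi> \<in> borel_measurable circle_measure \<and>
                     integrable circle_measure (\<lambda>\<zeta>. norm (\<phi> \<zeta>) powr p)}"

definition Lp_circle_norm :: "real \<Rightarrow> (complex \<Rightarrow> complex) \<Rightarrow> real" where
  "Lp_circle_norm p \<phi> = (\<integral>\<zeta>. norm (\<phi> \<zeta>) powr p \<partial>circle_measure) powr (1 / p)"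

text \<open>
  Norm of an operator T on a space X with (semi)norm N: the least admissible constant, which is
  infinite if T is unbounded.
\<close>

definition operator_norm_on :: "'a set \<Rightarrow> ('a \<Rightarrow> real) \<Rightarrow> ('a \<Rightarrow> 'a) \<Rightarrow> ereal" where
  "operator_norm_on X N T = Inf {ereal C |C. 0 \<le> C \<and> (\<forall>f\<in>X. N (T f) \<le> C * N f)}"

end

theory Submission
  imports Defs "HOL-Probability.Probability_Measure"
begin

text \<open>
Write \<open>f = g + cnj h\<close>, so that the conjugate is, up to the factor \<open>- \<i>\<close>, the function \<open>g - cnj h\<close>.
Let \<open>1 < p < 2\<close> and \<open>T = tan (pi / (2 * p))\<close>. The upper bound rests on a pointwise inequality

  \<open>norm (z - cnj w) powr p \<le> T powr p * norm (z + cnj w) powr p - K * Re ((z * w) powr (p / 2))\<close>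

with \<open>K \<ge> 0\<close> and the principal branch of the power (\<open>conjugation_inequality\<close>). For
\<open>norm z = norm w\<close> it is the inequality behind the theorem of Pichorides for real functions, and the
general case is reduced to this one. The function \<open>Re (\<zeta> powr a)\<close> is subharmonic in the whole plane
for \<open>0 < a < 1\<close>, since near the negative axis it is the maximum of two branches. Inserting
\<open>z = g \<zeta>\<close> and \<open>w = h \<zeta>\<close> and integrating over a circle, the last term has a nonnegative mean because
\<open>g * h\<close> is holomorphic and vanishes at 0 (\<open>slit_power_submean\<close>). Here \<open>h 0 = 0\<close> enters, which is
the convention \<open>sign 0 = 1\<close>: the constant term belongs to \<open>g\<close>. For \<open>p = 2\<close> the inequality becomes
the identity \<open>(norm (z - cnj w))\<^sup>2 = (norm (z + cnj w))\<^sup>2 - 4 * Re (z * w)\<close>.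

For \<open>p > 2\<close> the bound follows by duality, as conjugation is symmetric for the pairing of \<open>L^p\<close> with
the dual space; the constants correspond because \<open>tan (pi / (2 * q)) = cot (pi / (2 * p))\<close> for the
conjugate exponent \<open>q\<close> (\<open>conjugation_bound_duality\<close>). Sharpness comes from the dilations of
\<open>Re (((1 + z) / (1 - z)) powr (1 / p))\<close>: the power maps the disk onto a sector of half-angle
\<open>pi / (2 * p)\<close>, and on the boundary of that sector the imaginary part is \<open>T\<close> times the real part
(\<open>conjugation_bound_imp_ge_tan\<close>). Duality again covers \<open>p > 2\<close>.

These estimates are first proved for functions that are harmonic on a neighbourhood of the closed
disk, where they are statements about continuous functions on the circle
(\<open>conjugation_bound_iff\<close>). For \<open>h^p\<close> one dilates. For the Hilbert transform, the Poisson integral is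
a contraction from \<open>L^p\<close> to \<open>h^p\<close>, and Fatou's lemma bounds the radial boundary values of the
conjugate; conversely, for functions harmonic on a neighbourhood of the closed disk the Hilbert
transform is the restriction of the conjugate to the circle, so its norm cannot be smaller.
\<close>

section \<open>Integration over the circle\<close>

abbreviation circle_power :: "real \<Rightarrow> (complex \<Rightarrow> complex) \<Rightarrow> real" where
  "circle_power p F \<equiv> (\<integral>\<zeta>. norm (F \<zeta>) powr p \<partial>circle_measure)"

lemma measurable_cis_circle: "cis \<in> measurable borel (restrict_space borel (sphere 0 1))"
  by (intro measurable_restrict_space2)
       (auto intro!: borel_measurable_continuous_onI continuous_intros)

lemma prob_space_circle_measure: "prob_space circle_measure"
proof -
  interpret U: prob_space "uniform_measure lborel {0..2 * pi}"
    by (intro prob_space_uniform_measure) (auto simp: ennreal_eq_0_iff not_le)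
  have "cis \<in> measurable (uniform_measure lborel {0..2 * pi}) (restrict_space borel (sphere 0 1))"
    using measurable_cis_circle by (simp add: measurable_def)
  then show ?thesis
    unfolding circle_measure_def by (rule U.prob_space_distr)
qed

lemma space_circle_measure [simp]: "space circle_measure = sphere 0 1"
  by (simp add: circle_measure_def space_restrict_space)

lemma sets_circle_measure [measurable_cong]:
  "sets circle_measure = sets (restrict_space borel (sphere 0 1))"
  by (simp add: circle_measure_def)

interpretation circle: prob_space circle_measure
  by (rule prob_space_circle_measure)

lemma borel_measurable_circle_continuous:
  fixes f :: "complex \<Rightarrow> 'a::topological_space"
  assumes "continuous_on (sphere 0 1) f"
  shows "f \<in> borel_measurable circle_measure"
  using borel_measurable_continuous_on_restrict[OF assms]
  by (simp add: measurable_def sets_circle_measure space_restrict_space)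

lemma integrable_circle_continuous:
  fixes f :: "complex \<Rightarrow> 'a::{banach, second_countable_topology}"
  assumes "continuous_on (sphere 0 1) f"
  shows "integrable circle_measure f"
proof -
  have "bounded (f ` sphere 0 1)"
    using assms by (intro compact_imp_bounded compact_continuous_image) auto
  then obtain B where "\<And>\<zeta>. \<zeta> \<in> sphere 0 1 \<Longrightarrow> norm (f \<zeta>) \<le> B"
    unfolding bounded_iff by blast
  then show ?thesis
    using borel_measurable_circle_continuous[OF assms]
    by (intro circle.integrable_const_bound[of _ B]) (auto intro!: AE_I2)
qed

lemma integral_circle_interval:
  fixes f :: "complex \<Rightarrow> 'a::{banach, second_countable_topology}"
  assumes "f \<in> borel_measurable circle_measure"
  shows "(\<integral>\<zeta>. f \<zeta> \<partial>circle_measure) = (1 / (2 * pi)) *\<^sub>R (LINT t:{0..2 * pi}|lborel. f (cis t))"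
proof -
  have U: "uniform_measure lborel {0..2 * pi} = density lborel (\<lambda>t. ennreal (indicator {0..2 * pi} t / (2 * pi)))"
    unfolding uniform_measure_def
    using divide_ennreal[of 1 "2 * pi"] by (intro density_cong) (auto simp: indicator_def)
  have fm: "f \<in> borel_measurable (restrict_space borel (sphere 0 1))"
    using assms by (simp add: measurable_def sets_circle_measure space_restrict_space)
  have m: "(\<lambda>t. f (cis t)) \<in> borel_measurable borel"
    using measurable_compose[OF measurable_cis_circle fm] .
  have "(\<integral>\<zeta>. f \<zeta> \<partial>circle_measure) = (\<integral>t. f (cis t) \<partial>uniform_measure lborel {0..2 * pi})"
    unfolding circle_measure_def using measurable_cis_circle fm by (intro integral_distr) auto
  also have "\<dots> = (\<integral>t. (indicator {0..2 * pi} t / (2 * pi)) *\<^sub>R f (cis t) \<partial>lborel)"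
    unfolding U using m by (intro integral_density) auto
  also have "\<dots> = (\<integral>t. (1 / (2 * pi)) *\<^sub>R (indicator {0..2 * pi} t *\<^sub>R f (cis t)) \<partial>lborel)"
    by (intro Bochner_Integration.integral_cong) (auto simp: indicator_def)
  also have "\<dots> = (1 / (2 * pi)) *\<^sub>R (\<integral>t. indicator {0..2 * pi} t *\<^sub>R f (cis t) \<partial>lborel)"
    by (cases "integrable lborel (\<lambda>t. indicator {0..2 * pi} t *\<^sub>R f (cis t))")
       (simp_all add: not_integrable_integral_eq del: scaleR_scaleR)
  finally show ?thesis
    by (simp add: set_lebesgue_integral_def)
qed

text \<open>
Since \<open>d\<zeta> = \<i> \<zeta> dt\<close> along the circle, Cauchy's formula against normalised arc length has
the kernel \<open>\<zeta> / (\<zeta> - w)\<close> instead of \<open>1 / (\<zeta> - w)\<close>. This form yields both the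
mean value property (\<open>w = 0\<close>) and the Poisson formula.
\<close>

lemma circle_cauchy_formula:
  assumes F: "F holomorphic_on ball 0 R" and R: "R > 1" and w: "norm w < 1"
  shows "(\<integral>\<zeta>. F \<zeta> * \<zeta> / (\<zeta> - w) \<partial>circle_measure) = F w"
proof -
  have "F holomorphic_on cball 0 1" using F R by (auto intro: holomorphic_on_subset)
  then have "((\<lambda>u. F u / (u - w)) has_contour_integral (2 * of_real pi * \<i> * F w)) (circlepath 0 1)"
    using w by (intro Cauchy_integral_circlepath_simple) auto
  then have "((\<lambda>u. F u / (u - w)) has_contour_integral (2 * of_real pi * \<i> * F w)) (part_circlepath 0 1 0 (2*pi))"
    by (simp add: circlepath_def)
  then have hi: "((\<lambda>t. F (cis t) / (cis t - w) * \<i> * cis t) has_integral (2 * of_real pi * \<i> * F w)) {0..2*pi}"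
    by (subst (asm) has_contour_integral_part_circlepath_iff) auto
  have cont: "continuous_on (sphere 0 1) (\<lambda>\<zeta>. F \<zeta> * \<zeta> / (\<zeta> - w))"
    using w R by (intro continuous_intros holomorphic_on_imp_continuous_on[OF holomorphic_on_subset[OF F]]) auto
  have cont2: "continuous_on {0..2*pi} (\<lambda>t. F (cis t) * cis t / (cis t - w))"
    by (intro continuous_on_compose2[OF cont]) (auto intro!: continuous_intros)
  have "(LINT t:{0..2 * pi}|lborel. F (cis t) * cis t / (cis t - w)) = integral {0..2*pi} (\<lambda>t. F (cis t) * cis t / (cis t - w))"
    by (intro set_borel_integral_eq_integral borel_integrable_compact cont2 compact_Icc
       borel_integrable_atLeastAtMost')
  also have "\<dots> = 2 * of_real pi * F w"
    using has_integral_mult_right[OF hi, of "-\<i>"] by (intro integral_unique) (simp add: mult_ac)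
  finally show ?thesis
    by (subst integral_circle_interval[OF borel_measurable_circle_continuous[OF cont]])
       (simp add: scaleR_conv_of_real)
qed

lemma circle_mean_value:
  assumes F: "F holomorphic_on ball 0 R" and R: "R > 1"
  shows "(\<integral>\<zeta>. F \<zeta> \<partial>circle_measure) = F 0"
proof -
  have "(\<integral>\<zeta>. F \<zeta> \<partial>circle_measure) = (\<integral>\<zeta>. F \<zeta> * \<zeta> / (\<zeta> - 0) \<partial>circle_measure)"
    by (intro Bochner_Integration.integral_cong) auto
  then show ?thesis using circle_cauchy_formula[OF assms, of 0] by simp
qed

section \<open>Trigonometric approximation\<close>

text \<open>
On the circle \<open>cnj \<zeta>\<close> is the inverse of \<open>\<zeta>\<close>, so \<open>poly a \<zeta> * cnj \<zeta> ^ n\<close> is a general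
trigonometric polynomial. In this representation products only multiply the polynomials and add
the exponents, which makes the induction over real polynomials in two variables short.
\<close>

lemma real_polynomial_function_circle:
  assumes "real_polynomial_function P"
  shows "\<exists>(a::complex poly) n. \<forall>\<zeta>\<in>sphere 0 1. of_real (P \<zeta>) = poly a \<zeta> * cnj \<zeta> ^ n"
  using assms
proof induction
  case (linear f)
  interpret bounded_linear f by fact
  \<comment> \<open>Here \<open>Re \<zeta> = (\<zeta> + cnj \<zeta>) / 2\<close> and \<open>Im \<zeta> = (\<zeta> - cnj \<zeta>) / (2 * \<i>)\<close> are inserted into the real linear map.\<close>
  have "of_real (f \<zeta>) = poly [:(of_real (f 1) + \<i> * of_real (f \<i>)) / 2, 0, (of_real (f 1) - \<i> * of_real (f \<i>)) / 2:] \<zeta> * cnj \<zeta> ^ 1"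
    if "\<zeta> \<in> sphere 0 1" for \<zeta>
  proof -
    have "\<zeta> = Re \<zeta> *\<^sub>R 1 + Im \<zeta> *\<^sub>R \<i>" by (simp add: complex_eq_iff)
    then have "f \<zeta> = f (Re \<zeta> *\<^sub>R 1 + Im \<zeta> *\<^sub>R \<i>)" by (rule arg_cong)
    also have "\<dots> = Re \<zeta> * f 1 + Im \<zeta> * f \<i>" by (simp only: add scaleR) simp
    finally have 1: "complex_of_real (f \<zeta>) = of_real (Re \<zeta>) * of_real (f 1) + of_real (Im \<zeta>) * of_real (f \<i>)" by simp
    have "\<zeta> * cnj \<zeta> = 1" using that by (simp add: complex_norm_square[symmetric])
    then have 2: "poly [:A, 0, B:] \<zeta> * cnj \<zeta> ^ 1 = A * cnj \<zeta> + B * \<zeta>" for A B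
      by (simp add: algebra_simps)
    show ?thesis unfolding 1 2 by (simp add: complex_eq_iff field_simps)
  qed
  then show ?case by blast
next
  case (const c)
  have "of_real c = poly [:of_real c:] \<zeta> * cnj \<zeta> ^ 0" for \<zeta> by simp
  then show ?case by blast
next
  case (add f g)
  then obtain a m b n where *: "\<And>\<zeta>. \<zeta> \<in> sphere 0 1 \<Longrightarrow> of_real (f \<zeta>) = poly a \<zeta> * cnj \<zeta> ^ m"
    "\<And>\<zeta>. \<zeta> \<in> sphere 0 1 \<Longrightarrow> of_real (g \<zeta>) = poly b \<zeta> * cnj \<zeta> ^ n" by blast
  have "of_real (f \<zeta> + g \<zeta>) = poly (a * monom 1 n + b * monom 1 m) \<zeta> * cnj \<zeta> ^ (m + n)"
    if "\<zeta> \<in> sphere 0 1" for \<zeta>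
  proof -
    have "\<zeta> * cnj \<zeta> = 1" using that by (simp add: complex_norm_square[symmetric])
    then have e: "\<zeta> ^ k * cnj \<zeta> ^ k = 1" for k by (simp flip: power_mult_distrib)
    have "A * \<zeta> ^ n * cnj \<zeta> ^ (m + n) = A * cnj \<zeta> ^ m * (\<zeta> ^ n * cnj \<zeta> ^ n)"
      "A * \<zeta> ^ m * cnj \<zeta> ^ (m + n) = A * cnj \<zeta> ^ n * (\<zeta> ^ m * cnj \<zeta> ^ m)" for A
      by (simp_all add: power_add mult_ac)
    then have e': "A * \<zeta> ^ n * cnj \<zeta> ^ (m + n) = A * cnj \<zeta> ^ m" "A * \<zeta> ^ m * cnj \<zeta> ^ (m + n) = A * cnj \<zeta> ^ n" for A
      by (simp_all only: e mult_1_right)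
    show ?thesis
      by (simp only: of_real_add *[OF that] poly_add poly_mult poly_monom mult_1_left distrib_right e')
  qed
  then show ?case by blast
next
  case (mult f g)
  then obtain a m b n where *: "\<And>\<zeta>. \<zeta> \<in> sphere 0 1 \<Longrightarrow> of_real (f \<zeta>) = poly a \<zeta> * cnj \<zeta> ^ m"
    "\<And>\<zeta>. \<zeta> \<in> sphere 0 1 \<Longrightarrow> of_real (g \<zeta>) = poly b \<zeta> * cnj \<zeta> ^ n" by blast
  have "of_real (f \<zeta> * g \<zeta>) = poly (a * b) \<zeta> * cnj \<zeta> ^ (m + n)"
    if "\<zeta> \<in> sphere 0 1" for \<zeta>
    using *[OF that] by (simp add: power_add)
  then show ?case by blast
qed

text \<open>
A negative power of \<open>\<zeta>\<close> can be conjugated into a positive one without changing the real part.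
Thus every real trigonometric polynomial is the boundary function of the real part of an entire
function, that is, of a harmonic function: this replaces the solution of the Dirichlet problem.
\<close>

lemma Re_laurent_eq_Re_poly_circle:
  "\<exists>q::complex poly. \<forall>\<zeta>\<in>sphere 0 1. Re (poly a \<zeta> * cnj \<zeta> ^ n) = Re (poly q \<zeta>)"
proof (induction a arbitrary: n)
  case 0
  show ?case by (intro exI[of _ 0]) simp
next
  case (pCons c a)
  show ?case
  proof (cases n)
    case 0
    then show ?thesis by (intro exI[of _ "pCons c a"]) simp
  next
    case (Suc k)
    obtain q where q: "\<And>\<zeta>. \<zeta> \<in> sphere 0 1 \<Longrightarrow> Re (poly a \<zeta> * cnj \<zeta> ^ k) = Re (poly q \<zeta>)"
      using pCons.IH[of k] by blast
    have "Re (poly (pCons c a) \<zeta> * cnj \<zeta> ^ n) = Re (poly (monom (cnj c) n + q) \<zeta>)"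
      if "\<zeta> \<in> sphere 0 1" for \<zeta>
    proof -
      have "\<zeta> * cnj \<zeta> = 1" using that by (simp add: complex_norm_square[symmetric])
      then have "poly (pCons c a) \<zeta> * cnj \<zeta> ^ n = cnj (cnj c * \<zeta> ^ n) + poly a \<zeta> * cnj \<zeta> ^ k"
        by (simp add: Suc algebra_simps)
      then show ?thesis using q[OF that] by (simp only: plus_complex.simps cnj.sel) (simp add: poly_monom)
    qed
    then show ?thesis by blast
  qed
qed

lemma circle_approx_Re_poly:
  fixes u :: "complex \<Rightarrow> real"
  assumes "continuous_on (sphere 0 1) u" "\<epsilon> > 0"
  obtains q :: "complex poly" where "\<And>\<zeta>. \<zeta> \<in> sphere 0 1 \<Longrightarrow> \<bar>u \<zeta> - Re (poly q \<zeta>)\<bar> < \<epsilon>"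
proof -
  obtain P where P: "real_polynomial_function P" "\<And>\<zeta>. \<zeta> \<in> sphere 0 1 \<Longrightarrow> \<bar>u \<zeta> - P \<zeta>\<bar> < \<epsilon>"
    using Stone_Weierstrass_real_polynomial_function[OF compact_sphere assms] by blast
  obtain a n where a: "\<And>\<zeta>. \<zeta> \<in> sphere 0 1 \<Longrightarrow> of_real (P \<zeta>) = poly a \<zeta> * cnj \<zeta> ^ n"
    using real_polynomial_function_circle[OF P(1)] by blast
  obtain q where q: "\<And>\<zeta>. \<zeta> \<in> sphere 0 1 \<Longrightarrow> Re (poly a \<zeta> * cnj \<zeta> ^ n) = Re (poly q \<zeta>)"
    using Re_laurent_eq_Re_poly_circle[of a n] by blast
  have "P \<zeta> = Re (poly q \<zeta>)" if "\<zeta> \<in> sphere 0 1" for \<zeta>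
    using a[OF that] q[OF that] by (metis Re_complex_of_real)
  with P(2) that show ?thesis by auto
qed

text \<open>
The complex version splits \<open>\<psi>\<close> into real and imaginary part; a real part \<open>Re q\<close> contributes
\<open>q / 2\<close> to both summands. The constant term is moved into \<open>a\<close> so that \<open>b\<close> vanishes at 0.
\<close>

lemma circle_approx_harmonic_poly:
  fixes \<psi> :: "complex \<Rightarrow> complex"
  assumes "continuous_on (sphere 0 1) \<psi>" "\<epsilon> > 0"
  obtains a b :: "complex poly" where "poly b 0 = 0"
    "\<And>\<zeta>. \<zeta> \<in> sphere 0 1 \<Longrightarrow> norm (\<psi> \<zeta> - (poly a \<zeta> + cnj (poly b \<zeta>))) < \<epsilon>"
proof -
  obtain q1 where q1: "\<And>\<zeta>. \<zeta> \<in> sphere 0 1 \<Longrightarrow> \<bar>Re (\<psi> \<zeta>) - Re (poly q1 \<zeta>)\<bar> < \<epsilon> / 2"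
    using circle_approx_Re_poly[of "\<lambda>\<zeta>. Re (\<psi> \<zeta>)" "\<epsilon> / 2"] assms by (auto intro!: continuous_intros)
  obtain q2 where q2: "\<And>\<zeta>. \<zeta> \<in> sphere 0 1 \<Longrightarrow> \<bar>Im (\<psi> \<zeta>) - Re (poly q2 \<zeta>)\<bar> < \<epsilon> / 2"
    using circle_approx_Re_poly[of "\<lambda>\<zeta>. Im (\<psi> \<zeta>)" "\<epsilon> / 2"] assms by (auto intro!: continuous_intros)
  define a b where "a = smult (1/2) (q1 + smult \<i> q2)" and "b = smult (1/2) (q1 - smult \<i> q2)"
  define c where "c = poly b 0"
  show ?thesis
  proof (rule that[of "b - [:c:]" "a + [:cnj c:]"])
    show "poly (b - [:c:]) 0 = 0" by (simp add: c_def)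
    fix \<zeta> :: complex assume z: "\<zeta> \<in> sphere 0 1"
    have "poly (a + [:cnj c:]) \<zeta> + cnj (poly (b - [:c:]) \<zeta>) = Complex (Re (poly q1 \<zeta>)) (Re (poly q2 \<zeta>))"
      by (simp add: a_def b_def complex_eq_iff field_simps)
    then have "norm (\<psi> \<zeta> - (poly (a + [:cnj c:]) \<zeta> + cnj (poly (b - [:c:]) \<zeta>)))
      \<le> \<bar>Re (\<psi> \<zeta>) - Re (poly q1 \<zeta>)\<bar> + \<bar>Im (\<psi> \<zeta>) - Re (poly q2 \<zeta>)\<bar>"
      using cmod_le[of "\<psi> \<zeta> - Complex (Re (poly q1 \<zeta>)) (Re (poly q2 \<zeta>))"] by simp
    with q1[OF z] q2[OF z] show "norm (\<psi> \<zeta> - (poly (a + [:cnj c:]) \<zeta> + cnj (poly (b - [:c:]) \<zeta>))) < \<epsilon>"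
      by linarith
  qed
qed

section \<open>The subharmonic function Re (z powr a)\<close>

text \<open>
Local holomorphic minorants that touch \<open>u\<close> give the mean value inequality. The proof compares
\<open>u\<close> with a harmonic polynomial \<open>Re q\<close> that is uniformly close to \<open>u\<close> on the circle: an interior
maximum of \<open>u - Re q\<close> would be an interior maximum of the real part of a holomorphic function.
Adding a small multiple of \<open>(norm z)\<^sup>2\<close> makes that maximum strict, so that it contradicts the
maximum modulus principle.
\<close>

lemma touching_submean:
  fixes u :: "complex \<Rightarrow> real"
  assumes cont: "continuous_on (cball 0 1) u"
    and touch: "\<And>z. z \<in> ball 0 1 \<Longrightarrow> \<exists>\<rho>>0. \<exists>v. v holomorphic_on ball z \<rho> \<and>
                  (\<forall>w\<in>ball z \<rho>. Re (v w) \<le> u w) \<and> Re (v z) = u z"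
  shows "u 0 \<le> (\<integral>\<zeta>. u \<zeta> \<partial>circle_measure)"
proof (rule field_le_epsilon)
  fix e :: real assume e: "e > 0"
  define \<delta> where "\<delta> = e / 4"
  have \<delta>: "\<delta> > 0" using e by (simp add: \<delta>_def)
  have cont': "continuous_on (sphere 0 1) u"
    by (rule continuous_on_subset[OF cont]) auto
  obtain q where q: "\<And>\<zeta>. \<zeta> \<in> sphere 0 1 \<Longrightarrow> \<bar>u \<zeta> - Re (poly q \<zeta>)\<bar> < \<delta>"
    using circle_approx_Re_poly[OF cont' \<delta>] by blast
  define W where "W z = u z - Re (poly q z) + \<delta> * (norm z)\<^sup>2" for z
  have "continuous_on (cball 0 1) W"
    unfolding W_def by (intro continuous_intros cont)
  then obtain z0 where z0: "z0 \<in> cball 0 1" "\<And>z. z \<in> cball 0 1 \<Longrightarrow> W z \<le> W z0"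
    using continuous_attains_sup[of "cball 0 1" W] by fastforce
  have sph: "z0 \<in> sphere 0 1"
  proof (rule ccontr)
    assume "z0 \<notin> sphere 0 1"
    then have zb: "z0 \<in> ball 0 1" using z0(1) by auto
    obtain \<rho> v where v: "\<rho> > 0" "v holomorphic_on ball z0 \<rho>"
      "\<And>w. w \<in> ball z0 \<rho> \<Longrightarrow> Re (v w) \<le> u w" "Re (v z0) = u z0"
      using touch[OF zb] by blast
    obtain \<rho>' where \<rho>': "\<rho>' > 0" "ball z0 \<rho>' \<subseteq> ball 0 1" using zb open_contains_ball open_ball by blast
    define r where "r = min \<rho> \<rho>'"
    have r: "r > 0" "ball z0 r \<subseteq> ball 0 1" "ball z0 r \<subseteq> ball z0 \<rho>" using v(1) \<rho>' by (auto simp: r_def)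
    \<comment> \<open>Up to the term \<open>\<delta> * (norm (w - z0))\<^sup>2\<close>, the summand \<open>\<delta> * (norm w)\<^sup>2\<close> is the real part of an affine function of \<open>w\<close>.\<close>
    define K where "K w = v w - poly q w + 2 * of_real \<delta> * cnj z0 * (w - z0)" for w
    have K_le: "Re (K w) \<le> Re (K z0) - \<delta> * (norm (w - z0))\<^sup>2" if w: "w \<in> ball z0 r" for w
    proof -
      have sq: "(norm w)\<^sup>2 = (norm z0)\<^sup>2 + 2 * Re (cnj z0 * (w - z0)) + (norm (w - z0))\<^sup>2"
        unfolding cmod_power2 by (simp add: power2_eq_square algebra_simps)
      have "Re (K w) = Re (v w) - Re (poly q w) + \<delta> * (2 * Re (cnj z0 * (w - z0)))"
        by (simp add: K_def algebra_simps)
      also have "\<dots> \<le> W w - \<delta> * (norm z0)\<^sup>2 - \<delta> * (norm (w - z0))\<^sup>2"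
        using v(3)[of w] w r(3) unfolding W_def sq by (auto simp: algebra_simps)
      also have "W w \<le> W z0" using w r(2) by (intro z0(2)) auto
      also have "W z0 - \<delta> * (norm z0)\<^sup>2 = Re (K z0)" by (simp add: K_def W_def v(4))
      finally show ?thesis by simp
    qed
    have "(\<lambda>w. exp (K w)) constant_on ball z0 r"
    proof (rule maximum_modulus_principle[where U = "ball z0 r" and \<xi> = z0])
      show "(\<lambda>w. exp (K w)) holomorphic_on ball z0 r"
        unfolding K_def using r(3) v(2) by (intro holomorphic_intros) (auto intro: holomorphic_on_subset)
      show "norm (exp (K z)) \<le> norm (exp (K z0))" if "z \<in> ball z0 r" for z
        using K_le[OF that] \<delta> by (simp add: order_trans)
    qed (use r in auto)
    moreover have "z0 + of_real (r / 2) \<in> ball z0 r" "z0 \<in> ball z0 r" using r(1) by (auto simp: dist_norm)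
    ultimately have "exp (K (z0 + of_real (r / 2))) = exp (K z0)"
      by (auto simp: constant_on_def)
    then have "Re (K (z0 + of_real (r / 2))) = Re (K z0)"
      by (metis norm_exp_eq_Re exp_inj_iff)
    with K_le[OF \<open>z0 + of_real (r / 2) \<in> ball z0 r\<close>] \<delta> r(1) show False
      by (simp add: power2_eq_square mult_le_0_iff)
  qed
  have "W 0 \<le> W z0" by (rule z0(2)) auto
  also have "W z0 \<le> 2 * \<delta>" using q[OF sph] sph by (simp add: W_def)
  finally have 1: "u 0 \<le> Re (poly q 0) + 2 * \<delta>" by (simp add: W_def)
  have "Re (poly q 0) = (\<integral>\<zeta>. Re (poly q \<zeta>) \<partial>circle_measure)"
    by (subst integral_Re, intro integrable_circle_continuous continuous_intros)
       (subst circle_mean_value[where R = 2]; auto intro!: holomorphic_intros)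
  also have "\<dots> \<le> (\<integral>\<zeta>. u \<zeta> + \<delta> \<partial>circle_measure)"
  proof (intro integral_mono integrable_circle_continuous continuous_intros cont')
    show "Re (poly q \<zeta>) \<le> u \<zeta> + \<delta>" if "\<zeta> \<in> space circle_measure" for \<zeta>
      using q[of \<zeta>] that by auto
  qed
  also have "\<dots> = (\<integral>\<zeta>. u \<zeta> \<partial>circle_measure) + \<delta>"
    by (subst Bochner_Integration.integral_add) (auto intro: integrable_circle_continuous cont' simp: circle.prob_space[simplified])
  finally show "u 0 \<le> (\<integral>\<zeta>. u \<zeta> \<partial>circle_measure) + e"
    using 1 \<delta> by (simp add: \<delta>_def)
qed

text \<open>
The numbers \<open>\<bar>t\<bar>\<close> and \<open>2 * pi - \<bar>t\<bar>\<close> have the same cosine, and \<open>arccos\<close> picks the smaller one.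
After scaling by \<open>a \<le> 1\<close> their sum is still at most \<open>2 * pi\<close>, so the smaller one has the larger
cosine.
\<close>

lemma cos_scaled_le_cos_scaled_arccos:
  assumes "0 \<le> a" "a \<le> 1" "\<bar>t\<bar> \<le> 2 * pi"
  shows "cos (a * t) \<le> cos (a * arccos (cos t))"
proof (cases "\<bar>t\<bar> \<le> pi")
  case True
  then have "arccos (cos t) = \<bar>t\<bar>" by (metis abs_ge_zero arccos_cos cos_abs_real)
  then show ?thesis using assms by (simp add: abs_mult cos_abs_real[of "a * t", symmetric] del: cos_abs_real)
next
  case False
  have "cos t = cos (2 * pi - \<bar>t\<bar>)" by (simp add: cos_diff)
  moreover have "arccos (cos (2 * pi - \<bar>t\<bar>)) = 2 * pi - \<bar>t\<bar>" using False assms by (intro arccos_cos) auto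
  ultimately have ar: "arccos (cos t) = 2 * pi - \<bar>t\<bar>" by metis
  have "cos (a * (2 * pi - \<bar>t\<bar>)) - cos (a * \<bar>t\<bar>) = 2 * sin (a * pi) * sin (a * (\<bar>t\<bar> - pi))"
    by (subst cos_diff_cos) (simp add: algebra_simps add_divide_distrib diff_divide_distrib)
  moreover have "sin (a * pi) \<ge> 0" using assms by (intro sin_ge_zero) (auto simp: mult_le_cancel_right1)
  moreover have "sin (a * (\<bar>t\<bar> - pi)) \<ge> 0"
  proof (rule sin_ge_zero)
    have "a * (\<bar>t\<bar> - pi) \<le> 1 * pi" using assms False by (intro mult_mono) auto
    then show "a * (\<bar>t\<bar> - pi) \<le> pi" by simp
  qed (use assms False in auto)
  ultimately have "cos (a * \<bar>t\<bar>) \<le> cos (a * (2 * pi - \<bar>t\<bar>))"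
    by (smt (verit) mult_nonneg_nonneg)
  moreover have "cos (a * t) = cos (a * \<bar>t\<bar>)" by (cases "t \<ge> 0") auto
  ultimately show ?thesis using ar by simp
qed

text \<open>
This is \<open>Re (\<zeta> powr a)\<close> for the principal branch: \<open>arccos (Re \<zeta> / norm \<zeta>)\<close> is the absolute value
of the argument. In this form the continuity across the negative real axis is visible.
\<close>

definition slit_power :: "real \<Rightarrow> complex \<Rightarrow> real" where
  "slit_power a \<zeta> = norm \<zeta> powr a * cos (a * arccos (Re \<zeta> / norm \<zeta>))"

lemma slit_power_0 [simp]: "slit_power a 0 = 0"
  by (simp add: slit_power_def)

lemma abs_slit_power_le: "\<bar>slit_power a \<zeta>\<bar> \<le> norm \<zeta> powr a"
  by (simp add: slit_power_def abs_mult mult_left_le)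

lemma Re_over_norm_bounds: "- 1 \<le> Re \<zeta> / norm \<zeta>" "Re \<zeta> / norm \<zeta> \<le> 1"
  using abs_Re_le_cmod[of \<zeta>] by (cases "\<zeta> = 0"; simp add: divide_simps abs_le_iff)+

lemma continuous_on_slit_power:
  assumes "a > 0"
  shows "continuous_on UNIV (slit_power a)"
proof -
  have "isCont (slit_power a) \<zeta>" for \<zeta>
  proof (cases "\<zeta> = 0")
    case False
    have "continuous_on (- {0}) (slit_power a)"
      unfolding slit_power_def
      by (intro continuous_intros ballI conjI Re_over_norm_bounds) auto
    then show ?thesis using False by (simp add: continuous_on_eq_continuous_at open_Compl)
  next
    case True
    have "((\<lambda>\<zeta>. norm \<zeta> powr a) \<longlongrightarrow> norm (0::complex) powr a) (at 0)"
      using assms by (intro tendsto_powr' tendsto_intros) (auto intro!: tendsto_norm_zero)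
    then have "((\<lambda>\<zeta>::complex. norm \<zeta> powr a) \<longlongrightarrow> 0) (at 0)" using assms by simp
    then have "(slit_power a \<longlongrightarrow> 0) (at 0)"
      by (rule Lim_null_comparison[rotated]) (auto simp: abs_slit_power_le)
    then show ?thesis using True by (simp add: isCont_def)
  qed
  then show ?thesis by (simp add: continuous_on_eq_continuous_at)
qed

text \<open>
The branch of \<open>\<zeta> powr a\<close> that agrees with the principal one at \<open>\<zeta>0\<close> is holomorphic in the disk
around \<open>\<zeta>0\<close> that reaches to the origin. Where it leaves the principal sheet, the continued argument
of \<open>\<zeta>\<close> exceeds \<open>pi\<close> in absolute value, and there the principal branch has the larger real part.
\<close>

lemma slit_power_harmonic_minorant:
  assumes a: "0 \<le> a" "a \<le> 1" and z: "\<zeta>0 \<noteq> 0"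
  shows "\<exists>v. v holomorphic_on ball \<zeta>0 (norm \<zeta>0) \<and> (\<forall>\<zeta>\<in>ball \<zeta>0 (norm \<zeta>0). Re (v \<zeta>) \<le> slit_power a \<zeta>) \<and>
             Re (v \<zeta>0) = slit_power a \<zeta>0"
proof -
  define L where "L \<zeta> = Ln (\<zeta> / \<zeta>0) + Ln \<zeta>0" for \<zeta>
  define v where "v \<zeta> = exp (of_real a * L \<zeta>)" for \<zeta>
  have pos: "Re (\<zeta> / \<zeta>0) > 0" if "\<zeta> \<in> ball \<zeta>0 (norm \<zeta>0)" for \<zeta>
  proof -
    have "norm (\<zeta> / \<zeta>0 - 1) < 1"
    proof -
      have "norm (\<zeta> - \<zeta>0) < norm \<zeta>0" using that by (simp add: dist_norm norm_minus_commute)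
      moreover have "\<zeta> / \<zeta>0 - 1 = (\<zeta> - \<zeta>0) / \<zeta>0" using z by (simp add: divide_simps)
      ultimately show ?thesis using z by (simp add: norm_divide)
    qed
    then show ?thesis using abs_Re_le_cmod[of "\<zeta> / \<zeta>0 - 1"] by (simp only: minus_complex.simps one_complex.simps)
  qed
  have expL: "exp (L \<zeta>) = \<zeta>" if "\<zeta> \<noteq> 0" for \<zeta>
    using that z by (simp add: L_def exp_add)
  have Re_v: "Re (v \<zeta>) = norm \<zeta> powr a * cos (a * Im (L \<zeta>))" if "\<zeta> \<noteq> 0" for \<zeta>
  proof -
    have "norm \<zeta> = exp (Re (L \<zeta>))" using expL[OF that] by (metis norm_exp_eq_Re)
    then show ?thesis using that by (simp add: v_def Re_exp powr_def)
  qed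
  have cosL: "Re \<zeta> / norm \<zeta> = cos (Im (L \<zeta>))" if "\<zeta> \<noteq> 0" for \<zeta>
  proof -
    have "norm \<zeta> = exp (Re (L \<zeta>))" using expL[OF that] by (metis norm_exp_eq_Re)
    moreover have "Re \<zeta> = exp (Re (L \<zeta>)) * cos (Im (L \<zeta>))" using expL[OF that] by (metis Re_exp)
    ultimately show ?thesis by simp
  qed
  have "\<zeta> / \<zeta>0 \<notin> \<real>\<^sub>\<le>\<^sub>0" if "\<zeta> \<in> ball \<zeta>0 (norm \<zeta>0)" for \<zeta>
    using pos[OF that] by (auto simp: complex_nonpos_Reals_iff)
  then have "v holomorphic_on ball \<zeta>0 (norm \<zeta>0)"
    unfolding v_def L_def using z by (intro holomorphic_intros) auto
  moreover have "Re (v \<zeta>) \<le> slit_power a \<zeta>" if \<zeta>: "\<zeta> \<in> ball \<zeta>0 (norm \<zeta>0)" for \<zeta>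
  proof -
    have n0: "\<zeta> \<noteq> 0" using \<zeta> by auto
    have "\<bar>Im (Ln (\<zeta> / \<zeta>0))\<bar> < pi / 2" using Im_Ln_pos_lt_imp[of "\<zeta> / \<zeta>0"] pos[OF \<zeta>] n0 z
      by (metis Re_Ln_pos_lt divide_eq_0_iff)
    moreover have "\<bar>Im (Ln \<zeta>0)\<bar> \<le> pi" using mpi_less_Im_Ln[OF z] Im_Ln_le_pi[OF z] by linarith
    ultimately have "\<bar>Im (L \<zeta>)\<bar> \<le> 2 * pi" unfolding L_def plus_complex.simps using pi_gt_zero by linarith
    then show ?thesis
      unfolding Re_v[OF n0] slit_power_def cosL[OF n0]
      using a by (intro mult_left_mono cos_scaled_le_cos_scaled_arccos) auto
  qed
  moreover have "Re (v \<zeta>0) = slit_power a \<zeta>0"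
  proof -
    have L0: "L \<zeta>0 = Ln \<zeta>0" using z by (simp add: L_def)
    have "\<bar>Im (Ln \<zeta>0)\<bar> \<le> pi" using mpi_less_Im_Ln[OF z] Im_Ln_le_pi[OF z] by linarith
    then have "arccos (cos (Im (Ln \<zeta>0))) = \<bar>Im (Ln \<zeta>0)\<bar>" by (metis abs_ge_zero arccos_cos cos_abs_real)
    moreover have "cos (a * \<bar>t\<bar>) = cos (a * t)" for t by (cases "t \<ge> 0") auto
    ultimately show ?thesis unfolding Re_v[OF z] slit_power_def cosL[OF z] L0 by simp
  qed
  ultimately show ?thesis by blast
qed

text \<open>
The minorants above exist away from the origin, so zeros of \<open>\<Phi>\<close> need a separate argument. It
is enough to replace \<open>slit_power a (\<Phi> z)\<close> by the maximum of its values at \<open>\<Phi> z\<close> and at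
\<open>\<Phi> z + \<i> * \<delta>\<close>: because \<open>a < 1\<close>, the function is positive on both imaginary half axes, so whenever
one of these two points is 0 the other one wins. Then \<open>\<delta>\<close> tends to 0.
\<close>

lemma slit_power_submean:
  assumes a: "0 < a" "a < 1" and \<Phi>: "\<Phi> holomorphic_on ball 0 R" and R: "R > 1" and \<Phi>0: "\<Phi> 0 = 0"
  shows "0 \<le> (\<integral>\<zeta>. slit_power a (\<Phi> \<zeta>) \<partial>circle_measure)"
proof -
  define u where "u \<delta> z = max (slit_power a (\<Phi> z)) (slit_power a (\<Phi> z + \<i> * of_real \<delta>))" for \<delta> z
  have c\<Phi>: "continuous_on (cball 0 1) \<Phi>"
    using R by (intro holomorphic_on_imp_continuous_on[OF holomorphic_on_subset[OF \<Phi>]]) auto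
  have cu: "continuous_on (cball 0 1) (u \<delta>)" for \<delta>
    unfolding u_def using a
    by (intro continuous_intros continuous_on_compose2[OF continuous_on_slit_power] c\<Phi>) auto
  have pos_i: "slit_power a (\<i> * of_real s) > 0" if "s \<noteq> 0" for s
  proof -
    have "cos (a * (pi / 2)) > 0" using a by (intro cos_gt_zero) auto
    then show ?thesis using that by (simp add: slit_power_def norm_mult)
  qed
  have u_nonneg: "0 \<le> (\<integral>\<zeta>. u \<delta> \<zeta> \<partial>circle_measure)" if \<delta>: "\<delta> > 0" for \<delta>
  proof -
    have "0 \<le> u \<delta> 0" by (simp add: u_def \<Phi>0)
    also have "u \<delta> 0 \<le> (\<integral>\<zeta>. u \<delta> \<zeta> \<partial>circle_measure)"
    proof (rule touching_submean[OF cu])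
      fix z :: complex assume z: "z \<in> ball 0 1"
      have "\<exists>s\<in>{0, \<delta>}. \<Phi> z + \<i> * of_real s \<noteq> 0 \<and> u \<delta> z = slit_power a (\<Phi> z + \<i> * of_real s)"
      proof (cases "slit_power a (\<Phi> z + \<i> * of_real \<delta>) \<le> slit_power a (\<Phi> z)")
        case True
        have "\<Phi> z \<noteq> 0" using True pos_i[of \<delta>] \<delta> by auto
        with True show ?thesis by (auto simp: u_def)
      next
        case False
        have "\<Phi> z + \<i> * of_real \<delta> \<noteq> 0"
        proof
          assume "\<Phi> z + \<i> * of_real \<delta> = 0"
          moreover from this have "\<Phi> z = \<i> * of_real (- \<delta>)" by (simp add: add_eq_0_iff)
          ultimately show False using False pos_i[of "- \<delta>"] \<delta> by simp
        qed
        with False show ?thesis by (auto simp: u_def)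
      qed
      then obtain s where s: "s \<in> {0, \<delta>}" "\<Phi> z + \<i> * of_real s \<noteq> 0" "u \<delta> z = slit_power a (\<Phi> z + \<i> * of_real s)"
        by blast
      define w where "w = \<Phi> z + \<i> * of_real s"
      obtain v where v: "v holomorphic_on ball w (norm w)" "\<And>\<zeta>. \<zeta> \<in> ball w (norm w) \<Longrightarrow> Re (v \<zeta>) \<le> slit_power a \<zeta>"
        "Re (v w) = slit_power a w"
        using slit_power_harmonic_minorant[of a w] a s(2) by (auto simp: w_def)
      have "isCont \<Phi> z" using c\<Phi> z
        by (metis continuous_on_interior interior_cball)
      then obtain \<rho>0 where \<rho>0: "\<rho>0 > 0" "\<And>y. dist y z < \<rho>0 \<Longrightarrow> dist (\<Phi> y) (\<Phi> z) < norm w"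
        using s(2) unfolding w_def continuous_at_eps_delta by (metis zero_less_norm_iff)
      obtain \<rho>1 where \<rho>1: "\<rho>1 > 0" "ball z \<rho>1 \<subseteq> ball 0 1" using z open_contains_ball open_ball by blast
      define \<rho> where "\<rho> = min \<rho>0 \<rho>1"
      have sub: "\<Phi> y + \<i> * of_real s \<in> ball w (norm w)" if "y \<in> ball z \<rho>" for y
        using \<rho>0(2)[of y] that by (simp add: \<rho>_def w_def dist_commute)
      have "(\<lambda>y. v (\<Phi> y + \<i> * of_real s)) holomorphic_on ball z \<rho>"
      proof (rule holomorphic_on_compose_gen[OF _ v(1), unfolded o_def])
        have "ball z \<rho> \<subseteq> ball 0 R" 
          using \<rho>1(2) R subset_ball[of \<rho> \<rho>1 z] subset_ball[of 1 R 0] by (auto simp: \<rho>_def)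
        then show "(\<lambda>y. \<Phi> y + \<i> * of_real s) holomorphic_on ball z \<rho>"
          by (intro holomorphic_intros holomorphic_on_subset[OF \<Phi>])
      qed (use sub in auto)
      moreover have "Re (v (\<Phi> y + \<i> * of_real s)) \<le> u \<delta> y" if "y \<in> ball z \<rho>" for y
        using v(2)[OF sub[OF that]] s(1) by (auto simp: u_def)
      moreover have "Re (v (\<Phi> z + \<i> * of_real s)) = u \<delta> z" using v(3) s(3) by (simp add: w_def)
      moreover have "\<rho> > 0" using \<rho>0 \<rho>1 by (simp add: \<rho>_def)
      ultimately show "\<exists>\<rho>>0. \<exists>v. v holomorphic_on ball z \<rho> \<and> (\<forall>w\<in>ball z \<rho>. Re (v w) \<le> u \<delta> w) \<and> Re (v z) = u \<delta> z"
        by (intro exI[of _ \<rho>] conjI exI[of _ "\<lambda>y. v (\<Phi> y + \<i> * of_real s)"]) auto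
    qed
    finally show ?thesis .
  qed
  have "bounded (\<Phi> ` cball 0 1)" by (intro compact_imp_bounded compact_continuous_image c\<Phi>) auto
  then obtain B where B: "\<And>z. z \<in> cball 0 1 \<Longrightarrow> norm (\<Phi> z) \<le> B" unfolding bounded_iff by blast
  have "(\<lambda>n. \<integral>\<zeta>. u (inverse (Suc n)) \<zeta> \<partial>circle_measure) \<longlonglongrightarrow> (\<integral>\<zeta>. slit_power a (\<Phi> \<zeta>) \<partial>circle_measure)"
  proof (rule integral_dominated_convergence[where w = "\<lambda>_. (B + 1) powr a"])
    have sub: "sphere 0 1 \<subseteq> cball (0::complex) 1" by auto
    show "(\<lambda>\<zeta>. slit_power a (\<Phi> \<zeta>)) \<in> borel_measurable circle_measure"
      using a by (intro borel_measurable_circle_continuous continuous_on_compose2[OF continuous_on_slit_power]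
         continuous_on_subset[OF c\<Phi> sub]) auto
    show "u (inverse (Suc n)) \<in> borel_measurable circle_measure" for n
      by (intro borel_measurable_circle_continuous continuous_on_subset[OF cu sub])
    show "AE \<zeta> in circle_measure. (\<lambda>n. u (inverse (Suc n)) \<zeta>) \<longlonglongrightarrow> slit_power a (\<Phi> \<zeta>)"
    proof (rule AE_I2)
      fix \<zeta>
      have "(\<lambda>n. \<Phi> \<zeta> + \<i> * of_real (inverse (real (Suc n)))) \<longlonglongrightarrow> \<Phi> \<zeta> + \<i> * of_real 0"
        by (intro tendsto_intros LIMSEQ_inverse_real_of_nat)
      moreover have "isCont (slit_power a) (\<Phi> \<zeta>)" using continuous_on_slit_power[OF a(1)]
        by (simp add: continuous_on_eq_continuous_at)
      ultimately have "(\<lambda>n. slit_power a (\<Phi> \<zeta> + \<i> * of_real (inverse (real (Suc n))))) \<longlonglongrightarrow> slit_power a (\<Phi> \<zeta>)"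
        using isCont_tendsto_compose by fastforce
      then have "(\<lambda>n. u (inverse (Suc n)) \<zeta>) \<longlonglongrightarrow> max (slit_power a (\<Phi> \<zeta>)) (slit_power a (\<Phi> \<zeta>))"
        unfolding u_def by (intro tendsto_max tendsto_const)
      then show "(\<lambda>n. u (inverse (Suc n)) \<zeta>) \<longlonglongrightarrow> slit_power a (\<Phi> \<zeta>)" by simp
    qed
    show "AE \<zeta> in circle_measure. norm (u (inverse (Suc n)) \<zeta>) \<le> (B + 1) powr a" for n
    proof (rule AE_I2)
      fix \<zeta> :: complex assume "\<zeta> \<in> space circle_measure"
      then have b: "norm (\<Phi> \<zeta>) \<le> B" using B by auto
      have "norm (\<Phi> \<zeta> + \<i> * of_real (inverse (real (Suc n)))) \<le> norm (\<Phi> \<zeta>) + norm (\<i> * of_real (inverse (real (Suc n))))"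
        by (rule norm_triangle_ineq)
      also have "norm (\<i> * of_real (inverse (real (Suc n))) :: complex) \<le> 1"
        by (simp only: norm_mult norm_ii norm_of_real) (simp add: inverse_le_1_iff)
      finally have b': "norm (\<Phi> \<zeta> + \<i> * of_real (inverse (real (Suc n)))) \<le> B + 1" using b by simp
      have "\<bar>slit_power a (\<Phi> \<zeta>)\<bar> \<le> (B + 1) powr a" 
        using abs_slit_power_le[of a "\<Phi> \<zeta>"] powr_mono2[of a "norm (\<Phi> \<zeta>)" "B + 1"] a b by simp
      moreover have "\<bar>slit_power a (\<Phi> \<zeta> + \<i> * of_real (inverse (real (Suc n))))\<bar> \<le> (B + 1) powr a" 
        using abs_slit_power_le[of a "\<Phi> \<zeta> + \<i> * of_real (inverse (real (Suc n)))"]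
          powr_mono2[OF less_imp_le[OF a(1)] norm_ge_zero b'] by linarith
      ultimately show "norm (u (inverse (Suc n)) \<zeta>) \<le> (B + 1) powr a" 
        by (simp add: u_def abs_le_iff max_def)
    qed
  qed auto
  then show ?thesis
    by (rule LIMSEQ_le_const) (auto intro!: u_nonneg)
qed

section \<open>The pointwise inequality and the range 1 < p <= 2\<close>

text \<open>
After division by \<open>cos t powr p\<close> the difference of both sides has a derivative whose sign is that
of \<open>D - sin t powr (p - 1) / sin ((p - 1) * t)\<close>, where \<open>D = sin t0 powr (p - 1) / cos t0\<close>. The
quotient is decreasing in \<open>t\<close>, since \<open>cot ((p - 1) * t) \<ge> cot t\<close>, and equals \<open>D\<close> at \<open>t0\<close>. Hence
the difference is minimal at \<open>t0\<close>, where it vanishes.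
\<close>

lemma pichorides_inequality:
  fixes p t :: real
  assumes p: "1 < p" "p \<le> 2" and t: "0 \<le> t" "t \<le> pi / 2"
  defines "t0 \<equiv> pi / (2 * p)"
  shows "sin t powr p \<le> tan t0 powr p * cos t powr p - (sin t0 powr (p - 1) / cos t0) * cos (p * t)"
proof -
  have t0: "0 < t0" "t0 < pi / 2" "p * t0 = pi / 2" using p by (auto simp: t0_def divide_simps)
  define D where "D = sin t0 powr (p - 1) / cos t0"
  have pos0: "sin t0 > 0" "cos t0 > 0" "tan t0 > 0" 
    using t0 by (auto intro!: sin_gt_zero2 cos_gt_zero tan_gt_zero)
  define M where "M t = tan t0 powr p - tan t powr p - D * (cos (p * t) / cos t powr p)" for t
  define M' where "M' t = p / cos t powr (p + 1) * (D * sin ((p - 1) * t) - sin t powr (p - 1))" for t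
  have der: "(M has_real_derivative M' t) (at t)" if "0 < t" "t < pi / 2" for t
  proof -
    have c: "cos t > 0" "sin t > 0" "tan t > 0"
      using that by (auto intro!: sin_gt_zero2 cos_gt_zero tan_gt_zero)
    have tanp: "tan t powr (p - 1) = sin t powr (p - 1) / cos t powr (p - 1)"
      using c by (simp add: tan_def powr_divide)
    have e1: "cos t powr (p + 1) = cos t powr (p - 1) * (cos t)\<^sup>2"
      using c powr_add[of "cos t" "p - 1" 2] by (simp add: add.commute)
    have e2: "cos t powr p = cos t powr (p - 1) * cos t"
      using c powr_add[of "cos t" "p - 1" 1] by simp
    have s: "sin ((p - 1) * t) = sin (p * t) * cos t - cos (p * t) * sin t"
      by (simp add: left_diff_distrib sin_diff)
    have "(M has_real_derivative - (p * tan t powr (p - 1) * inverse ((cos t)\<^sup>2)) -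
        D * ((- sin (p * t) * p * cos t powr p - cos (p * t) * (p * cos t powr (p - 1) * (- sin t))) / (cos t powr p * cos t powr p))) (at t)"
      unfolding M_def using c
      by (auto intro!: derivative_eq_intros) (simp add: algebra_simps)
    also have "- (p * tan t powr (p - 1) * inverse ((cos t)\<^sup>2)) -
        D * ((- sin (p * t) * p * cos t powr p - cos (p * t) * (p * cos t powr (p - 1) * (- sin t))) / (cos t powr p * cos t powr p)) = M' t"
      unfolding M'_def s tanp e1 e2 using c by (simp add: field_simps power2_eq_square)
    finally show ?thesis .
  qed
  define S where "S t = sin t powr (p - 1) / sin ((p - 1) * t)" for t
  have sinpos: "sin ((p - 1) * t) > 0" if "0 < t" "t < pi / 2" for t
  proof (rule sin_gt_zero)
    have "(p - 1) * t \<le> 1 * t" using p that by (intro mult_right_mono) auto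
    then show "(p - 1) * t < pi" using that by linarith
  qed (use p that in auto)
  have S_mono: "S y \<le> S x" if xy: "0 < x" "x \<le> y" "y < pi / 2" for x y
  proof (rule DERIV_nonpos_imp_nonincreasing[OF xy(2)])
    fix s assume "x \<le> s" "s \<le> y"
    then have s: "0 < s" "s < pi / 2" using xy by auto
    have c: "cos s > 0" "sin s > 0" using s by (auto intro!: sin_gt_zero2 cos_gt_zero)
    let ?d = "((p - 1) * sin s powr (p - 1 - 1) * cos s * sin ((p - 1) * s) -
         sin s powr (p - 1) * (cos ((p - 1) * s) * (p - 1))) / (sin ((p - 1) * s) * sin ((p - 1) * s))"
    have "(S has_real_derivative ?d) (at s)"
      unfolding S_def using c sinpos[OF s] by (auto intro!: derivative_eq_intros)
    moreover have "?d \<le> 0"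
    proof -
      have e: "sin s powr (p - 1) = sin s powr (p - 1 - 1) * sin s"
        using c powr_add[of "sin s" "p - 1 - 1" 1] by simp
      have "(p - 1) * s \<le> 1 * s" using p s by (intro mult_right_mono) auto
      moreover have "(p - 1) * s \<ge> 0" using p s by simp
      ultimately have "sin (s - (p - 1) * s) \<ge> 0" using s by (intro sin_ge_zero) auto
      then have "sin s * cos ((p - 1) * s) - cos s * sin ((p - 1) * s) \<ge> 0" by (simp add: sin_diff)
      then have "(p - 1) * sin s powr (p - 1 - 1) * (sin s * cos ((p - 1) * s) - cos s * sin ((p - 1) * s)) \<ge> 0"
        using p by (intro mult_nonneg_nonneg) auto
      then show ?thesis using sinpos[OF s] unfolding e
        by (intro divide_nonpos_pos) (auto simp: algebra_simps)
    qed
    ultimately show "\<exists>y. (S has_real_derivative y) (at s) \<and> y \<le> 0" by blast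
  qed
  have "sin ((p - 1) * t0) = cos t0"
    by (simp only: left_diff_distrib t0(3) mult_1 sin_diff) simp
  then have S0: "S t0 = D" by (simp add: S_def D_def)
  have M0: "M t0 = 0" unfolding M_def t0(3) by simp
  have M'_sign: "M' t = p / cos t powr (p + 1) * sin ((p - 1) * t) * (D - S t)" if "0 < t" "t < pi / 2" for t
  proof -
    have "sin ((p - 1) * t) * (D - S t) = D * sin ((p - 1) * t) - sin t powr (p - 1)"
      using sinpos[OF that] by (simp only: S_def right_diff_distrib) simp
    then show ?thesis by (simp only: M'_def mult.assoc)
  qed
  have coef: "p / cos t powr (p + 1) * sin ((p - 1) * t) \<ge> 0" if "0 < t" "t < pi / 2" for t
    using sinpos[OF that] p by simp
  have M_nonneg: "M t \<ge> 0" if t: "0 < t" "t < pi / 2" for t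
  proof (cases "t \<le> t0")
    case True
    have "M t0 \<le> M t"
    proof (rule DERIV_nonpos_imp_nonincreasing[OF True])
      fix s assume s: "t \<le> s" "s \<le> t0"
      then have s': "0 < s" "s < pi / 2" using t t0 by auto
      have "M' s \<le> 0" unfolding M'_sign[OF s']
        using S_mono[of s t0] s s' t0 S0 by (intro mult_nonneg_nonpos coef) auto
      then show "\<exists>y. (M has_real_derivative y) (at s) \<and> y \<le> 0" using der[OF s'] by blast
    qed
    then show ?thesis using M0 by simp
  next
    case False
    then have le: "t0 \<le> t" by simp
    have "M t0 \<le> M t"
    proof (rule DERIV_nonneg_imp_nondecreasing[OF le])
      fix s assume s: "t0 \<le> s" "s \<le> t"
      then have s': "0 < s" "s < pi / 2" using t t0 by auto
      have "M' s \<ge> 0" unfolding M'_sign[OF s']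
        using S_mono[of t0 s] s s' t0 S0 by (intro mult_nonneg_nonneg coef) auto
      then show "\<exists>y. (M has_real_derivative y) (at s) \<and> 0 \<le> y" using der[OF s'] by blast
    qed
    then show ?thesis using M0 by simp
  qed
  \<comment> \<open>The endpoints, at which \<open>M\<close> is not defined or not differentiable, follow by continuity.\<close>
  define N where "N t = tan t0 powr p * cos t powr p - sin t powr p - D * cos (p * t)" for t
  have N_nonneg: "N t \<ge> 0" if t: "t \<in> {0<..<pi / 2}" for t
  proof -
    have c: "cos t > 0" "sin t > 0" using t by (auto intro!: sin_gt_zero2 cos_gt_zero)
    then have "N t = M t * cos t powr p" by (simp add: N_def M_def tan_def powr_divide field_simps)
    then show ?thesis using M_nonneg[of t] t by simp
  qed
  have "continuous_on {0..pi/2} N"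
    unfolding N_def using p
    by (intro continuous_intros continuous_on_powr') (auto intro!: sin_ge_zero cos_ge_zero)
  moreover have "closure {0<..<pi/2} = {0..pi/2}" by simp
  ultimately have "N t \<ge> 0"
    using continuous_ge_on_closure[of "{0<..<pi/2}" N t 0] t N_nonneg by simp
  then show ?thesis by (simp add: N_def D_def)
qed

text \<open>
This is the concavity of \<open>s powr \<alpha>\<close> applied to \<open>x = k * (y / k) + (1 - k) * ((x - y) / (1 - k))\<close>,
with equality for \<open>y = k * x\<close>. It is obtained by adding two instances of Young's inequality.
\<close>

lemma powr_reverse_hoelder:
  fixes \<alpha> k x y :: real
  assumes \<alpha>: "0 < \<alpha>" "\<alpha> < 1" and k: "0 < k" "k < 1" and xy: "0 \<le> y" "y \<le> x"
  shows "k powr (\<alpha> - 1) * (1 - k) powr (1 - \<alpha>) * (x - y) powr \<alpha> \<le> k powr (\<alpha> - 1) * x powr \<alpha> - y powr \<alpha>"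
proof (cases "x = 0")
  case True
  then show ?thesis using xy by simp
next
  case False
  then have x: "x > 0" using xy by simp
  have young: "a powr (1 - \<alpha>) * s powr \<alpha> \<le> (1 - \<alpha>) * a + \<alpha> * s" if "a > 0" "s \<ge> 0" for a s
    using Youngs_inequality_0[of "1 - \<alpha>" \<alpha> a s] that \<alpha> by (cases "s = 0") auto
  have "k powr (1 - \<alpha>) * (y / x) powr \<alpha> + (1 - k) powr (1 - \<alpha>) * ((x - y) / x) powr \<alpha>
      \<le> ((1 - \<alpha>) * k + \<alpha> * (y / x)) + ((1 - \<alpha>) * (1 - k) + \<alpha> * ((x - y) / x))"
    using k xy x by (intro add_mono young) auto
  also have "\<dots> = 1" using x by (simp add: field_simps)
  finally have "k powr (1 - \<alpha>) * y powr \<alpha> + (1 - k) powr (1 - \<alpha>) * (x - y) powr \<alpha> \<le> x powr \<alpha>"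
    using xy x by (simp add: powr_divide field_simps)
  then have "k powr (\<alpha> - 1) * (k powr (1 - \<alpha>) * y powr \<alpha> + (1 - k) powr (1 - \<alpha>) * (x - y) powr \<alpha>) \<le> k powr (\<alpha> - 1) * x powr \<alpha>"
    by (intro mult_left_mono) auto
  moreover have "k powr (\<alpha> - 1) * k powr (1 - \<alpha>) = 1"
    using k by (simp flip: powr_add)
  ultimately show ?thesis by (simp add: algebra_simps)
qed

lemma cos_powr_over_cos_decreasing:
  fixes \<alpha> x y :: real
  assumes \<alpha>: "0 < \<alpha>" "\<alpha> < 1" and xy: "0 \<le> x" "x \<le> y" "y < pi / 2"
  shows "cos y powr \<alpha> / cos (\<alpha> * y) \<le> cos x powr \<alpha> / cos (\<alpha> * x)"
proof (rule DERIV_nonpos_imp_nonincreasing[OF xy(2)])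
  fix s assume "x \<le> s" "s \<le> y"
  then have s: "0 \<le> s" "s < pi / 2" using xy by auto
  have c: "cos s > 0" using s by (intro cos_gt_zero_pi) auto
  have as: "\<alpha> * s \<le> s" "\<alpha> * s \<ge> 0" using \<alpha> s by (auto intro!: mult_left_le_one_le)
  then have ca: "cos (\<alpha> * s) > 0" using s by (intro cos_gt_zero_pi) auto
  let ?d = "((\<alpha> * cos s powr (\<alpha> - 1) * (- sin s)) * cos (\<alpha> * s) -
       cos s powr \<alpha> * (- sin (\<alpha> * s) * \<alpha>)) / (cos (\<alpha> * s) * cos (\<alpha> * s))"
  have "((\<lambda>y. cos y powr \<alpha> / cos (\<alpha> * y)) has_real_derivative ?d) (at s)"
    using c ca by (auto intro!: derivative_eq_intros)
  moreover have "?d \<le> 0"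
  proof -
    have e: "cos s powr \<alpha> = cos s powr (\<alpha> - 1) * cos s"
      using c powr_add[of "cos s" "\<alpha> - 1" 1] by simp
    have "sin (s - \<alpha> * s) \<ge> 0" using s as by (intro sin_ge_zero) auto
    then have "\<alpha> * cos s powr (\<alpha> - 1) * (sin s * cos (\<alpha> * s) - cos s * sin (\<alpha> * s)) \<ge> 0"
      using \<alpha> by (simp add: sin_diff)
    then show ?thesis using ca unfolding e
      by (intro divide_nonpos_pos) (auto simp: algebra_simps)
  qed
  ultimately show "\<exists>d. ((\<lambda>y. cos y powr \<alpha> / cos (\<alpha> * y)) has_real_derivative d) (at s) \<and> d \<le> 0" by blast
qed

text \<open>
For \<open>X + Y = m\<close> this is the one-variable inequality at \<open>t = \<theta> / 2\<close>. For larger \<open>X + Y\<close>, with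
\<open>X - Y\<close> fixed, consider \<open>F = T * X powr \<alpha> - Y powr \<alpha>\<close>, where \<open>T = tan t0 powr p\<close> and \<open>\<alpha> = p / 2\<close>.
It increases as long as \<open>k * X \<le> Y\<close>, where \<open>k\<close> is defined by \<open>k powr (\<alpha> - 1) = T\<close>, and this
condition persists once it holds. If it fails at \<open>X + Y = m\<close>, then \<open>F\<close> has an interior minimum,
bounded below by the reverse Hoelder inequality by a multiple of \<open>cos \<theta> powr \<alpha>\<close>. Since
\<open>cos \<theta> powr \<alpha> / cos (\<alpha> * \<theta>)\<close> decreases, the worst angle is the one at which the condition starts
to fail, and there the minimum is again at \<open>X + Y = m\<close>.
\<close>

lemma conjugation_inequality_real:
  fixes p m \<theta> X Y :: real
  assumes p: "1 < p" "p < 2" and \<theta>: "0 \<le> \<theta>" "\<theta> \<le> pi" and m: "m > 0"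
    and XY: "X \<ge> 0" "Y \<ge> 0" "X + Y \<ge> m" "X - Y = m * cos \<theta>"
  defines "t0 \<equiv> pi / (2 * p)"
  shows "Y powr (p / 2) \<le> tan t0 powr p * X powr (p / 2)
           - (sin t0 powr (p - 1) / cos t0) * (m powr (p / 2) * cos (p / 2 * \<theta>))"
proof -
  define \<alpha> where "\<alpha> = p / 2"
  define D where "D = sin t0 powr (p - 1) / cos t0"
  define t where "t = \<theta> / 2"
  define k where "k = tan t0 powr (- (p / (1 - \<alpha>)))"
  have \<alpha>: "0 < \<alpha>" "\<alpha> < 1" "p = 2 * \<alpha>" using p by (auto simp: \<alpha>_def)
  have t0: "pi / 4 < t0" "t0 < pi / 2" using p by (auto simp: t0_def divide_simps)
  have pos0: "sin t0 > 0" "cos t0 > 0"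
    using t0 pi_gt_zero by (auto intro!: sin_gt_zero2 cos_gt_zero simp del: pi_gt_zero)
  have T: "tan t0 > 1" using tan_monotone[of "pi / 4" t0] t0 by (simp add: tan_45)
  have D: "D \<ge> 0" using pos0 by (simp add: D_def)
  have k: "0 < k" "k < 1"
  proof -
    show "0 < k" using T by (simp add: k_def)
    have "- (p / (1 - \<alpha>)) < 0" using \<alpha> p by simp
    then show "k < 1" unfolding k_def using T powr_less_cancel_iff[of "tan t0" "- (p / (1 - \<alpha>))" 0] by simp
  qed
  have kp: "k powr (\<alpha> - 1) = tan t0 powr p"
  proof -
    have "- (p / (1 - \<alpha>)) * (\<alpha> - 1) = p / (1 - \<alpha>) * (1 - \<alpha>)"
      using minus_mult_minus[of "p / (1 - \<alpha>)" "1 - \<alpha>"] by simp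
    also have "\<dots> = p" using \<alpha> by simp
    finally show ?thesis by (simp only: k_def powr_powr)
  qed
  have t: "0 \<le> t" "t \<le> pi / 2" "\<theta> = 2 * t" using \<theta> by (auto simp: t_def)
  \<comment> \<open>The values of \<open>X\<close> and \<open>Y\<close> for which \<open>X + Y = m\<close>.\<close>
  define X0 Y0 where "X0 = m * (cos t)\<^sup>2" and "Y0 = m * (sin t)\<^sup>2"
  have d0: "X0 - Y0 = m * cos \<theta>" 
    unfolding X0_def Y0_def t(3) cos_double by (simp add: algebra_simps)
  have s0: "X0 + Y0 = m" unfolding X0_def Y0_def by (simp flip: distrib_left)
  have XY0: "Y0 \<le> Y" "X = X0 + (Y - Y0)" "X0 \<ge> 0" "Y0 \<ge> 0"
    using d0 s0 XY m by (auto simp: X0_def Y0_def)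
  have sqp: "((x::real)\<^sup>2) powr \<alpha> = x powr p" if "x \<ge> 0" for x
    using that \<alpha>(3) by (cases "x = 0") (auto simp: powr_powr simp flip: powr_numeral)
  have cs: "cos t \<ge> 0" "sin t \<ge> 0" using t by (auto intro!: cos_ge_zero sin_ge_zero)
  have pich: "Y0 powr \<alpha> \<le> tan t0 powr p * X0 powr \<alpha> - D * (m powr \<alpha> * cos (\<alpha> * \<theta>))"
  proof -
    have "sin t powr p \<le> tan t0 powr p * cos t powr p - D * cos (p * t)"
      using pichorides_inequality[of p t] p t by (simp add: D_def t0_def)
    then have "m powr \<alpha> * sin t powr p \<le> m powr \<alpha> * (tan t0 powr p * cos t powr p - D * cos (p * t))"
      by (intro mult_left_mono) auto
    moreover have "X0 powr \<alpha> = m powr \<alpha> * cos t powr p" "Y0 powr \<alpha> = m powr \<alpha> * sin t powr p"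
      using m cs by (simp_all add: X0_def Y0_def powr_mult sqp)
    ultimately show ?thesis by (simp add: t(3) \<alpha>(3) algebra_simps)
  qed
  have "Y powr \<alpha> \<le> tan t0 powr p * X powr \<alpha> - D * (m powr \<alpha> * cos (\<alpha> * \<theta>))"
  proof (cases "k * X0 \<le> Y0")
    case True
    have "Y0 > 0"
    proof (rule ccontr)
      assume "\<not> Y0 > 0"
      then have "Y0 = 0" using XY0 by simp
      then show False using True s0 m k by (simp add: mult_le_0_iff)
    qed
    define F where "F y = tan t0 powr p * (y + (X0 - Y0)) powr \<alpha> - y powr \<alpha>" for y
    have "F Y0 \<le> F Y"
    proof (rule DERIV_nonneg_imp_increasing_open[OF XY0(1)])
      fix y assume y: "Y0 < y" "y < Y"
      define x where "x = y + (X0 - Y0)"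
      have x: "x > 0" "y > 0" using y XY0 \<open>Y0 > 0\<close> by (auto simp: x_def)
      have "(F has_real_derivative tan t0 powr p * (\<alpha> * x powr (\<alpha> - 1)) - \<alpha> * y powr (\<alpha> - 1)) (at y)"
        unfolding F_def using x unfolding x_def by (auto intro!: derivative_eq_intros)
      moreover have "k * x \<le> y"
      proof -
        have "k * (y - Y0) \<le> 1 * (y - Y0)" using y k by (intro mult_right_mono) auto
        then show ?thesis using True by (simp add: x_def algebra_simps)
      qed
      then have "y powr (\<alpha> - 1) \<le> (k * x) powr (\<alpha> - 1)"
        using k x \<alpha> by (intro powr_mono2') auto
      then have "y powr (\<alpha> - 1) \<le> tan t0 powr p * x powr (\<alpha> - 1)" using k x by (simp add: powr_mult kp)
      then have "tan t0 powr p * (\<alpha> * x powr (\<alpha> - 1)) - \<alpha> * y powr (\<alpha> - 1) \<ge> 0"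
        using mult_left_mono[of "y powr (\<alpha> - 1)" "tan t0 powr p * x powr (\<alpha> - 1)" \<alpha>] \<alpha> by (simp add: mult_ac)
      ultimately show "\<exists>d. (F has_real_derivative d) (at y) \<and> 0 \<le> d" by blast
    next
      show "continuous_on {Y0..Y} F"
        unfolding F_def using \<alpha> XY0 by (intro continuous_intros continuous_on_powr') auto
    qed
    moreover have "Y + (X0 - Y0) = X" using XY0(2) by simp
    ultimately show ?thesis using pich by (simp add: F_def)
  next
    case False
    \<comment> \<open>Half the critical angle: \<open>k * (cos t1)\<^sup>2 = (sin t1)\<^sup>2\<close>.\<close>
    define t1 where "t1 = arctan (sqrt k)"
    have t1: "0 < t1" "t1 < pi / 4"
      using k arctan_less_iff[of "sqrt k" 1] by (auto simp: t1_def arctan_one)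
    have tan1: "(tan t1)\<^sup>2 = k" using k by (simp add: t1_def tan_arctan)
    have c1: "cos t1 > 0" "sin t1 > 0" using t1 by (auto intro!: sin_gt_zero2 cos_gt_zero)
    have ks: "(sin t1)\<^sup>2 = k * (cos t1)\<^sup>2" using tan1 c1 by (simp add: tan_def power_divide field_simps)
    have ct: "cos t > 0"
    proof (rule ccontr)
      assume "\<not> cos t > 0"
      then have "X0 = 0" using cs by (simp add: X0_def)
      then show False using False XY0 by simp
    qed
    have "t < t1"
    proof (rule ccontr)
      assume "\<not> t < t1"
      then have "tan t1 \<le> tan t"
      proof (cases "t = t1")
        case False
        have "t < pi / 2" using ct t by (cases "t = pi / 2") auto
        then show ?thesis using False \<open>\<not> t < t1\<close> t1 by (intro less_imp_le tan_monotone) auto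
      qed simp
      moreover have "tan t1 \<ge> 0" using c1 by (simp add: tan_def)
      ultimately have "(tan t1)\<^sup>2 \<le> (tan t)\<^sup>2" by (intro power_mono) auto
      then have "k \<le> (tan t)\<^sup>2" using tan1 by simp
      then have "k * (cos t)\<^sup>2 \<le> (sin t)\<^sup>2" using ct by (simp add: tan_def power_divide pos_le_divide_eq)
      then have "k * X0 \<le> Y0" using m unfolding X0_def Y0_def
        by (metis less_imp_le mult.left_commute mult_left_mono)
      with False show False by simp
    qed
    define A where "A = k powr (\<alpha> - 1) * (1 - k) powr (1 - \<alpha>)"
    have \<theta>c: "cos \<theta> > 0" using \<open>t < t1\<close> t t1 by (intro cos_gt_zero_pi) auto
    have cap: "cos (\<alpha> * \<theta>) > 0"
    proof -
      have "\<alpha> * \<theta> \<le> \<theta>" "\<alpha> * \<theta> \<ge> 0" using \<alpha> \<theta> by (auto intro!: mult_left_le_one_le)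
      then show ?thesis using \<open>t < t1\<close> t t1 by (intro cos_gt_zero_pi) auto
    qed
    have cap1: "cos (\<alpha> * (2 * t1)) > 0"
    proof -
      have "\<alpha> * (2 * t1) \<le> 2 * t1" using \<alpha> t1 by (intro mult_left_le_one_le) auto
      moreover have "\<alpha> * (2 * t1) > 0" using \<alpha> t1 by simp
      ultimately show ?thesis using t1 by (intro cos_gt_zero_pi) linarith+
    qed
    have "D * cos (\<alpha> * (2 * t1)) \<le> A * cos (2 * t1) powr \<alpha>"
    proof -
      have "D * cos (p * t1) \<le> tan t0 powr p * cos t1 powr p - sin t1 powr p"
        using pichorides_inequality[of p t1] p t1 by (simp add: D_def t0_def)
      also have "\<dots> = k powr (\<alpha> - 1) * (cos t1)\<^sup>2 powr \<alpha> - (k * (cos t1)\<^sup>2) powr \<alpha>"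
        using c1 by (simp add: sqp kp flip: ks)
      also have "\<dots> = (k powr (\<alpha> - 1) - k powr \<alpha>) * (cos t1)\<^sup>2 powr \<alpha>"
        using k by (simp add: powr_mult algebra_simps)
      also have "k powr (\<alpha> - 1) - k powr \<alpha> = k powr (\<alpha> - 1) * (1 - k)"
        using k powr_add[of k "\<alpha> - 1" 1] by (simp add: algebra_simps)
      also have "1 - k = (1 - k) powr (1 - \<alpha>) * (1 - k) powr \<alpha>"
        using k by (simp flip: powr_add)
      also have "k powr (\<alpha> - 1) * ((1 - k) powr (1 - \<alpha>) * (1 - k) powr \<alpha>) * (cos t1)\<^sup>2 powr \<alpha>
          = A * ((1 - k) * (cos t1)\<^sup>2) powr \<alpha>"
        using k by (simp add: A_def powr_mult)
      also have "(1 - k) * (cos t1)\<^sup>2 = cos (2 * t1)" unfolding cos_double ks by (simp add: algebra_simps)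
      finally show ?thesis by (simp add: \<alpha>(3) mult_ac)
    qed
    then have "D \<le> A * (cos (2 * t1) powr \<alpha> / cos (\<alpha> * (2 * t1)))" using cap1 by (simp add: field_simps)
    also have "\<dots> \<le> A * (cos \<theta> powr \<alpha> / cos (\<alpha> * \<theta>))"
      using \<alpha> t1 t \<open>t < t1\<close> k by (intro mult_left_mono cos_powr_over_cos_decreasing) (auto simp: A_def)
    finally have "D * cos (\<alpha> * \<theta>) \<le> A * cos \<theta> powr \<alpha>" using cap by (simp add: field_simps)
    then have "m powr \<alpha> * (D * cos (\<alpha> * \<theta>)) \<le> m powr \<alpha> * (A * cos \<theta> powr \<alpha>)" by (intro mult_left_mono) auto
    also have "\<dots> = A * (X - Y) powr \<alpha>" using m \<theta>c by (simp add: XY(4) powr_mult)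
    also have "\<dots> \<le> tan t0 powr p * X powr \<alpha> - Y powr \<alpha>"
    proof -
      have "Y \<le> X" using mult_pos_pos[OF m \<theta>c] XY(4) by linarith
      then show ?thesis
        unfolding A_def kp[symmetric] by (intro powr_reverse_hoelder \<alpha>(1,2) k XY(2))
    qed
    finally show ?thesis by (simp add: algebra_simps)
  qed
  then show ?thesis by (simp add: \<alpha>_def D_def)
qed

text \<open>
With \<open>X = (norm (z + cnj w))\<^sup>2\<close> and \<open>Y = (norm (z - cnj w))\<^sup>2\<close> one has \<open>X - Y = 4 * Re (z * w)\<close> and
\<open>X + Y \<ge> 4 * norm (z * w)\<close>, so both sides depend on the real inequality only. The correction term
is a function of the product \<open>z * w\<close>, and its mean over the circle has a sign when \<open>z * w\<close> is a
holomorphic function vanishing at 0.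
\<close>

lemma conjugation_inequality:
  fixes z w :: complex
  assumes p: "1 < p" "p < 2"
  defines "t0 \<equiv> pi / (2 * p)"
  shows "norm (z - cnj w) powr p \<le> tan t0 powr p * norm (z + cnj w) powr p
           - 2 powr p * (sin t0 powr (p - 1) / cos t0) * slit_power (p / 2) (z * w)"
proof -
  have sq: "(norm x)\<^sup>2 powr (p / 2) = norm x powr p" for x :: complex
    by (cases "x = 0") (auto simp: powr_powr simp flip: powr_numeral)
  have t0: "pi / 4 < t0" "t0 < pi / 2" using p by (auto simp: t0_def divide_simps)
  have T: "tan t0 > 1" using tan_monotone[of "pi / 4" t0] t0 by (simp add: tan_45)
  show ?thesis
  proof (cases "z * w = 0")
    case True
    then have "norm (z - cnj w) = norm (z + cnj w)" by auto
    moreover have "1 * norm (z + cnj w) powr p \<le> tan t0 powr p * norm (z + cnj w) powr p"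
      using T p by (intro mult_right_mono) (auto intro!: ge_one_powr_ge_zero)
    moreover have "slit_power (p / 2) (z * w) = 0" by (simp only: True slit_power_0)
    ultimately show ?thesis by simp
  next
    case False
    define R where "R = norm (z * w)"
    define \<theta> where "\<theta> = arccos (Re (z * w) / R)"
    have R: "R > 0" using False by (simp add: R_def)
    have c: "cos \<theta> = Re (z * w) / R" unfolding \<theta>_def R_def by (intro cos_arccos Re_over_norm_bounds)
    have X: "(norm (z + cnj w))\<^sup>2 = (norm z)\<^sup>2 + (norm w)\<^sup>2 + 2 * Re (z * w)"
      and Y: "(norm (z - cnj w))\<^sup>2 = (norm z)\<^sup>2 + (norm w)\<^sup>2 - 2 * Re (z * w)"
      unfolding cmod_power2 by (simp_all add: power2_eq_square algebra_simps)
    have "(norm z - norm w)\<^sup>2 \<ge> 0" by simp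
    then have am: "(norm z)\<^sup>2 + (norm w)\<^sup>2 \<ge> 2 * R" 
      by (simp add: power2_diff R_def norm_mult)
    have "(norm (z - cnj w))\<^sup>2 powr (p / 2) \<le> tan t0 powr p * (norm (z + cnj w))\<^sup>2 powr (p / 2)
           - (sin t0 powr (p - 1) / cos t0) * ((4 * R) powr (p / 2) * cos (p / 2 * \<theta>))"
      unfolding t0_def
    proof (rule conjugation_inequality_real[OF p])
      show "0 \<le> \<theta>" "\<theta> \<le> pi" unfolding \<theta>_def R_def by (intro arccos_lbound arccos_ubound Re_over_norm_bounds)+
      show "(norm (z + cnj w))\<^sup>2 - (norm (z - cnj w))\<^sup>2 = 4 * R * cos \<theta>"
        unfolding c X Y using R by simp
      show "4 * R \<le> (norm (z + cnj w))\<^sup>2 + (norm (z - cnj w))\<^sup>2" unfolding X Y using am by simp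
    qed (use R in auto)
    moreover have "(4 * R) powr (p / 2) = 2 powr p * R powr (p / 2)"
    proof -
      have "(4::real) = 2 powr 2" by simp
      then have "(4::real) powr (p / 2) = 2 powr p" by (simp only: powr_powr) simp
      then show ?thesis using R by (simp add: powr_mult)
    qed
    ultimately show ?thesis unfolding sq slit_power_def \<theta>_def R_def by (simp add: mult_ac)
  qed
qed

text \<open>
The analytic and co-analytic parts of a harmonic function on a neighbourhood of the closed disk.
For such functions every integral over the circle makes sense without boundary limits; all
sharp estimates are proved here first.
\<close>

definition closed_disk_pair :: "(complex \<Rightarrow> complex) \<Rightarrow> (complex \<Rightarrow> complex) \<Rightarrow> bool" where
  "closed_disk_pair g h \<longleftrightarrow> (\<exists>R>1. g holomorphic_on ball 0 R \<and> h holomorphic_on ball 0 R \<and> h 0 = 0)"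

text \<open>
The factor \<open>- \<i>\<close> of the harmonic conjugate has modulus 1 and is dropped, and \<open>p\<close>-th powers
replace norms.
\<close>

definition conjugation_bound :: "real \<Rightarrow> real \<Rightarrow> bool" where
  "conjugation_bound p C \<longleftrightarrow> (\<forall>g h. closed_disk_pair g h \<longrightarrow>
     circle_power p (\<lambda>\<zeta>. g \<zeta> - cnj (h \<zeta>))
       \<le> C powr p * circle_power p (\<lambda>\<zeta>. g \<zeta> + cnj (h \<zeta>)))"

lemma closed_disk_pair_continuous:
  assumes "closed_disk_pair g h"
  shows "continuous_on (cball 0 1) g" "continuous_on (cball 0 1) h"
proof -
  obtain R where R: "R > 1" "g holomorphic_on ball 0 R" "h holomorphic_on ball 0 R"
    using assms by (auto simp: closed_disk_pair_def)
  have "cball 0 1 \<subseteq> ball (0::complex) R" using R(1) by auto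
  then show "continuous_on (cball 0 1) g" "continuous_on (cball 0 1) h"
    using R by (auto intro!: holomorphic_on_imp_continuous_on intro: holomorphic_on_subset)
qed

lemma closed_disk_pair_continuous_circle:
  assumes "closed_disk_pair g h"
  shows "continuous_on (sphere 0 1) g" "continuous_on (sphere 0 1) h"
  using closed_disk_pair_continuous[OF assms] by (auto intro: continuous_on_subset)

lemma integrable_circle_powr:
  fixes F :: "complex \<Rightarrow> complex"
  assumes "continuous_on (sphere 0 1) F" "p > 0"
  shows "integrable circle_measure (\<lambda>\<zeta>. norm (F \<zeta>) powr p)"
  using assms by (intro integrable_circle_continuous continuous_on_powr' continuous_intros) auto

text \<open>
The pointwise inequality is integrated over the circle; the correction term has the right sign
because \<open>g * h\<close> vanishes at 0. For \<open>p = 2\<close> it reduces to the mean value property of \<open>g * h\<close>.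
\<close>

lemma conjugation_bound_tan:
  assumes p: "1 < p" "p \<le> 2"
  shows "conjugation_bound p (tan (pi / (2 * p)))"
  unfolding conjugation_bound_def
proof (intro allI impI)
  fix g h assume gh: "closed_disk_pair g h"
  obtain R where R: "R > 1" "g holomorphic_on ball 0 R" "h holomorphic_on ball 0 R" "h 0 = 0"
    using gh by (auto simp: closed_disk_pair_def)
  note cont = closed_disk_pair_continuous_circle[OF gh]
  have hol: "(\<lambda>z. g z * h z) holomorphic_on ball 0 R" using R by (intro holomorphic_intros)
  have int: "integrable circle_measure (\<lambda>\<zeta>. norm (g \<zeta> - cnj (h \<zeta>)) powr p)"
      "integrable circle_measure (\<lambda>\<zeta>. norm (g \<zeta> + cnj (h \<zeta>)) powr p)"
    using p by (intro integrable_circle_powr continuous_intros cont; simp)+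
  define t0 where "t0 = pi / (2 * p)"
  have t0: "0 < t0" "t0 < pi / 2" using p by (auto simp: t0_def divide_simps)
  define K where "K = 2 powr p * (sin t0 powr (p - 1) / cos t0)"
  have "cos t0 > 0" using t0 by (intro cos_gt_zero) auto
  then have K: "K \<ge> 0" by (simp add: K_def)
  have sp: "continuous_on (sphere 0 1) (\<lambda>\<zeta>. slit_power (p / 2) (g \<zeta> * h \<zeta>))"
    using p by (intro continuous_on_compose2[OF continuous_on_slit_power] continuous_intros cont) auto
  have mean: "(\<integral>\<zeta>. slit_power (p / 2) (g \<zeta> * h \<zeta>) \<partial>circle_measure) \<ge> 0" if "p < 2"
    using slit_power_submean[of "p / 2", OF _ _ hol R(1)] p that R(4) by simp
  have "circle_power p (\<lambda>\<zeta>. g \<zeta> - cnj (h \<zeta>))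
      \<le> tan t0 powr p * circle_power p (\<lambda>\<zeta>. g \<zeta> + cnj (h \<zeta>))"
  proof (cases "p = 2")
    case True
    have "norm (z - cnj w) powr 2 = norm (z + cnj w) powr 2 - 4 * Re (z * w)" for z w :: complex
      unfolding powr_numeral[OF norm_ge_zero] cmod_power2
      by (simp add: power2_eq_square algebra_simps)
    then have "circle_power p (\<lambda>\<zeta>. g \<zeta> - cnj (h \<zeta>))
        = (\<integral>\<zeta>. norm (g \<zeta> + cnj (h \<zeta>)) powr p - 4 * Re (g \<zeta> * h \<zeta>) \<partial>circle_measure)"
      using True by simp
    also have "\<dots> = circle_power p (\<lambda>\<zeta>. g \<zeta> + cnj (h \<zeta>)) - 4 * Re (\<integral>\<zeta>. g \<zeta> * h \<zeta> \<partial>circle_measure)"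
    proof -
      have i: "integrable circle_measure (\<lambda>\<zeta>. g \<zeta> * h \<zeta>)"
        by (intro integrable_circle_continuous continuous_intros cont)
      then have i': "integrable circle_measure (\<lambda>\<zeta>. 4 * Re (g \<zeta> * h \<zeta>))"
        by (intro integrable_mult_right integrable_Re)
      show ?thesis
        by (simp only: Bochner_Integration.integral_diff[OF int(2) i'] integral_mult_right_zero integral_Re[OF i])
    qed
    also have "(\<integral>\<zeta>. g \<zeta> * h \<zeta> \<partial>circle_measure) = 0"
      using circle_mean_value[OF hol R(1)] R(4) by simp
    finally show ?thesis using True by (simp add: t0_def tan_45)
  next
    case False
    then have p2: "p < 2" using p by simp
    have "circle_power p (\<lambda>\<zeta>. g \<zeta> - cnj (h \<zeta>))
        \<le> (\<integral>\<zeta>. tan t0 powr p * norm (g \<zeta> + cnj (h \<zeta>)) powr p - K * slit_power (p / 2) (g \<zeta> * h \<zeta>) \<partial>circle_measure)"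
      using conjugation_inequality[OF p(1) p2] int integrable_circle_continuous[OF sp]
      by (intro integral_mono Bochner_Integration.integrable_diff) (auto simp: K_def t0_def)
    also have "\<dots> = tan t0 powr p * circle_power p (\<lambda>\<zeta>. g \<zeta> + cnj (h \<zeta>))
        - K * (\<integral>\<zeta>. slit_power (p / 2) (g \<zeta> * h \<zeta>) \<partial>circle_measure)"
      using int(2) integrable_circle_continuous[OF sp] by (subst Bochner_Integration.integral_diff) auto
    also have "\<dots> \<le> tan t0 powr p * circle_power p (\<lambda>\<zeta>. g \<zeta> + cnj (h \<zeta>))"
      using mean[OF p2] K by simp
    finally show ?thesis .
  qed
  then show "circle_power p (\<lambda>\<zeta>. g \<zeta> - cnj (h \<zeta>))
      \<le> tan (pi / (2 * p)) powr p * circle_power p (\<lambda>\<zeta>. g \<zeta> + cnj (h \<zeta>))"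
    by (simp add: t0_def)
qed

section \<open>Duality\<close>

lemma hoelder_circle:
  fixes F G :: "complex \<Rightarrow> complex"
  assumes pq: "1 < p" "1 < q" "1 / p + 1 / q = 1"
    and F: "continuous_on (sphere 0 1) F" and G: "continuous_on (sphere 0 1) G"
  shows "norm (\<integral>\<zeta>. F \<zeta> * G \<zeta> \<partial>circle_measure)
    \<le> circle_power p F powr (1 / p)
      * circle_power q G powr (1 / q)"
proof -
  define A B where "A = circle_power p F"
    and "B = circle_power q G"
  have int: "integrable circle_measure (\<lambda>\<zeta>. norm (F \<zeta>) powr p)" "integrable circle_measure (\<lambda>\<zeta>. norm (G \<zeta>) powr q)"
    using pq F G by (auto intro!: integrable_circle_powr)
  have AB: "A \<ge> 0" "B \<ge> 0" by (simp_all add: A_def B_def)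
  \<comment> \<open>The summand \<open>\<epsilon>\<close> keeps the normalising factors positive when \<open>F\<close> or \<open>G\<close> vanishes.\<close>
  have le: "norm (\<integral>\<zeta>. F \<zeta> * G \<zeta> \<partial>circle_measure) \<le> (A + \<epsilon>) powr (1 / p) * (B + \<epsilon>) powr (1 / q)" if \<epsilon>: "\<epsilon> > 0" for \<epsilon>
  proof -
    define a b where "a = (A + \<epsilon>) powr (1 / p)" and "b = (B + \<epsilon>) powr (1 / q)"
    have ab: "a > 0" "b > 0" using AB \<epsilon> by (auto simp: a_def b_def)
    have abp: "a powr p = A + \<epsilon>" "b powr q = B + \<epsilon>"
      using AB \<epsilon> pq by (auto simp: a_def b_def powr_powr)
    have "norm (\<integral>\<zeta>. F \<zeta> * G \<zeta> \<partial>circle_measure) \<le> (\<integral>\<zeta>. norm (F \<zeta> * G \<zeta>) \<partial>circle_measure)"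
      by (rule integral_norm_bound)
    also have "\<dots> \<le> (\<integral>\<zeta>. a * b * (norm (F \<zeta>) powr p / (p * (A + \<epsilon>)) + norm (G \<zeta>) powr q / (q * (B + \<epsilon>))) \<partial>circle_measure)"
    proof (rule integral_mono)
      show "integrable circle_measure (\<lambda>\<zeta>. norm (F \<zeta> * G \<zeta>))"
        using F G by (intro integrable_circle_continuous continuous_intros)
      show "integrable circle_measure (\<lambda>\<zeta>. a * b * (norm (F \<zeta>) powr p / (p * (A + \<epsilon>)) + norm (G \<zeta>) powr q / (q * (B + \<epsilon>))))"
        using int by (intro integrable_mult_right Bochner_Integration.integrable_add integrable_divide) auto
      show "norm (F \<zeta> * G \<zeta>) \<le> a * b * (norm (F \<zeta>) powr p / (p * (A + \<epsilon>)) + norm (G \<zeta>) powr q / (q * (B + \<epsilon>)))" for \<zeta>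
      proof -
        have "(norm (F \<zeta>) / a) * (norm (G \<zeta>) / b) \<le> (norm (F \<zeta>) / a) powr p / p + (norm (G \<zeta>) / b) powr q / q"
          using ab pq by (intro Youngs_inequality) auto
        also have "\<dots> = norm (F \<zeta>) powr p / (p * (A + \<epsilon>)) + norm (G \<zeta>) powr q / (q * (B + \<epsilon>))"
          using ab by (simp add: powr_divide abp mult.commute)
        finally have "a * b * ((norm (F \<zeta>) / a) * (norm (G \<zeta>) / b)) \<le> a * b * (norm (F \<zeta>) powr p / (p * (A + \<epsilon>)) + norm (G \<zeta>) powr q / (q * (B + \<epsilon>)))"
          using ab by (intro mult_left_mono) auto
        then show ?thesis using ab by (simp add: norm_mult)
      qed
    qed
    also have "\<dots> = a * b * (A / (p * (A + \<epsilon>)) + B / (q * (B + \<epsilon>)))"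
      using int by (simp add: A_def B_def)
    also have "\<dots> \<le> a * b * (1 / p + 1 / q)"
    proof -
      have "A / (p * (A + \<epsilon>)) \<le> 1 / p" "B / (q * (B + \<epsilon>)) \<le> 1 / q" 
        using AB \<epsilon> pq divide_right_mono[of "A / (A + \<epsilon>)" 1 p] divide_right_mono[of "B / (B + \<epsilon>)" 1 q]
        by (simp_all add: mult.commute)
      then show ?thesis using ab by (intro mult_left_mono add_mono) auto
    qed
    also have "\<dots> = a * b" using pq(3) by simp
    finally show ?thesis by (simp add: a_def b_def)
  qed
  have "(\<lambda>n. (A + inverse (real (Suc n))) powr (1 / p) * (B + inverse (real (Suc n))) powr (1 / q)) \<longlonglongrightarrow> (A + 0) powr (1 / p) * (B + 0) powr (1 / q)"
    using pq AB by (intro tendsto_intros tendsto_powr' LIMSEQ_inverse_real_of_nat) (auto intro!: always_eventually add_nonneg_nonneg)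
  then have "norm (\<integral>\<zeta>. F \<zeta> * G \<zeta> \<partial>circle_measure) \<le> (A + 0) powr (1 / p) * (B + 0) powr (1 / q)"
    by (rule LIMSEQ_le_const) (auto intro!: le)
  then show ?thesis by (simp add: A_def B_def)
qed

text \<open>
Conjugation multiplies analytic terms by 1 and co-analytic terms by -1 and is therefore
symmetric for the pairing: the mixed terms \<open>g * b\<close> and \<open>cnj (a * h)\<close> have mean 0.
\<close>

lemma conjugation_duality_pairing:
  assumes gh: "closed_disk_pair g h" and ab: "closed_disk_pair a b"
  shows "(\<integral>\<zeta>. (g \<zeta> - cnj (h \<zeta>)) * cnj (a \<zeta> + cnj (b \<zeta>)) \<partial>circle_measure)
       = (\<integral>\<zeta>. (g \<zeta> + cnj (h \<zeta>)) * cnj (a \<zeta> - cnj (b \<zeta>)) \<partial>circle_measure)"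
proof -
  note cont = closed_disk_pair_continuous_circle[OF gh] closed_disk_pair_continuous_circle[OF ab]
  have mean0: "(\<integral>\<zeta>. f \<zeta> * k \<zeta> \<partial>circle_measure) = 0" if nice: "closed_disk_pair f' k" "closed_disk_pair f k'" for f f' k k'
  proof -
    obtain R where R: "R > 1" "k holomorphic_on ball 0 R" "k 0 = 0"
      using nice by (auto simp: closed_disk_pair_def)
    obtain R' where R': "R' > 1" "f holomorphic_on ball 0 R'"
      using nice by (auto simp: closed_disk_pair_def)
    have "(\<lambda>\<zeta>. f \<zeta> * k \<zeta>) holomorphic_on ball 0 (min R R')"
      by (intro holomorphic_intros holomorphic_on_subset[OF R(2)] holomorphic_on_subset[OF R'(2)]) auto
    from circle_mean_value[OF this] show ?thesis using R R' by simp
  qed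
  have i: "integrable circle_measure (\<lambda>\<zeta>. 2 * (g \<zeta> * b \<zeta>))" "integrable circle_measure (\<lambda>\<zeta>. 2 * cnj (a \<zeta> * h \<zeta>))"
    "integrable circle_measure (\<lambda>\<zeta>. (g \<zeta> + cnj (h \<zeta>)) * cnj (a \<zeta> - cnj (b \<zeta>)))"
    by (intro integrable_circle_continuous continuous_intros cont)+
  have "(\<integral>\<zeta>. (g \<zeta> - cnj (h \<zeta>)) * cnj (a \<zeta> + cnj (b \<zeta>)) \<partial>circle_measure)
     = (\<integral>\<zeta>. (g \<zeta> + cnj (h \<zeta>)) * cnj (a \<zeta> - cnj (b \<zeta>)) + 2 * (g \<zeta> * b \<zeta>) - 2 * cnj (a \<zeta> * h \<zeta>) \<partial>circle_measure)"
    by (intro Bochner_Integration.integral_cong) (auto simp: algebra_simps)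
  also have "\<dots> = (\<integral>\<zeta>. (g \<zeta> + cnj (h \<zeta>)) * cnj (a \<zeta> - cnj (b \<zeta>)) \<partial>circle_measure)
      + 2 * (\<integral>\<zeta>. g \<zeta> * b \<zeta> \<partial>circle_measure) - 2 * cnj (\<integral>\<zeta>. a \<zeta> * h \<zeta> \<partial>circle_measure)"
    by (simp only: Bochner_Integration.integral_diff[OF Bochner_Integration.integrable_add[OF i(3) i(1)] i(2)]
         Bochner_Integration.integral_add[OF i(3) i(1)] integral_mult_right_zero Bochner_Integration.integral_cnj)
  also have "\<dots> = (\<integral>\<zeta>. (g \<zeta> + cnj (h \<zeta>)) * cnj (a \<zeta> - cnj (b \<zeta>)) \<partial>circle_measure)"
    using mean0[OF ab gh] mean0[OF gh ab] by simp
  finally show ?thesis .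
qed

text \<open>
With \<open>D = g - cnj h\<close>, the function \<open>\<psi> = norm D powr (p - 1) * sgn D\<close> satisfies
\<open>D * cnj \<psi> = norm D powr p\<close> and \<open>norm \<psi> powr q = norm D powr p\<close>. It is only continuous, so it is
approximated uniformly by harmonic polynomials, to which the symmetry of conjugation, Hoelder's
inequality and the bound for the exponent \<open>q\<close> apply.
\<close>

lemma conjugation_bound_duality:
  assumes pq: "1 < p" "1 < q" "1 / p + 1 / q = 1" and C: "C \<ge> 0" and bound: "conjugation_bound q C"
  shows "conjugation_bound p C"
  unfolding conjugation_bound_def
proof (intro allI impI)
  fix g h assume gh: "closed_disk_pair g h"
  note cont = closed_disk_pair_continuous_circle[OF gh]
  define D S where "D \<zeta> = g \<zeta> - cnj (h \<zeta>)" and "S \<zeta> = g \<zeta> + cnj (h \<zeta>)" for \<zeta>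
  have cD: "continuous_on (sphere 0 1) D" and cS: "continuous_on (sphere 0 1) S"
    unfolding D_def S_def by (intro continuous_intros cont)+
  define \<psi> where "\<psi> \<zeta> = of_real (norm (D \<zeta>) powr (p - 1)) * sgn (D \<zeta>)" for \<zeta>
  have norm_\<psi>: "norm (\<psi> \<zeta>) = norm (D \<zeta>) powr (p - 1)" for \<zeta>
    by (cases "D \<zeta> = 0") (auto simp: \<psi>_def norm_mult norm_sgn)
  have pq': "(p - 1) * q = p" using pq by (simp add: field_simps)
  have \<psi>q: "norm (\<psi> \<zeta>) powr q = norm (D \<zeta>) powr p" for \<zeta>
    by (simp add: norm_\<psi> powr_powr pq')
  have D\<psi>: "D \<zeta> * cnj (\<psi> \<zeta>) = of_real (norm (D \<zeta>) powr p)" for \<zeta>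
  proof (cases "D \<zeta> = 0")
    case False
    have "D \<zeta> * cnj (\<psi> \<zeta>) = of_real (norm (D \<zeta>) powr (p - 1)) * (D \<zeta> * cnj (D \<zeta>) / of_real (norm (D \<zeta>)))"
      by (simp add: \<psi>_def sgn_eq)
    also have "\<dots> = of_real (norm (D \<zeta>) powr (p - 1) * norm (D \<zeta>))"
      using False by (simp add: complex_norm_square[symmetric] power2_eq_square)
    also have "norm (D \<zeta>) powr (p - 1) * norm (D \<zeta>) = norm (D \<zeta>) powr p"
      using False powr_add[of "norm (D \<zeta>)" "p - 1" 1] by simp
    finally show ?thesis .
  qed (simp add: \<psi>_def)
  have c\<psi>: "continuous_on (sphere 0 1) \<psi>"
  proof -
    have "isCont (\<lambda>z::complex. of_real (norm z powr (p - 1)) * sgn z) z" for z :: complex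
    proof (cases "z = 0")
      case True
      have "((\<lambda>z::complex. norm z powr (p - 1)) \<longlongrightarrow> norm (0::complex) powr (p - 1)) (at 0)"
        using pq by (intro tendsto_powr' tendsto_intros) (auto intro!: tendsto_norm_zero)
      then have "((\<lambda>z::complex. norm z powr (p - 1)) \<longlongrightarrow> 0) (at 0)" using pq by simp
      then have "((\<lambda>z::complex. of_real (norm z powr (p - 1)) * sgn z) \<longlongrightarrow> 0) (at 0)"
        by (rule Lim_null_comparison[rotated]) (auto simp: norm_mult norm_sgn)
      then show ?thesis using True by (simp add: isCont_def)
    next
      case False
      then show ?thesis by (auto intro!: continuous_intros)
    qed
    then have "continuous_on UNIV (\<lambda>z::complex. of_real (norm z powr (p - 1)) * sgn z)"
      by (simp add: continuous_on_eq_continuous_at)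
    from continuous_on_compose2[OF this cD] show ?thesis by (simp add: \<psi>_def[abs_def])
  qed
  define I J where "I = circle_power p D" and "J = circle_power p S"
  have IJ: "I \<ge> 0" "J \<ge> 0" by (simp_all add: I_def J_def)
  have "\<exists>a b. closed_disk_pair a b \<and> (\<forall>\<zeta>\<in>sphere 0 1. norm (\<psi> \<zeta> - (a \<zeta> + cnj (b \<zeta>))) < inverse (real (Suc n)))" for n
  proof -
    have pos: "inverse (real (Suc n)) > 0" by simp
    obtain a b :: "complex poly" where "poly b 0 = 0"
      "\<And>\<zeta>. \<zeta> \<in> sphere 0 1 \<Longrightarrow> norm (\<psi> \<zeta> - (poly a \<zeta> + cnj (poly b \<zeta>))) < inverse (real (Suc n))"
      using circle_approx_harmonic_poly[OF c\<psi> pos] by blast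
    then show ?thesis
      by (intro exI[of _ "poly a"] exI[of _ "poly b"])
         (auto simp: closed_disk_pair_def intro!: exI[of _ 2] holomorphic_intros)
  qed
  then obtain a b where ab: "\<And>n. closed_disk_pair (a n) (b n)"
    and approx: "\<And>n \<zeta>. \<zeta> \<in> sphere 0 1 \<Longrightarrow> norm (\<psi> \<zeta> - (a n \<zeta> + cnj (b n \<zeta>))) < inverse (real (Suc n))"
    by metis
  define \<tau> where "\<tau> n \<zeta> = a n \<zeta> + cnj (b n \<zeta>)" for n \<zeta>
  have c\<tau>: "continuous_on (sphere 0 1) (\<tau> n)" for n
    unfolding \<tau>_def by (intro continuous_intros closed_disk_pair_continuous_circle[OF ab])
  have lim: "(\<lambda>n. \<tau> n \<zeta>) \<longlonglongrightarrow> \<psi> \<zeta>" if "\<zeta> \<in> sphere 0 1" for \<zeta>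
  proof (rule LIM_zero_cancel, rule Lim_null_comparison[OF _ LIMSEQ_inverse_real_of_nat])
    show "\<forall>\<^sub>F n in sequentially. norm (\<tau> n \<zeta> - \<psi> \<zeta>) \<le> inverse (real (Suc n))"
      using approx[OF that] by (auto simp: \<tau>_def norm_minus_commute less_imp_le intro!: always_eventually)
  qed
  obtain B where B: "\<And>\<zeta>. \<zeta> \<in> sphere 0 1 \<Longrightarrow> norm (\<psi> \<zeta>) \<le> B"
    using compact_imp_bounded[OF compact_continuous_image[OF c\<psi> compact_sphere]] unfolding bounded_iff by blast
  obtain B' where B': "\<And>\<zeta>. \<zeta> \<in> sphere 0 1 \<Longrightarrow> norm (D \<zeta>) \<le> B'"
    using compact_imp_bounded[OF compact_continuous_image[OF cD compact_sphere]] unfolding bounded_iff by blast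
  have \<tau>B: "norm (\<tau> n \<zeta>) \<le> B + 1" if "\<zeta> \<in> sphere 0 1" for n \<zeta>
  proof -
    have "norm (\<tau> n \<zeta>) \<le> norm (\<psi> \<zeta>) + norm (\<psi> \<zeta> - \<tau> n \<zeta>)"
      by (metis norm_triangle_sub norm_minus_commute)
    also have "norm (\<psi> \<zeta> - \<tau> n \<zeta>) \<le> inverse (real (Suc n))"
      using approx[OF that] by (simp add: \<tau>_def less_imp_le)
    also have "inverse (real (Suc n)) \<le> 1" by (simp add: inverse_le_1_iff)
    finally show ?thesis using B[OF that] by simp
  qed
  have step: "norm (\<integral>\<zeta>. D \<zeta> * cnj (\<tau> n \<zeta>) \<partial>circle_measure)
      \<le> J powr (1 / p) * (C * circle_power q (\<tau> n) powr (1 / q))" for n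
  proof -
    define T where "T = circle_power q (\<tau> n)"
    define U where "U = circle_power q (\<lambda>\<zeta>. a n \<zeta> - cnj (b n \<zeta>))"
    have TU: "T \<ge> 0" "U \<ge> 0" by (simp_all add: T_def U_def)
    have "norm (\<integral>\<zeta>. D \<zeta> * cnj (\<tau> n \<zeta>) \<partial>circle_measure)
        = norm (\<integral>\<zeta>. S \<zeta> * cnj (a n \<zeta> - cnj (b n \<zeta>)) \<partial>circle_measure)"
      unfolding D_def S_def \<tau>_def using conjugation_duality_pairing[OF gh ab] by simp
    also have "\<dots> \<le> J powr (1 / p) * circle_power q (\<lambda>\<zeta>. cnj (a n \<zeta> - cnj (b n \<zeta>))) powr (1 / q)"
      unfolding J_def
      by (intro hoelder_circle pq cS continuous_intros closed_disk_pair_continuous_circle[OF ab])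
    also have "circle_power q (\<lambda>\<zeta>. cnj (a n \<zeta> - cnj (b n \<zeta>))) = U"
      by (simp only: complex_mod_cnj U_def)
    also have "U powr (1 / q) \<le> C * T powr (1 / q)"
    proof -
      have "U \<le> C powr q * T" using bound ab unfolding conjugation_bound_def U_def T_def \<tau>_def by blast
      then have "U powr (1 / q) \<le> (C powr q * T) powr (1 / q)" using TU pq by (intro powr_mono2) auto
      also have "\<dots> = C * T powr (1 / q)" using C pq TU by (simp add: powr_mult powr_powr)
      finally show ?thesis .
    qed
    finally show ?thesis by (simp add: T_def mult_left_mono)
  qed
  have lim1: "(\<lambda>n. norm (\<integral>\<zeta>. D \<zeta> * cnj (\<tau> n \<zeta>) \<partial>circle_measure)) \<longlonglongrightarrow> norm (\<integral>\<zeta>. D \<zeta> * cnj (\<psi> \<zeta>) \<partial>circle_measure)"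
  proof (intro tendsto_norm integral_dominated_convergence[where w = "\<lambda>_. B' * (B + 1)"])
    show "AE \<zeta> in circle_measure. norm (D \<zeta> * cnj (\<tau> n \<zeta>)) \<le> B' * (B + 1)" for n
      using \<tau>B B' by (intro AE_I2) (auto simp: norm_mult intro!: mult_mono order_trans[OF norm_ge_zero])
    show "AE \<zeta> in circle_measure. (\<lambda>n. D \<zeta> * cnj (\<tau> n \<zeta>)) \<longlonglongrightarrow> D \<zeta> * cnj (\<psi> \<zeta>)"
      by (intro AE_I2 tendsto_intros lim) simp
  qed (auto intro!: borel_measurable_circle_continuous continuous_intros cD c\<psi> c\<tau>)
  have lim2: "(\<lambda>n. circle_power q (\<tau> n)) \<longlonglongrightarrow> circle_power q \<psi>"
  proof (intro integral_dominated_convergence[where w = "\<lambda>_. (B + 1) powr q"])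
    show "AE \<zeta> in circle_measure. norm (norm (\<tau> n \<zeta>) powr q) \<le> (B + 1) powr q" for n
      using \<tau>B pq by (intro AE_I2) (auto intro!: powr_mono2)
    show "AE \<zeta> in circle_measure. (\<lambda>n. norm (\<tau> n \<zeta>) powr q) \<longlonglongrightarrow> norm (\<psi> \<zeta>) powr q"
      using pq by (intro AE_I2 tendsto_powr' tendsto_intros lim) auto
  qed (use pq in \<open>auto intro!: borel_measurable_integrable integrable_circle_powr c\<psi> c\<tau>\<close>)
  have lim3: "(\<lambda>n. J powr (1 / p) * (C * circle_power q (\<tau> n) powr (1 / q)))
      \<longlonglongrightarrow> J powr (1 / p) * (C * circle_power q \<psi> powr (1 / q))"
    using pq by (intro tendsto_mult tendsto_const tendsto_powr' lim2) auto
  have "norm (\<integral>\<zeta>. D \<zeta> * cnj (\<psi> \<zeta>) \<partial>circle_measure)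
      \<le> J powr (1 / p) * (C * circle_power q \<psi> powr (1 / q))"
    using step by (intro LIMSEQ_le[OF lim1 lim3]) blast
  then have main: "I \<le> J powr (1 / p) * (C * I powr (1 / q))"
    unfolding D\<psi> \<psi>q by (simp add: I_def)
  have "I \<le> C powr p * J"
  proof (cases "I = 0")
    case True
    then show ?thesis using IJ by simp
  next
    case False
    then have I: "I > 0" using IJ by simp
    have "I powr (1 / p) * I powr (1 / q) = I" using I pq(3) by (simp flip: powr_add)
    then have "I powr (1 / p) * I powr (1 / q) \<le> (J powr (1 / p) * C) * I powr (1 / q)"
      using main by (simp add: mult_ac)
    then have "I powr (1 / p) \<le> J powr (1 / p) * C" using I by simp
    then have "(I powr (1 / p)) powr p \<le> (J powr (1 / p) * C) powr p" using pq by (intro powr_mono2) auto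
    then show ?thesis using IJ I C pq by (simp add: powr_powr powr_mult mult_ac)
  qed
  then show "circle_power p (\<lambda>\<zeta>. g \<zeta> - cnj (h \<zeta>))
       \<le> C powr p * circle_power p (\<lambda>\<zeta>. g \<zeta> + cnj (h \<zeta>))"
    by (simp add: I_def J_def D_def S_def)
qed

section \<open>Sharpness\<close>

lemma cayley_Re_pos:
  fixes z :: complex
  assumes "norm z < 1"
  shows "Re ((1 + z) / (1 - z)) > 0"
proof -
  have "(norm z)\<^sup>2 < 1" using assms by (simp add: power_less_one_iff)
  then have "Re ((1 + z) * cnj (1 - z)) > 0"
    unfolding cmod_power2 by (simp add: power2_eq_square algebra_simps)
  then show ?thesis by (simp only: Re_complex_div_gt_0)
qed

text \<open>
Near \<open>\<zeta> = 1\<close> the modulus is at least \<open>1 / ((1 - r) + t)\<close> at angle \<open>t\<close>, and the integral of this over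
\<open>[0, 1]\<close> is at least \<open>- ln (1 - r)\<close>.
\<close>

lemma cayley_mean_unbounded:
  "\<exists>r. 0 < r \<and> r < 1 \<and> B < (\<integral>\<zeta>. norm ((1 + of_real r * \<zeta>) / (1 - of_real r * \<zeta>)) \<partial>circle_measure)"
proof -
  define r where "r = 1 - exp (- (2 * pi * (\<bar>B\<bar> + 1)))"
  have r: "0 < r" "r < 1" by (auto simp: r_def)
  define W where "W \<zeta> = norm ((1 + of_real r * \<zeta>) / (1 - of_real r * \<zeta>))" for \<zeta> :: complex
  have ne: "1 - of_real r * \<zeta> \<noteq> 0" if "norm \<zeta> = 1" for \<zeta> :: complex
  proof
    assume "1 - of_real r * \<zeta> = 0"
    then have "norm (of_real r * \<zeta>) = 1" by (metis eq_iff_diff_eq_0 norm_one)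
    then show False using that r by (simp add: norm_mult)
  qed
  have cW: "continuous_on (sphere 0 1) W"
    unfolding W_def using ne by (intro continuous_intros) auto
  have cW': "continuous_on {0..2 * pi} (\<lambda>t. W (cis t))"
    by (intro continuous_on_compose2[OF cW]) (auto intro!: continuous_intros)
  have int1: "set_integrable lborel {0..2 * pi} (\<lambda>t. W (cis t))"
    by (intro borel_integrable_atLeastAtMost' cW')
  have c1: "continuous_on {0..1} (\<lambda>t. 1 / ((1 - r) + t))"
    using r by (intro continuous_intros) auto
  have int2: "set_integrable lborel {0..1} (\<lambda>t. 1 / ((1 - r) + t))"
    by (intro borel_integrable_atLeastAtMost' c1)
  have low: "1 / ((1 - r) + t) \<le> W (cis t)" if t: "0 \<le> t" "t \<le> 1" for t
  proof -
    have "1 \<le> Re (1 + of_real r * cis t)"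
      using r t pi_gt3 by (auto intro!: mult_nonneg_nonneg cos_ge_zero)
    also have "\<dots> \<le> norm (1 + of_real r * cis t)" by (rule complex_Re_le_cmod)
    finally have num: "1 \<le> norm (1 + of_real r * cis t)" .
    have "1 - of_real r * cis t = of_real (1 - r) + of_real r * (1 - cis t)" by (simp add: algebra_simps)
    also have "norm \<dots> \<le> norm (of_real (1 - r) :: complex) + norm (of_real r * (1 - cis t))" by (rule norm_triangle_ineq)
    also have "norm (of_real r * (1 - cis t)) \<le> 1 * norm (1 - cis t)"
      unfolding norm_mult using r by (intro mult_right_mono) auto
    also have "norm (1 - cis t) \<le> t"
    proof -
      have "norm (1 - cis t) = 2 * \<bar>sin (t / 2)\<bar>"
        using dist_exp_i_1[of t] by (simp add: cis_conv_exp norm_minus_commute)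
      also have "\<dots> \<le> 2 * \<bar>t / 2\<bar>" by (intro mult_left_mono abs_sin_x_le_abs_x) auto
      finally show ?thesis using t by simp
    qed
    also have "norm (of_real (1 - r) :: complex) = 1 - r" using r by (simp only: norm_of_real)
    finally have den: "norm (1 - of_real r * cis t) \<le> 1 - r + t" by simp
    show ?thesis unfolding W_def norm_divide
      using num den ne[of "cis t"] r t by (intro frac_le) auto
  qed
  have "1 / (2 * pi) * (LINT t:{0..1}|lborel. 1 / ((1 - r) + t)) \<le> 1 / (2 * pi) * (LINT t:{0..2 * pi}|lborel. W (cis t))"
  proof (intro mult_left_mono)
    show "(LINT t:{0..1}|lborel. 1 / ((1 - r) + t)) \<le> (LINT t:{0..2 * pi}|lborel. W (cis t))"
      unfolding set_lebesgue_integral_def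
    proof (rule integral_mono[OF int2[unfolded set_integrable_def] int1[unfolded set_integrable_def]])
      have "(1::real) \<le> 2 * pi" using pi_gt3 by simp
      then show "indicator {0..1} t *\<^sub>R (1 / (1 - r + t)) \<le> indicator {0..2 * pi} t *\<^sub>R W (cis t)" for t
        using low[of t] by (auto simp: indicator_def W_def)
    qed
  qed simp
  moreover have "(LINT t:{0..1}|lborel. 1 / ((1 - r) + t)) = ln (2 - r) - ln (1 - r)"
  proof -
    have "((\<lambda>t. 1 / ((1 - r) + t)) has_integral (ln ((1 - r) + 1) - ln ((1 - r) + 0))) {0..1}"
      using r by (intro fundamental_theorem_of_calculus)
       (auto intro!: derivative_eq_intros simp: has_real_derivative_iff_has_vector_derivative[symmetric])
    then show ?thesis
      by (subst set_borel_integral_eq_integral[OF int2]) (simp add: integral_unique)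
  qed
  moreover have "(\<integral>\<zeta>. W \<zeta> \<partial>circle_measure) = 1 / (2 * pi) * (LINT t:{0..2 * pi}|lborel. W (cis t))"
    using integral_circle_interval[OF borel_measurable_circle_continuous[OF cW]] by simp
  moreover have "\<bar>B\<bar> + 1 \<le> 1 / (2 * pi) * (ln (2 - r) - ln (1 - r))"
  proof -
    have "ln (1 - r) = - (2 * pi * (\<bar>B\<bar> + 1))" by (simp add: r_def)
    moreover have "ln (2 - r) \<ge> 0" using r by simp
    ultimately have "2 * pi * (\<bar>B\<bar> + 1) \<le> ln (2 - r) - ln (1 - r)" by linarith
    then show ?thesis by (simp add: pos_le_divide_eq mult.commute)
  qed
  ultimately have "\<bar>B\<bar> + 1 \<le> (\<integral>\<zeta>. W \<zeta> \<partial>circle_measure)" by simp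
  then have "B < (\<integral>\<zeta>. W \<zeta> \<partial>circle_measure)" by linarith
  with r show ?thesis unfolding W_def by blast
qed

lemma sin_ge_linear:
  fixes x :: real
  assumes "0 \<le> x" "x \<le> pi / 2"
  shows "2 / pi * x \<le> sin x"
proof -
  have "concave_on {0..pi} (sin :: real \<Rightarrow> real)"
    by (rule f''_le0_imp_concave[where f' = cos and f'' = "\<lambda>x. - sin x"])
       (auto intro!: derivative_eq_intros sin_ge_zero)
  then have "sin ((1 - 2 * x / pi) *\<^sub>R 0 + (2 * x / pi) *\<^sub>R (pi / 2)) \<ge> (1 - 2 * x / pi) * sin 0 + (2 * x / pi) * sin (pi / 2)"
    by (rule concave_onD) (use assms in \<open>auto simp: field_simps\<close>)
  then show ?thesis by simp
qed

text \<open>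
Both \<open>cos (p * \<theta>)\<close> and the difference \<open>tan t0 powr p * cos \<theta> powr p - \<bar>sin \<theta>\<bar> powr p\<close> vanish at
\<open>\<theta> = t0\<close>. The difference is Lipschitz there, with constant \<open>L\<close>, while \<open>cos (p * \<theta>)\<close> is bounded
below by a positive multiple of \<open>t0 - \<theta>\<close>.
\<close>

lemma tan_sector_inequality:
  fixes p :: real
  assumes p: "1 < p"
  defines "t0 \<equiv> pi / (2 * p)"
  obtains K where "\<And>\<theta>. \<bar>\<theta>\<bar> \<le> t0 \<Longrightarrow> tan t0 powr p * cos \<theta> powr p - K * cos (p * \<theta>) \<le> \<bar>sin \<theta>\<bar> powr p"
proof -
  have t0: "0 < t0" "t0 < pi / 2" "p * t0 = pi / 2" using p by (auto simp: t0_def divide_simps)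
  define T where "T = tan t0"
  have pos0: "sin t0 > 0" "cos t0 > 0"
    using t0 by (auto intro!: sin_gt_zero2 cos_gt_zero)
  then have T: "T > 0" by (simp add: T_def tan_def)
  define L where "L = p * T powr p + p"
  define \<phi> where "\<phi> x = T powr p * cos x powr p - sin x powr p" for x
  have \<phi>0: "\<phi> t0 = 0" using pos0 by (simp add: \<phi>_def T_def tan_def powr_divide)
  have ge: "T powr p * cos x powr p - (pi / (2 * p) * L) * cos (p * x) \<le> \<bar>sin x\<bar> powr p" if x: "0 \<le> x" "x \<le> t0" for x
  proof -
    have "\<phi> x - \<phi> t0 \<le> L * (t0 - x)"
    proof -
      have "\<phi> x + L * x \<le> \<phi> t0 + L * t0"
      proof (rule DERIV_nonneg_imp_increasing_open[OF x(2)])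
        fix y assume y: "x < y" "y < t0"
        then have c: "sin y > 0" "cos y > 0" using x t0 by (auto intro!: sin_gt_zero2 cos_gt_zero)
        have "((\<lambda>x. \<phi> x + L * x) has_real_derivative (T powr p * (p * cos y powr (p - 1) * (- sin y)) - p * sin y powr (p - 1) * cos y + L)) (at y)"
          unfolding \<phi>_def using c by (auto intro!: derivative_eq_intros)
        moreover have "T powr p * (p * cos y powr (p - 1) * (- sin y)) - p * sin y powr (p - 1) * cos y + L \<ge> 0"
        proof -
          have "cos y powr (p - 1) * sin y \<le> 1 * 1" "sin y powr (p - 1) * cos y \<le> 1 * 1"
            using c p by (intro mult_mono powr_le1; simp)+
          then have "(T powr p * p) * (cos y powr (p - 1) * sin y) \<le> (T powr p * p) * 1" "p * (sin y powr (p - 1) * cos y) \<le> p * 1"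
            using p by (intro mult_left_mono; simp)+
          then show ?thesis by (simp add: L_def algebra_simps)
        qed
        ultimately show "\<exists>d. ((\<lambda>x. \<phi> x + L * x) has_real_derivative d) (at y) \<and> 0 \<le> d" by blast
      next
        show "continuous_on {x..t0} (\<lambda>x. \<phi> x + L * x)"
          unfolding \<phi>_def using x t0 p
          by (intro continuous_intros continuous_on_powr') (auto intro!: sin_ge_zero cos_ge_zero)
      qed
      then show ?thesis by (simp add: algebra_simps)
    qed
    also have "L * (t0 - x) \<le> L * (pi / (2 * p) * cos (p * x))"
    proof (rule mult_left_mono)
      have "2 / pi * (p * (t0 - x)) \<le> sin (p * (t0 - x))"
        using x p t0 by (intro sin_ge_linear) (auto simp: right_diff_distrib)
      also have "sin (p * (t0 - x)) = cos (p * x)"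
        unfolding right_diff_distrib t0(3) by (simp add: sin_diff)
      finally have "2 * p / pi * (t0 - x) \<le> cos (p * x)" by (simp add: mult.assoc)
      then show "t0 - x \<le> pi / (2 * p) * cos (p * x)" using p by (simp add: field_simps)
    qed (use p in \<open>auto simp: L_def\<close>)
    finally show ?thesis using \<phi>0 x t0 sin_ge_zero[of x] by (simp add: \<phi>_def algebra_simps)
  qed
  show ?thesis
  proof (rule that)
    fix \<theta> assume "\<bar>\<theta>\<bar> \<le> t0"
    then show "tan t0 powr p * cos \<theta> powr p - (pi / (2 * p) * L) * cos (p * \<theta>) \<le> \<bar>sin \<theta>\<bar> powr p"
      using ge[of \<theta>] ge[of "- \<theta>"] by (cases "\<theta> \<ge> 0") (auto simp: T_def)
  qed
qed

text \<open>
Let \<open>w z = (1 + z) / (1 - z)\<close>, a map onto the right half plane, and \<open>F = w powr (1 / p)\<close>, whose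
values lie in the sector \<open>\<bar>arg\<bar> < t0\<close>. The harmonic function \<open>Re F\<close>, dilated by \<open>r\<close>, has conjugate
\<open>Im F - \<i>\<close>. Multiplying the sector inequality by \<open>norm w\<close> turns its correction term into
\<open>K * Re w\<close>, whose mean is \<open>K\<close> for every \<open>r\<close>, while the mean of \<open>Re F powr p\<close> is at least
\<open>cos t0 powr p\<close> times the mean of \<open>norm w\<close>, which is unbounded as \<open>r\<close> varies. So no constant below
\<open>tan t0\<close> is admissible.
\<close>

lemma conjugation_bound_imp_ge_tan:
  assumes p: "1 < p" and C: "C \<ge> 0" and bound: "conjugation_bound p C"
  shows "tan (pi / (2 * p)) \<le> C"
proof (rule ccontr)
  define t0 where "t0 = pi / (2 * p)"
  assume "\<not> tan (pi / (2 * p)) \<le> C"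
  then have CT: "C < tan t0" by (simp add: t0_def)
  have t0: "0 < t0" "t0 < pi / 2" "p * t0 = pi / 2" using p by (auto simp: t0_def divide_simps)
  obtain K where K: "\<And>\<theta>. \<bar>\<theta>\<bar> \<le> t0 \<Longrightarrow> tan t0 powr p * cos \<theta> powr p - K * cos (p * \<theta>) \<le> \<bar>sin \<theta>\<bar> powr p"
    using tan_sector_inequality[OF p] unfolding t0_def by blast
  have cos0: "cos t0 > 0" using t0 by (intro cos_gt_zero) auto
  define E where "E = tan t0 powr p - C powr p"
  have E: "E > 0" unfolding E_def using powr_less_mono2[of p C "tan t0"] CT C p by simp
  define w :: "complex \<Rightarrow> complex" where "w z = (1 + z) / (1 - z)" for z
  obtain r where r: "0 < r" "r < 1" and big: "K / (E * cos t0 powr p) < (\<integral>\<zeta>. norm (w (of_real r * \<zeta>)) \<partial>circle_measure)"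
    using cayley_mean_unbounded unfolding w_def by blast
  define F where "F z = exp (Ln (w (of_real r * z)) / of_real p)" for z
  define R where "R = 1 / r"
  have R: "R > 1" using r by (simp add: R_def)
  have inb: "norm (of_real r * z) < 1" if "z \<in> ball 0 R" for z :: complex
    using that r by (simp add: norm_mult R_def field_simps)
  have w_hol: "(\<lambda>z. w (of_real r * z)) holomorphic_on ball 0 R"
    unfolding w_def using inb by (intro holomorphic_intros) (metis eq_iff_diff_eq_0 less_irrefl norm_one)
  have wpos: "Re (w (of_real r * z)) > 0" if "z \<in> ball 0 R" for z
    unfolding w_def by (rule cayley_Re_pos[OF inb[OF that]])
  have F_hol: "F holomorphic_on ball 0 R"
  proof -
    have "w (of_real r * z) \<notin> \<real>\<^sub>\<le>\<^sub>0" if "z \<in> ball 0 R" for z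
      using wpos[OF that] by (auto simp: complex_nonpos_Reals_iff)
    then show ?thesis unfolding F_def using p by (intro holomorphic_intros w_hol) auto
  qed
  have F0: "F 0 = 1" by (simp add: F_def w_def)
  define g h where "g z = (F z + 1) / 2" and "h z = (F z - 1) / 2" for z
  have nice: "closed_disk_pair g h"
    unfolding closed_disk_pair_def g_def h_def using R F0
    by (intro exI[of _ R] conjI holomorphic_intros F_hol) auto
  have g_h: "g z + cnj (h z) = of_real (Re (F z))" "g z - cnj (h z) = 1 + \<i> * of_real (Im (F z))" for z
    by (simp_all add: g_def h_def complex_eq_iff field_simps)
  have cF: "continuous_on (sphere 0 1) F"
    using R by (intro holomorphic_on_imp_continuous_on[OF holomorphic_on_subset[OF F_hol]]) auto
  have cw: "continuous_on (sphere 0 1) (\<lambda>z. w (of_real r * z))"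
    using R by (intro holomorphic_on_imp_continuous_on[OF holomorphic_on_subset[OF w_hol]]) auto
  define A where "A = circle_power p (\<lambda>\<zeta>. g \<zeta> + cnj (h \<zeta>))"
  have polar: "norm (g \<zeta> + cnj (h \<zeta>)) powr p = norm (w (of_real r * \<zeta>)) * cos (Im (Ln (w (of_real r * \<zeta>))) / p) powr p"
      "norm (w (of_real r * \<zeta>)) * \<bar>sin (Im (Ln (w (of_real r * \<zeta>))) / p)\<bar> powr p \<le> norm (g \<zeta> - cnj (h \<zeta>)) powr p"
      "Re (w (of_real r * \<zeta>)) = norm (w (of_real r * \<zeta>)) * cos (p * (Im (Ln (w (of_real r * \<zeta>))) / p))"
      "\<bar>Im (Ln (w (of_real r * \<zeta>))) / p\<bar> \<le> t0"
    if \<zeta>: "\<zeta> \<in> sphere 0 1" for \<zeta>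
  proof -
    define v where "v = w (of_real r * \<zeta>)"
    define \<theta> where "\<theta> = Im (Ln v) / p"
    have v: "Re v > 0" unfolding v_def using R \<zeta> by (intro wpos) auto
    then have v0: "v \<noteq> 0" by auto
    have "\<bar>Im (Ln v)\<bar> < pi / 2" using v v0 by (metis Re_Ln_pos_lt)
    then have \<theta>: "\<bar>\<theta>\<bar> \<le> t0" using p by (simp add: \<theta>_def t0_def abs_divide divide_simps)
    have c: "cos \<theta> > 0" using \<theta> t0 by (intro cos_gt_zero_pi) auto
    have nv: "norm v = exp (Re (Ln v))" using exp_Ln[OF v0] by (metis norm_exp_eq_Re)
    have Fv: "F \<zeta> = exp (Ln v / of_real p)" by (simp add: F_def v_def)
    have ReF: "Re (F \<zeta>) = exp (Re (Ln v) / p) * cos \<theta>" and ImF: "Im (F \<zeta>) = exp (Re (Ln v) / p) * sin \<theta>"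
      unfolding Fv by (simp_all add: Re_exp Im_exp \<theta>_def)
    have ep: "exp (Re (Ln v) / p) powr p = norm v" using p by (simp add: nv powr_def)
    show "norm (g \<zeta> + cnj (h \<zeta>)) powr p = norm (w (of_real r * \<zeta>)) * cos (Im (Ln (w (of_real r * \<zeta>))) / p) powr p"
      unfolding g_h norm_of_real ReF using c by (simp add: abs_mult powr_mult ep flip: v_def \<theta>_def)
    have "norm v * \<bar>sin \<theta>\<bar> powr p = \<bar>Im (F \<zeta>)\<bar> powr p"
      unfolding ImF by (simp add: abs_mult powr_mult ep)
    also have "\<dots> \<le> norm (g \<zeta> - cnj (h \<zeta>)) powr p"
      using abs_Im_le_cmod[of "g \<zeta> - cnj (h \<zeta>)"] p by (intro powr_mono2) (simp_all add: g_h)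
    finally show "norm (w (of_real r * \<zeta>)) * \<bar>sin (Im (Ln (w (of_real r * \<zeta>))) / p)\<bar> powr p \<le> norm (g \<zeta> - cnj (h \<zeta>)) powr p"
      by (simp add: v_def \<theta>_def)
    have "Re v = exp (Re (Ln v)) * cos (Im (Ln v))" using exp_Ln[OF v0] by (metis Re_exp)
    then show "Re (w (of_real r * \<zeta>)) = norm (w (of_real r * \<zeta>)) * cos (p * (Im (Ln (w (of_real r * \<zeta>))) / p))"
      using p by (simp add: nv flip: v_def)
    show "\<bar>Im (Ln (w (of_real r * \<zeta>))) / p\<bar> \<le> t0" using \<theta> by (simp add: v_def \<theta>_def)
  qed
  have ints: "integrable circle_measure (\<lambda>\<zeta>. norm (g \<zeta> + cnj (h \<zeta>)) powr p)"
    "integrable circle_measure (\<lambda>\<zeta>. norm (g \<zeta> - cnj (h \<zeta>)) powr p)"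
    "integrable circle_measure (\<lambda>\<zeta>. Re (w (of_real r * \<zeta>)))"
    "integrable circle_measure (\<lambda>\<zeta>. norm (w (of_real r * \<zeta>)))"
    "integrable circle_measure (\<lambda>\<zeta>. w (of_real r * \<zeta>))"
    using p by (intro integrable_circle_powr continuous_intros closed_disk_pair_continuous_circle[OF nice]
       integrable_circle_continuous cw; simp)+
  have "(\<integral>\<zeta>. w (of_real r * \<zeta>) \<partial>circle_measure) = 1"
    using circle_mean_value[OF w_hol R] by (simp add: w_def)
  then have mean1: "(\<integral>\<zeta>. Re (w (of_real r * \<zeta>)) \<partial>circle_measure) = 1"
    by (simp add: integral_Re[OF ints(5)])
  have "tan t0 powr p * A - K * 1 = (\<integral>\<zeta>. tan t0 powr p * norm (g \<zeta> + cnj (h \<zeta>)) powr p - K * Re (w (of_real r * \<zeta>)) \<partial>circle_measure)"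
    unfolding A_def mean1[symmetric] using ints by simp
  also have "\<dots> \<le> circle_power p (\<lambda>\<zeta>. g \<zeta> - cnj (h \<zeta>))"
  proof (rule integral_mono)
    fix \<zeta> assume "\<zeta> \<in> space circle_measure"
    then have \<zeta>: "\<zeta> \<in> sphere 0 1" by simp
    define \<theta> where "\<theta> = Im (Ln (w (of_real r * \<zeta>))) / p"
    define n where "n = norm (w (of_real r * \<zeta>))"
    have "n * (tan t0 powr p * cos \<theta> powr p - K * cos (p * \<theta>)) \<le> n * \<bar>sin \<theta>\<bar> powr p"
      using K[of \<theta>] polar(4)[OF \<zeta>] by (intro mult_left_mono) (auto simp: \<theta>_def n_def)
    also have "\<dots> \<le> norm (g \<zeta> - cnj (h \<zeta>)) powr p" using polar(2)[OF \<zeta>] by (simp add: \<theta>_def n_def)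
    finally show "tan t0 powr p * norm (g \<zeta> + cnj (h \<zeta>)) powr p - K * Re (w (of_real r * \<zeta>)) \<le> norm (g \<zeta> - cnj (h \<zeta>)) powr p"
      unfolding polar(1)[OF \<zeta>] polar(3)[OF \<zeta>] by (fold \<theta>_def n_def) (simp add: algebra_simps)
  qed (use ints in auto)
  also have "\<dots> \<le> C powr p * A" using bound nice by (simp add: conjugation_bound_def A_def)
  finally have "E * A \<le> K" by (simp add: E_def algebra_simps)
  moreover have "cos t0 powr p * (\<integral>\<zeta>. norm (w (of_real r * \<zeta>)) \<partial>circle_measure) \<le> A"
  proof -
    have "cos t0 powr p * (\<integral>\<zeta>. norm (w (of_real r * \<zeta>)) \<partial>circle_measure) = (\<integral>\<zeta>. cos t0 powr p * norm (w (of_real r * \<zeta>)) \<partial>circle_measure)"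
      by simp
    also have "\<dots> \<le> A" unfolding A_def
    proof (rule integral_mono)
      fix \<zeta> assume "\<zeta> \<in> space circle_measure"
      then have \<zeta>: "\<zeta> \<in> sphere 0 1" by simp
      define \<theta> where "\<theta> = Im (Ln (w (of_real r * \<zeta>))) / p"
      have "cos t0 \<le> cos \<bar>\<theta>\<bar>" using polar(4)[OF \<zeta>] t0 by (intro cos_monotone_0_pi_le) (auto simp: \<theta>_def)
      then have "cos t0 powr p \<le> cos \<theta> powr p" using cos0 p by (intro powr_mono2) auto
      then show "cos t0 powr p * norm (w (of_real r * \<zeta>)) \<le> norm (g \<zeta> + cnj (h \<zeta>)) powr p"
        unfolding polar(1)[OF \<zeta>] \<theta>_def[symmetric] by (subst mult.commute) (intro mult_left_mono, auto)
    qed (use ints in auto)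
    finally show ?thesis .
  qed
  ultimately have "E * (cos t0 powr p * (\<integral>\<zeta>. norm (w (of_real r * \<zeta>)) \<partial>circle_measure)) \<le> K"
    using E by (meson less_imp_le mult_left_mono order_trans)
  with big E cos0 show False by (simp add: divide_less_eq mult_ac split: if_splits)
qed

text \<open>
For \<open>p > 2\<close> the dual exponent is below 2, and duality transfers both the upper and the lower bound.
\<close>

lemma conjugation_bound_iff:
  assumes p: "1 < p" and C: "C \<ge> 0"
  shows "conjugation_bound p C \<longleftrightarrow> (if p \<le> 2 then tan (pi / (2 * p)) else cot (pi / (2 * p))) \<le> C"
proof -
  have mono: "conjugation_bound p C" if "conjugation_bound p c" "0 \<le> c" "c \<le> C" "p > 1" for p c
    unfolding conjugation_bound_def
  proof (intro allI impI)
    fix g h assume "closed_disk_pair g h"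
    then have "circle_power p (\<lambda>\<zeta>. g \<zeta> - cnj (h \<zeta>)) \<le> c powr p * circle_power p (\<lambda>\<zeta>. g \<zeta> + cnj (h \<zeta>))"
      using that by (simp add: conjugation_bound_def)
    also have "\<dots> \<le> C powr p * circle_power p (\<lambda>\<zeta>. g \<zeta> + cnj (h \<zeta>))"
      using that by (intro mult_right_mono powr_mono2) auto
    finally show "circle_power p (\<lambda>\<zeta>. g \<zeta> - cnj (h \<zeta>)) \<le> C powr p * circle_power p (\<lambda>\<zeta>. g \<zeta> + cnj (h \<zeta>))" .
  qed
  have tan_pos: "tan (pi / (2 * p)) \<ge> 0" if "p > 1" for p :: real
    using that by (intro less_imp_le tan_gt_zero) (auto simp: divide_simps)
  have small: "conjugation_bound p C \<longleftrightarrow> tan (pi / (2 * p)) \<le> C" if "1 < p" "p \<le> 2" for p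
    using conjugation_bound_imp_ge_tan[OF that(1) C] mono[OF conjugation_bound_tan[OF that] tan_pos _ that(1)] that by blast
  show ?thesis
  proof (cases "p \<le> 2")
    case True
    then show ?thesis using small[OF p] by simp
  next
    case False
    define q where "q = p / (p - 1)"
    have q: "1 < q" "q \<le> 2" "1 / p + 1 / q = 1" "1 / q + 1 / p = 1" using False by (auto simp: q_def field_simps)
    have "pi / (2 * q) = pi / 2 - pi / (2 * p)" using False by (simp add: q_def field_simps)
    then have "tan (pi / (2 * q)) = cot (pi / (2 * p))" by (simp add: tan_cot')
    then show ?thesis
      using small[OF q(1,2)] conjugation_bound_duality[OF p q(1,3) C] conjugation_bound_duality[OF q(1) p q(4) C] False by auto
  qed
qed

section \<open>Harmonic functions and their decomposition\<close>

text \<open>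
The second difference \<open>\<Delta>\<close> over a small square can be evaluated by the mean value theorem in
either order of the variables; each order gives the corresponding mixed derivative at some
point of the square.
\<close>

lemma mixed_partials_eq_real:
  fixes f fx fy fxy fyx :: "complex \<Rightarrow> real"
  assumes S: "open S" "z0 \<in> S"
    and f: "\<And>z. z \<in> S \<Longrightarrow> (f has_derivative (\<lambda>v. Re v * fx z + Im v * fy z)) (at z)"
    and fx: "\<And>z. z \<in> S \<Longrightarrow> (fx has_derivative (\<lambda>v. Re v * fxx z + Im v * fxy z)) (at z)"
    and fy: "\<And>z. z \<in> S \<Longrightarrow> (fy has_derivative (\<lambda>v. Re v * fyx z + Im v * fyy z)) (at z)"
    and c: "continuous_on S fxy" "continuous_on S fyx"
  shows "fxy z0 = fyx z0"
proof (rule ccontr)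
  assume "fxy z0 \<noteq> fyx z0"
  define e where "e = \<bar>fxy z0 - fyx z0\<bar> / 2"
  have e: "e > 0" using \<open>fxy z0 \<noteq> fyx z0\<close> by (simp add: e_def)
  obtain d0 where d0: "d0 > 0" "ball z0 d0 \<subseteq> S" using S open_contains_ball by blast
  have "isCont fxy z0" "isCont fyx z0" using c S by (auto simp: continuous_on_eq_continuous_at)
  then obtain d1 d2 where d12: "d1 > 0" "\<And>z. dist z z0 < d1 \<Longrightarrow> dist (fxy z) (fxy z0) < e"
     "d2 > 0" "\<And>z. dist z z0 < d2 \<Longrightarrow> dist (fyx z) (fyx z0) < e"
    using e unfolding continuous_at_eps_delta by metis
  define t where "t = min d0 (min d1 d2) / 4"
  have t: "t > 0" "2 * t < d0" "2 * t < d1" "2 * t < d2" using d0 d12 by (auto simp: t_def)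
  have near: "dist (z0 + Complex a b) z0 \<le> 2 * t" if "0 \<le> a" "a \<le> t" "0 \<le> b" "b \<le> t" for a b
    using cmod_le[of "Complex a b"] that by (simp add: dist_norm)
  have inS: "z0 + Complex a b \<in> S" if "0 \<le> a" "a \<le> t" "0 \<le> b" "b \<le> t" for a b
    using near[OF that] t d0(2) by (auto simp: dist_commute)
  have der_x: "((\<lambda>a. k (z0 + Complex a b)) has_real_derivative kx (z0 + Complex a b)) (at a)"
    if k: "\<And>z. z \<in> S \<Longrightarrow> (k has_derivative (\<lambda>v. Re v * kx z + Im v * ky z)) (at z)"
      and ab: "0 \<le> a" "a \<le> t" "0 \<le> b" "b \<le> t" for k kx ky :: "complex \<Rightarrow> real" and a b
  proof -
    have "((\<lambda>a. z0 + Complex a b) has_derivative (\<lambda>s. of_real s)) (at a)"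
      unfolding Complex_eq by (auto intro!: derivative_eq_intros)
    from has_derivative_compose[OF this k[OF inS[OF ab]]]
    show ?thesis by (simp add: has_field_derivative_def mult.commute[of _ "kx _"] cong: )
  qed
  have der_y: "((\<lambda>b. k (z0 + Complex a b)) has_real_derivative ky (z0 + Complex a b)) (at b)"
    if k: "\<And>z. z \<in> S \<Longrightarrow> (k has_derivative (\<lambda>v. Re v * kx z + Im v * ky z)) (at z)"
      and ab: "0 \<le> a" "a \<le> t" "0 \<le> b" "b \<le> t" for k kx ky :: "complex \<Rightarrow> real" and a b
  proof -
    have "((\<lambda>b. z0 + Complex a b) has_derivative (\<lambda>s. \<i> * of_real s)) (at b)"
      unfolding Complex_eq by (auto intro!: derivative_eq_intros)
    from has_derivative_compose[OF this k[OF inS[OF ab]]]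
    show ?thesis by (simp add: has_field_derivative_def mult.commute[of _ "ky _"] cong: )
  qed
  define \<Delta> where "\<Delta> = f (z0 + Complex t t) - f (z0 + Complex t 0) - f (z0 + Complex 0 t) + f (z0 + Complex 0 0)"
  have "\<exists>a. 0 < a \<and> a < t \<and> (f (z0 + Complex t t) - f (z0 + Complex t 0)) - (f (z0 + Complex 0 t) - f (z0 + Complex 0 0)) = (t - 0) * (fx (z0 + Complex a t) - fx (z0 + Complex a 0))"
    using t by (intro MVT2[where f = "\<lambda>a. f (z0 + Complex a t) - f (z0 + Complex a 0)" and f' = "\<lambda>a. fx (z0 + Complex a t) - fx (z0 + Complex a 0)"]
      DERIV_diff der_x[OF f]) auto
  then obtain a where a: "0 < a" "a < t" "\<Delta> = t * (fx (z0 + Complex a t) - fx (z0 + Complex a 0))"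
    by (auto simp: \<Delta>_def)
  have "\<exists>b. 0 < b \<and> b < t \<and> fx (z0 + Complex a t) - fx (z0 + Complex a 0) = (t - 0) * fxy (z0 + Complex a b)"
    using t a by (intro MVT2[where f = "\<lambda>b. fx (z0 + Complex a b)" and f' = "\<lambda>b. fxy (z0 + Complex a b)"]
       der_y[OF fx]) auto
  then obtain b where b: "0 < b" "b < t" "\<Delta> = t * (t * fxy (z0 + Complex a b))"
    by (auto simp: a)
  have "\<exists>b. 0 < b \<and> b < t \<and> (f (z0 + Complex t t) - f (z0 + Complex 0 t)) - (f (z0 + Complex t 0) - f (z0 + Complex 0 0)) = (t - 0) * (fy (z0 + Complex t b) - fy (z0 + Complex 0 b))"
    using t by (intro MVT2[where f = "\<lambda>b. f (z0 + Complex t b) - f (z0 + Complex 0 b)" and f' = "\<lambda>b. fy (z0 + Complex t b) - fy (z0 + Complex 0 b)"]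
      DERIV_diff der_y[OF f]) auto
  then obtain b' where b': "0 < b'" "b' < t" "\<Delta> = t * (fy (z0 + Complex t b') - fy (z0 + Complex 0 b'))"
    by (auto simp: \<Delta>_def)
  have "\<exists>a. 0 < a \<and> a < t \<and> fy (z0 + Complex t b') - fy (z0 + Complex 0 b') = (t - 0) * fyx (z0 + Complex a b')"
    using t b' by (intro MVT2[where f = "\<lambda>a. fy (z0 + Complex a b')" and f' = "\<lambda>a. fyx (z0 + Complex a b')"]
       der_x[OF fy]) auto
  then obtain a' where a': "0 < a'" "a' < t" "\<Delta> = t * (t * fyx (z0 + Complex a' b'))"
    by (auto simp: b')
  have "fxy (z0 + Complex a b) = fyx (z0 + Complex a' b')" using b(3) a'(3) t(1) by simp
  moreover have "dist (fxy (z0 + Complex a b)) (fxy z0) < e"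
    using near[of a b] a b t by (intro d12) auto
  moreover have "dist (fyx (z0 + Complex a' b')) (fyx z0) < e"
    using near[of a' b'] a' b' t by (intro d12) auto
  ultimately show False by (simp add: e_def dist_real_def abs_if split: if_splits)
qed

lemma mixed_partials_eq:
  fixes f fx fy fxy fyx :: "complex \<Rightarrow> complex"
  assumes S: "open S" "z0 \<in> S"
    and f: "\<And>z. z \<in> S \<Longrightarrow> (f has_derivative (\<lambda>v. Re v *\<^sub>R fx z + Im v *\<^sub>R fy z)) (at z)"
    and fx: "\<And>z. z \<in> S \<Longrightarrow> (fx has_derivative (\<lambda>v. Re v *\<^sub>R fxx z + Im v *\<^sub>R fxy z)) (at z)"
    and fy: "\<And>z. z \<in> S \<Longrightarrow> (fy has_derivative (\<lambda>v. Re v *\<^sub>R fyx z + Im v *\<^sub>R fyy z)) (at z)"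
    and c: "continuous_on S fxy" "continuous_on S fyx"
  shows "fxy z0 = fyx z0"
proof (rule complex_eqI)
  show "Re (fxy z0) = Re (fyx z0)"
    by (rule mixed_partials_eq_real[where f = "\<lambda>z. Re (f z)" and fx = "\<lambda>z. Re (fx z)" and fy = "\<lambda>z. Re (fy z)"
         and fxx = "\<lambda>z. Re (fxx z)" and fyy = "\<lambda>z. Re (fyy z)"
         and fxy = "\<lambda>z. Re (fxy z)" and fyx = "\<lambda>z. Re (fyx z)", OF S])
       (use has_derivative_Re[OF f] has_derivative_Re[OF fx] has_derivative_Re[OF fy] c in \<open>auto intro!: continuous_intros\<close>)
  show "Im (fxy z0) = Im (fyx z0)"
    by (rule mixed_partials_eq_real[where f = "\<lambda>z. Im (f z)" and fx = "\<lambda>z. Im (fx z)" and fy = "\<lambda>z. Im (fy z)"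
         and fxx = "\<lambda>z. Im (fxx z)" and fyy = "\<lambda>z. Im (fyy z)"
         and fxy = "\<lambda>z. Im (fxy z)" and fyx = "\<lambda>z. Im (fyx z)", OF S])
       (use has_derivative_Im[OF f] has_derivative_Im[OF fx] has_derivative_Im[OF fy] c in \<open>auto intro!: continuous_intros\<close>)
qed

text \<open>
The Laplace equation and the symmetry of the mixed derivatives are the Cauchy-Riemann equations
for the Wirtinger derivative \<open>P\<close> and for the conjugate \<open>Q\<close> of the other Wirtinger derivative.
Primitives of \<open>P\<close> and \<open>Q\<close> on the disk are the two parts of \<open>f\<close>, up to a constant.
\<close>

lemma complex_harmonic_on_decomposition:
  assumes "complex_harmonic_on f unit_disk"
  obtains g h where "canonical_decomp f g h"
proof -
  let ?D = "ball 0 1 :: complex set"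
  obtain fx fy fxx fxy fyx fyy where
    f: "\<And>z. z \<in> ?D \<Longrightarrow> (f has_derivative (\<lambda>v. Re v *\<^sub>R fx z + Im v *\<^sub>R fy z)) (at z)"
    and fx: "\<And>z. z \<in> ?D \<Longrightarrow> (fx has_derivative (\<lambda>v. Re v *\<^sub>R fxx z + Im v *\<^sub>R fxy z)) (at z)"
    and fy: "\<And>z. z \<in> ?D \<Longrightarrow> (fy has_derivative (\<lambda>v. Re v *\<^sub>R fyx z + Im v *\<^sub>R fyy z)) (at z)"
    and lap: "\<And>z. z \<in> ?D \<Longrightarrow> fxx z + fyy z = 0"
    and c: "continuous_on ?D fxy" "continuous_on ?D fyx"
    using assms unfolding complex_harmonic_on_def by blast
  have mixed: "fxy z = fyx z" if "z \<in> ?D" for z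
    by (rule mixed_partials_eq[OF open_ball that f fx fy c])
  have lap': "fyy z = - fxx z" if "z \<in> ?D" for z using lap[OF that] by (simp add: eq_neg_iff_add_eq_0 add.commute)
  define P where "P z = (fx z - \<i> * fy z) / 2" for z
  define Q where "Q z = cnj ((fx z + \<i> * fy z) / 2)" for z
  have P: "(P has_field_derivative ((fxx z - \<i> * fxy z) / 2)) (at z)" if "z \<in> ?D" for z
  proof -
    have "(P has_derivative (\<lambda>v. ((Re v *\<^sub>R fxx z + Im v *\<^sub>R fxy z) - \<i> * (Re v *\<^sub>R fyx z + Im v *\<^sub>R fyy z)) / 2)) (at z)"
      unfolding P_def[abs_def] using that
      by (auto intro!: derivative_eq_intros fx fy) (simp add: fun_eq_iff field_simps)
    moreover have "((Re v *\<^sub>R fxx z + Im v *\<^sub>R fxy z) - \<i> * (Re v *\<^sub>R fyx z + Im v *\<^sub>R fyy z)) / 2 = (fxx z - \<i> * fxy z) / 2 * v" for v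
      by (simp add: mixed[OF that] lap'[OF that] complex_eq_iff field_simps)
    ultimately show ?thesis by (simp only: has_field_derivative_def)
  qed
  have Q: "(Q has_field_derivative (cnj (fxx z + \<i> * fxy z) / 2)) (at z)" if "z \<in> ?D" for z
  proof -
    have "(Q has_derivative (\<lambda>v. cnj (((Re v *\<^sub>R fxx z + Im v *\<^sub>R fxy z) + \<i> * (Re v *\<^sub>R fyx z + Im v *\<^sub>R fyy z)) / 2))) (at z)"
      unfolding Q_def[abs_def] using that 
      by (intro has_derivative_cnj) (auto intro!: derivative_eq_intros fx fy, simp add: fun_eq_iff field_simps)
    moreover have "cnj (((Re v *\<^sub>R fxx z + Im v *\<^sub>R fxy z) + \<i> * (Re v *\<^sub>R fyx z + Im v *\<^sub>R fyy z)) / 2) = cnj (fxx z + \<i> * fxy z) / 2 * v" for v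
      by (simp add: mixed[OF that] lap'[OF that] complex_eq_iff field_simps)
    ultimately show ?thesis by (simp only: has_field_derivative_def)
  qed
  have "P holomorphic_on ?D" "Q holomorphic_on ?D"
    unfolding holomorphic_on_open[OF open_ball] using P Q by blast+
  then obtain g0 h0 where g0: "\<And>z. z \<in> ?D \<Longrightarrow> (g0 has_field_derivative P z) (at z within ?D)"
    and h0: "\<And>z. z \<in> ?D \<Longrightarrow> (h0 has_field_derivative Q z) (at z within ?D)"
    using holomorphic_convex_primitive'[of ?D P] holomorphic_convex_primitive'[of ?D Q] by (metis convex_ball open_ball)
  have g0': "(g0 has_field_derivative P z) (at z)" and h0': "(h0 has_field_derivative Q z) (at z)" if "z \<in> ?D" for z
    using g0[OF that] h0[OF that] that by (simp_all add: at_within_open[OF that open_ball])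
  have "((\<lambda>z. f z - g0 z - cnj (h0 z)) has_derivative (\<lambda>v. 0)) (at z within ?D)" if "z \<in> ?D" for z
  proof -
    have "((\<lambda>z. f z - g0 z - cnj (h0 z)) has_derivative (\<lambda>v. (Re v *\<^sub>R fx z + Im v *\<^sub>R fy z) - P z * v - cnj (Q z * v))) (at z)"
      using f[OF that] g0'[OF that] h0'[OF that] unfolding has_field_derivative_def
      by (intro has_derivative_diff has_derivative_cnj)
    moreover have "(Re v *\<^sub>R fx z + Im v *\<^sub>R fy z) - P z * v - cnj (Q z * v) = 0" for v
      by (simp add: P_def Q_def complex_eq_iff field_simps)
    ultimately show ?thesis by (simp add: has_derivative_at_withinI)
  qed
  then obtain c where c: "\<And>z. z \<in> ?D \<Longrightarrow> f z - g0 z - cnj (h0 z) = c"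
    using has_derivative_zero_constant[of ?D "\<lambda>z. f z - g0 z - cnj (h0 z)"] by auto
  have hol0: "g0 holomorphic_on ?D" "h0 holomorphic_on ?D"
    unfolding holomorphic_on_open[OF open_ball] using g0' h0' by blast+
  show thesis
  proof (rule that)
    show "canonical_decomp f (\<lambda>z. g0 z + (c + cnj (h0 0))) (\<lambda>z. h0 z - h0 0)"
      unfolding canonical_decomp_def
    proof (intro conjI ballI)
      show "(\<lambda>z. g0 z + (c + cnj (h0 0))) holomorphic_on ?D" "(\<lambda>z. h0 z - h0 0) holomorphic_on ?D"
        using hol0 by (intro holomorphic_intros; simp)+
      show "f z = g0 z + (c + cnj (h0 0)) + cnj (h0 z - h0 0)" if "z \<in> ?D" for z
        using c[OF that] by (simp add: algebra_simps)
    qed simp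
  qed
qed

lemma complex_harmonic_on_holomorphic_plus_cnj:
  assumes S: "open S" and g: "g holomorphic_on S" and h: "h holomorphic_on S"
    and f: "\<And>z. z \<in> S \<Longrightarrow> f z = g z + cnj (h z)"
  shows "complex_harmonic_on f S"
proof -
  let ?g' = "deriv g" and ?h' = "deriv h" and ?g'' = "deriv (deriv g)" and ?h'' = "deriv (deriv h)"
  have hol: "?g' holomorphic_on S" "?h' holomorphic_on S" "?g'' holomorphic_on S" "?h'' holomorphic_on S"
    by (intro holomorphic_deriv S g h)+
  have D: "((\<lambda>z. G z + cnj (H z)) has_derivative (\<lambda>v. Re v *\<^sub>R (deriv G z + cnj (deriv H z)) + Im v *\<^sub>R (\<i> * (deriv G z - cnj (deriv H z))))) (at z)"
    if "G holomorphic_on S" "H holomorphic_on S" "z \<in> S" for G H z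
  proof -
    have "((\<lambda>z. G z + cnj (H z)) has_derivative (\<lambda>v. deriv G z * v + cnj (deriv H z * v))) (at z)"
      using holomorphic_derivI[OF that(1) S that(3)] holomorphic_derivI[OF that(2) S that(3)]
      unfolding has_field_derivative_def by (intro has_derivative_add has_derivative_cnj)
    moreover have "deriv G z * v + cnj (deriv H z * v) = Re v *\<^sub>R (deriv G z + cnj (deriv H z)) + Im v *\<^sub>R (\<i> * (deriv G z - cnj (deriv H z)))" for v
      by (simp add: complex_eq_iff algebra_simps)
    ultimately show ?thesis by simp
  qed
  have Di: "((\<lambda>z. \<i> * (G z - cnj (H z))) has_derivative (\<lambda>v. Re v *\<^sub>R (\<i> * (deriv G z - cnj (deriv H z))) + Im v *\<^sub>R (- (deriv G z + cnj (deriv H z))))) (at z)"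
    if "G holomorphic_on S" "H holomorphic_on S" "z \<in> S" for G H z
  proof -
    have "((\<lambda>z. \<i> * (G z - cnj (H z))) has_derivative (\<lambda>v. \<i> * (deriv G z * v - cnj (deriv H z * v)))) (at z)"
      using holomorphic_derivI[OF that(1) S that(3)] holomorphic_derivI[OF that(2) S that(3)]
      unfolding has_field_derivative_def by (intro has_derivative_diff has_derivative_cnj has_derivative_mult_right)
    moreover have "\<i> * (deriv G z * v - cnj (deriv H z * v)) = Re v *\<^sub>R (\<i> * (deriv G z - cnj (deriv H z))) + Im v *\<^sub>R (- (deriv G z + cnj (deriv H z)))" for v
      by (simp add: complex_eq_iff algebra_simps)
    ultimately show ?thesis by simp
  qed
  have fD: "(f has_derivative (\<lambda>v. Re v *\<^sub>R (?g' z + cnj (?h' z)) + Im v *\<^sub>R (\<i> * (?g' z - cnj (?h' z))))) (at z)" if "z \<in> S" for z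
    using has_derivative_transform_within_open[OF D[OF g h that] S that] f by auto
  show ?thesis
    unfolding complex_harmonic_on_def
  proof (rule exI[of _ "\<lambda>z. ?g' z + cnj (?h' z)"], rule exI[of _ "\<lambda>z. \<i> * (?g' z - cnj (?h' z))"],
      rule exI[of _ "\<lambda>z. ?g'' z + cnj (?h'' z)"], rule exI[of _ "\<lambda>z. \<i> * (?g'' z - cnj (?h'' z))"],
      rule exI[of _ "\<lambda>z. \<i> * (?g'' z - cnj (?h'' z))"], rule exI[of _ "\<lambda>z. - (?g'' z + cnj (?h'' z))"],
      intro conjI ballI fD D[OF hol(1,2)] Di[OF hol(1,2)])
  qed (auto intro!: continuous_intros holomorphic_on_imp_continuous_on[OF hol(3)]
         holomorphic_on_imp_continuous_on[OF hol(4)])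
qed

lemma holomorphic_Re_zero_constant:
  assumes F: "F holomorphic_on S" and S: "open S" "connected S" and Re: "\<And>z. z \<in> S \<Longrightarrow> Re (F z) = 0"
  shows "F constant_on S"
proof (rule ccontr)
  assume nc: "\<not> F constant_on S"
  then obtain a where a: "a \<in> S" by (auto simp: constant_on_def)
  have "open (F ` S)" using open_mapping_thm[OF F S S(1) _ nc] by simp
  then obtain e where e: "e > 0" "ball (F a) e \<subseteq> F ` S" using a open_contains_ball by blast
  have "F a + of_real (e / 2) \<in> ball (F a) e" using e(1) by (simp add: dist_norm)
  then obtain b where "b \<in> S" "F a + of_real (e / 2) = F b" using e(2) by blast
  then have "Re (F a + of_real (e / 2)) = Re (F b)" by simp
  then show False using Re[OF a] Re[OF \<open>b \<in> S\<close>] e(1) by simp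
qed

text \<open>
If \<open>a + cnj b = 0\<close> with \<open>a\<close> and \<open>b\<close> holomorphic, then \<open>a + b\<close> is purely imaginary and \<open>a - b\<close> is
real, so both are constant.
\<close>

lemma canonical_decomp_unique:
  assumes d1: "canonical_decomp f g1 h1" and d2: "canonical_decomp f g2 h2" and z: "z \<in> unit_disk"
  shows "g1 z = g2 z" "h1 z = h2 z"
proof -
  define F where "F z = (g1 z - g2 z) + (h1 z - h2 z)" for z
  define G where "G z = (g1 z - g2 z) - (h1 z - h2 z)" for z
  have hol: "F holomorphic_on ball 0 1" "G holomorphic_on ball 0 1"
    using d1 d2 unfolding F_def G_def canonical_decomp_def by (auto intro!: holomorphic_intros)
  have eq: "g1 z - g2 z = - cnj (h1 z - h2 z)" if "z \<in> ball 0 1" for z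
  proof -
    have "g1 z + cnj (h1 z) = g2 z + cnj (h2 z)" using d1 d2 that unfolding canonical_decomp_def by metis
    then show ?thesis by (simp add: algebra_simps)
  qed
  have "Re (F z) = 0" "Im (G z) = 0" if "z \<in> ball 0 1" for z
    unfolding F_def G_def eq[OF that] by auto
  then have "F constant_on ball 0 1" "(\<lambda>z. \<i> * G z) constant_on ball 0 1"
    using hol by (auto intro!: holomorphic_Re_zero_constant holomorphic_intros)
  then have "F z = F 0" "\<i> * G z = \<i> * G 0" using z unfolding constant_on_def by (metis centre_in_ball zero_less_one)+
  then have "F z = F 0" "G z = G 0" by simp_all
  moreover have "h1 0 = 0" "h2 0 = 0" using d1 d2 by (auto simp: canonical_decomp_def)
  moreover from this have "g1 0 = g2 0" using eq[of 0] by simp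
  ultimately have "F z = 0" "G z = 0" by (simp_all add: F_def G_def)
  then have "F z + G z = 0" "F z - G z = 0" by simp_all
  then show "g1 z = g2 z" "h1 z = h2 z" by (simp_all add: F_def G_def)
qed

lemma harmonic_conjugate_eq:
  assumes "canonical_decomp f g h" "z \<in> unit_disk"
  shows "harmonic_conjugate f z = - \<i> * (g z - cnj (h z))"
proof -
  have "(THE w. \<exists>g h. canonical_decomp f g h \<and> w = - \<i> * (g z - cnj (h z))) = - \<i> * (g z - cnj (h z))"
    using assms canonical_decomp_unique[OF _ assms(1) assms(2)] by (intro the_equality) (metis, metis)
  then show ?thesis using assms(2) by (simp add: harmonic_conjugate_def)
qed

section \<open>The Poisson integral\<close>

lemma measurable_circle_ident [measurable]: "(\<lambda>\<zeta>. \<zeta>) \<in> borel_measurable circle_measure"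
  by (intro borel_measurable_circle_continuous continuous_intros)

lemma integrable_circle_mult:
  fixes k \<phi> :: "complex \<Rightarrow> complex"
  assumes k: "continuous_on (sphere 0 1) k" and \<phi>: "integrable circle_measure \<phi>"
  shows "integrable circle_measure (\<lambda>\<zeta>. k \<zeta> * \<phi> \<zeta>)"
proof -
  have "bounded (k ` sphere 0 1)" by (intro compact_imp_bounded compact_continuous_image k) auto
  then obtain B where B: "\<And>\<zeta>. \<zeta> \<in> sphere 0 1 \<Longrightarrow> norm (k \<zeta>) \<le> B" unfolding bounded_iff by blast
  have [measurable]: "k \<in> borel_measurable circle_measure" "\<phi> \<in> borel_measurable circle_measure"
    using k \<phi> by (auto intro: borel_measurable_circle_continuous)
  show ?thesis
  proof (rule Bochner_Integration.integrable_bound)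
    show "integrable circle_measure (\<lambda>\<zeta>. B * norm (\<phi> \<zeta>))" using \<phi> by simp
    show "AE \<zeta> in circle_measure. norm (k \<zeta> * \<phi> \<zeta>) \<le> norm (B * norm (\<phi> \<zeta>))"
    proof (rule AE_I2)
      fix \<zeta> :: complex assume "\<zeta> \<in> space circle_measure"
      then have "norm (k \<zeta>) \<le> B" using B by simp
      then show "norm (k \<zeta> * \<phi> \<zeta>) \<le> norm (B * norm (\<phi> \<zeta>))"
        by (auto simp: norm_mult abs_mult intro!: mult_right_mono)
    qed
  qed measurable
qed

lemma circle_ne:
  fixes \<zeta> z :: complex
  assumes "norm z < 1" "\<zeta> \<in> sphere 0 1"
  shows "\<zeta> - z \<noteq> 0" "1 - z * cnj \<zeta> \<noteq> 0" "1 - cnj z * \<zeta> \<noteq> 0"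
proof -
  show "\<zeta> - z \<noteq> 0" using assms by auto
  have "norm (z * cnj \<zeta>) < 1" "norm (cnj z * \<zeta>) < 1" using assms by (auto simp: norm_mult)
  then show "1 - z * cnj \<zeta> \<noteq> 0" "1 - cnj z * \<zeta> \<noteq> 0" by (metis eq_iff_diff_eq_0 less_irrefl norm_one)+
qed

lemma circle_cnj: "\<zeta> \<in> sphere 0 1 \<Longrightarrow> \<zeta> * cnj \<zeta> = 1"
  by (simp add: complex_norm_square[symmetric])

lemma continuous_on_cauchy_kernel:
  fixes z :: complex
  shows "norm z < 1 \<Longrightarrow> continuous_on (sphere 0 1) (\<lambda>\<zeta>. \<zeta> / (\<zeta> - z))"
  using circle_ne(1) by (intro continuous_intros) auto

text \<open>
The geometric series of the kernel can be integrated term by term, which gives a power series.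
\<close>

lemma cauchy_transform_holomorphic:
  fixes \<phi> :: "complex \<Rightarrow> complex"
  assumes \<phi>: "integrable circle_measure \<phi>"
  shows "(\<lambda>z. \<integral>\<zeta>. \<zeta> / (\<zeta> - z) * \<phi> \<zeta> \<partial>circle_measure) holomorphic_on ball 0 1"
proof (rule power_series_holomorphic)
  fix z :: complex assume "z \<in> ball 0 1"
  then have z: "norm z < 1" by simp
  have cn: "continuous_on (sphere 0 1) (\<lambda>\<zeta>. (z * cnj \<zeta>) ^ n)" for n by (intro continuous_intros)
  have nf: "norm ((z * cnj \<zeta>) ^ n * \<phi> \<zeta>) = norm z ^ n * norm (\<phi> \<zeta>)" if "\<zeta> \<in> space circle_measure" for n \<zeta>
    using that by (simp add: norm_mult norm_power)
  have geo: "summable (\<lambda>n. norm z ^ n)" using z by (intro summable_geometric) simp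
  have "(\<lambda>n. \<integral>\<zeta>. (z * cnj \<zeta>) ^ n * \<phi> \<zeta> \<partial>circle_measure) sums (\<integral>\<zeta>. (\<Sum>n. (z * cnj \<zeta>) ^ n * \<phi> \<zeta>) \<partial>circle_measure)"
  proof (rule sums_integral)
    show "integrable circle_measure (\<lambda>\<zeta>. (z * cnj \<zeta>) ^ n * \<phi> \<zeta>)" for n
      by (rule integrable_circle_mult[OF cn \<phi>])
    show "AE \<zeta> in circle_measure. summable (\<lambda>n. norm ((z * cnj \<zeta>) ^ n * \<phi> \<zeta>))"
      by (intro AE_I2) (simp only: nf summable_mult2[OF geo])
    have "(\<integral>\<zeta>. norm ((z * cnj \<zeta>) ^ n * \<phi> \<zeta>) \<partial>circle_measure) = norm z ^ n * (\<integral>\<zeta>. norm (\<phi> \<zeta>) \<partial>circle_measure)" for n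
      by (simp only: Bochner_Integration.integral_cong[OF refl nf] integral_mult_right_zero)
    then show "summable (\<lambda>n. \<integral>\<zeta>. norm ((z * cnj \<zeta>) ^ n * \<phi> \<zeta>) \<partial>circle_measure)"
      by (simp only: summable_mult2[OF geo])
  qed
  moreover have "(\<integral>\<zeta>. (z * cnj \<zeta>) ^ n * \<phi> \<zeta> \<partial>circle_measure) = (\<integral>\<zeta>. cnj \<zeta> ^ n * \<phi> \<zeta> \<partial>circle_measure) * (z - 0) ^ n" for n
    by (simp only: power_mult_distrib mult.assoc integral_mult_right_zero) simp
  moreover have "(\<integral>\<zeta>. (\<Sum>n. (z * cnj \<zeta>) ^ n * \<phi> \<zeta>) \<partial>circle_measure) = (\<integral>\<zeta>. \<zeta> / (\<zeta> - z) * \<phi> \<zeta> \<partial>circle_measure)"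
  proof (rule Bochner_Integration.integral_cong[OF refl])
    fix \<zeta> :: complex assume "\<zeta> \<in> space circle_measure"
    then have \<zeta>: "\<zeta> \<in> sphere 0 1" by simp
    have "norm (z * cnj \<zeta>) < 1" using z \<zeta> by (simp add: norm_mult)
    then have "(\<lambda>n. (z * cnj \<zeta>) ^ n * \<phi> \<zeta>) sums (1 / (1 - z * cnj \<zeta>) * \<phi> \<zeta>)"
      by (intro sums_mult2 geometric_sums)
    moreover have "1 / (1 - z * cnj \<zeta>) = \<zeta> / (\<zeta> - z)"
      using circle_ne[OF z \<zeta>] circle_cnj[OF \<zeta>] by (simp add: frac_eq_eq algebra_simps)
    ultimately show "(\<Sum>n. (z * cnj \<zeta>) ^ n * \<phi> \<zeta>) = \<zeta> / (\<zeta> - z) * \<phi> \<zeta>" by (simp add: sums_iff)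
  qed
  ultimately show "(\<lambda>n. (\<integral>\<zeta>. cnj \<zeta> ^ n * \<phi> \<zeta> \<partial>circle_measure) * (z - 0) ^ n) sums (\<integral>\<zeta>. \<zeta> / (\<zeta> - z) * \<phi> \<zeta> \<partial>circle_measure)"
    by simp
qed

definition poisson_kernel :: "complex \<Rightarrow> complex \<Rightarrow> real" where
  "poisson_kernel z \<zeta> = (1 - (norm z)\<^sup>2) / (norm (\<zeta> - z))\<^sup>2"

lemma poisson_kernel_nonneg: "norm z < 1 \<Longrightarrow> poisson_kernel z \<zeta> \<ge> 0"
  by (simp add: poisson_kernel_def power_le_one)

lemma continuous_on_poisson_kernel: "norm z < 1 \<Longrightarrow> continuous_on (sphere 0 1) (poisson_kernel z)"
  unfolding poisson_kernel_def using circle_ne(1) by (intro continuous_intros) auto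

text \<open>
The first form shows the analytic and the co-analytic part of the kernel; the second one turns
the Poisson integral of a holomorphic function into a Cauchy integral.
\<close>

lemma poisson_kernel_eq_cauchy:
  assumes z: "norm z < 1" and \<zeta>: "\<zeta> \<in> sphere 0 1"
  shows "of_real (poisson_kernel z \<zeta>) = \<zeta> / (\<zeta> - z) + cnj (\<zeta> / (\<zeta> - z) - 1)"
    and "of_real (poisson_kernel z \<zeta>) = (1 - of_real ((norm z)\<^sup>2)) / (1 - cnj z * \<zeta>) * (\<zeta> / (\<zeta> - z))"
proof -
  note ne = circle_ne[OF z \<zeta>]
  have ne': "cnj \<zeta> - cnj z \<noteq> 0" using ne(1) by (metis complex_cnj_diff complex_cnj_zero_iff)
  have K: "of_real (poisson_kernel z \<zeta>) = (1 - z * cnj z) / ((\<zeta> - z) * (cnj \<zeta> - cnj z))"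
    unfolding poisson_kernel_def of_real_divide of_real_diff of_real_1 complex_norm_square complex_cnj_diff ..
  have "cnj (\<zeta> / (\<zeta> - z) - 1) = cnj z / (cnj \<zeta> - cnj z)" using ne' by (simp add: field_simps)
  then have "\<zeta> / (\<zeta> - z) + cnj (\<zeta> / (\<zeta> - z) - 1) = (\<zeta> * (cnj \<zeta> - cnj z) + cnj z * (\<zeta> - z)) / ((\<zeta> - z) * (cnj \<zeta> - cnj z))"
    using ne ne' by (simp add: add_frac_eq)
  also have "\<zeta> * (cnj \<zeta> - cnj z) + cnj z * (\<zeta> - z) = 1 - z * cnj z"
    using circle_cnj[OF \<zeta>] by (simp add: algebra_simps)
  finally show "of_real (poisson_kernel z \<zeta>) = \<zeta> / (\<zeta> - z) + cnj (\<zeta> / (\<zeta> - z) - 1)" using K by simp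
  have "\<zeta> * (cnj \<zeta> - cnj z) = 1 - cnj z * \<zeta>" using circle_cnj[OF \<zeta>] by (simp add: algebra_simps)
  then have "(1 - z * cnj z) / ((\<zeta> - z) * (cnj \<zeta> - cnj z)) = (1 - z * cnj z) / (1 - cnj z * \<zeta>) * (\<zeta> / (\<zeta> - z))"
    using ne ne' by (simp add: frac_eq_eq)
  then show "of_real (poisson_kernel z \<zeta>) = (1 - of_real ((norm z)\<^sup>2)) / (1 - cnj z * \<zeta>) * (\<zeta> / (\<zeta> - z))"
    unfolding K complex_norm_square .
qed

lemma poisson_extension_eq: "poisson_extension \<phi> z = (\<integral>\<zeta>. of_real (poisson_kernel z \<zeta>) * \<phi> \<zeta> \<partial>circle_measure)"
  by (simp add: poisson_extension_def poisson_kernel_def scaleR_conv_of_real)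

lemma poisson_extension_decomposition:
  assumes \<phi>: "integrable circle_measure \<phi>"
  obtains g h where "canonical_decomp (poisson_extension \<phi>) g h"
proof
  define g where "g z = (\<integral>\<zeta>. \<zeta> / (\<zeta> - z) * \<phi> \<zeta> \<partial>circle_measure)" for z
  define h where "h z = (\<integral>\<zeta>. \<zeta> / (\<zeta> - z) * cnj (\<phi> \<zeta>) \<partial>circle_measure) - (\<integral>\<zeta>. cnj (\<phi> \<zeta>) \<partial>circle_measure)" for z
  have \<phi>': "integrable circle_measure (\<lambda>\<zeta>. cnj (\<phi> \<zeta>))" using \<phi> by simp
  show "canonical_decomp (poisson_extension \<phi>) g h"
    unfolding canonical_decomp_def
  proof (intro conjI ballI)
    show "g holomorphic_on ball 0 1" "h holomorphic_on ball 0 1"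
      unfolding g_def[abs_def] h_def[abs_def]
      by (intro holomorphic_intros cauchy_transform_holomorphic \<phi> \<phi>')+
    have "(\<integral>\<zeta>. \<zeta> / (\<zeta> - 0) * cnj (\<phi> \<zeta>) \<partial>circle_measure) = (\<integral>\<zeta>. cnj (\<phi> \<zeta>) \<partial>circle_measure)"
      by (intro Bochner_Integration.integral_cong) auto
    then show "h 0 = 0" by (simp add: h_def)
    fix z :: complex assume "z \<in> ball 0 1"
    then have z: "norm z < 1" by simp
    note i = integrable_circle_mult[OF continuous_on_cauchy_kernel[OF z] \<phi>]
      integrable_circle_mult[OF continuous_on_cauchy_kernel[OF z] \<phi>']
    have "poisson_extension \<phi> z = (\<integral>\<zeta>. \<zeta> / (\<zeta> - z) * \<phi> \<zeta> + cnj (\<zeta> / (\<zeta> - z) * cnj (\<phi> \<zeta>) - cnj (\<phi> \<zeta>)) \<partial>circle_measure)"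
      unfolding poisson_extension_eq
    proof (intro Bochner_Integration.integral_cong refl)
      fix \<zeta> :: complex assume "\<zeta> \<in> space circle_measure"
      then have "of_real (poisson_kernel z \<zeta>) = \<zeta> / (\<zeta> - z) + cnj (\<zeta> / (\<zeta> - z) - 1)"
        by (intro poisson_kernel_eq_cauchy(1)[OF z]) simp
      moreover have "(x + cnj (x - 1)) * w = x * w + cnj (x * cnj w - cnj w)" for x w :: complex
        by (simp add: algebra_simps)
      ultimately show "of_real (poisson_kernel z \<zeta>) * \<phi> \<zeta> = \<zeta> / (\<zeta> - z) * \<phi> \<zeta> + cnj (\<zeta> / (\<zeta> - z) * cnj (\<phi> \<zeta>) - cnj (\<phi> \<zeta>))"
        by (simp only:)
    qed
    also have "\<dots> = g z + cnj (h z)"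
      unfolding g_def h_def using i \<phi>'
      by (subst Bochner_Integration.integral_add) (simp_all only: Bochner_Integration.integrable_diff integrable_cnj
         Bochner_Integration.integral_cnj Bochner_Integration.integral_diff)
    finally show "poisson_extension \<phi> z = g z + cnj (h z)" .
  qed
qed

text \<open>
The factor \<open>(1 - (norm z)\<^sup>2) / (1 - cnj z * \<zeta>)\<close> is holomorphic in \<open>\<zeta>\<close> on a disk of radius
\<open>1 / norm z > 1\<close> and equals 1 at \<open>\<zeta> = z\<close>, so Cauchy's formula applies to its product with \<open>g\<close>.
\<close>

lemma poisson_extension_holomorphic:
  assumes g: "g holomorphic_on ball 0 R" and R: "R > 1" and z: "norm z < 1"
  shows "poisson_extension g z = g z"
proof -
  define F where "F \<zeta> = g \<zeta> * ((1 - of_real ((norm z)\<^sup>2)) / (1 - cnj z * \<zeta>))" for \<zeta>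
  define R' where "R' = (if z = 0 then R else min R (1 / norm z))"
  have R': "R' > 1" "R' \<le> R" using R z by (auto simp: R'_def)
  have "1 - cnj z * \<zeta> \<noteq> 0" if "\<zeta> \<in> ball 0 R'" for \<zeta>
  proof (cases "z = 0")
    case False
    then have "norm \<zeta> < 1 / norm z" using that by (simp add: R'_def)
    then have "norm (cnj z * \<zeta>) < 1" using False by (simp add: norm_mult field_simps)
    then show ?thesis by (metis eq_iff_diff_eq_0 less_irrefl norm_one)
  qed simp
  then have F: "F holomorphic_on ball 0 R'"
    unfolding F_def using R' by (intro holomorphic_intros holomorphic_on_subset[OF g]) auto
  have "poisson_extension g z = (\<integral>\<zeta>. F \<zeta> * \<zeta> / (\<zeta> - z) \<partial>circle_measure)"
    unfolding poisson_extension_eq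
    using poisson_kernel_eq_cauchy(2)[OF z]
    by (intro Bochner_Integration.integral_cong refl) (simp add: F_def mult_ac)
  also have "\<dots> = F z" by (rule circle_cauchy_formula[OF F R'(1) z])
  also have "\<dots> = g z"
  proof -
    have "(norm z)\<^sup>2 < 1" using z by (simp add: power_less_one_iff)
    then have "(norm z)\<^sup>2 \<noteq> 1" by simp
    then have "1 - complex_of_real ((norm z)\<^sup>2) \<noteq> 0" by (metis eq_iff_diff_eq_0 of_real_eq_1_iff)
    moreover have "1 - cnj z * z = 1 - of_real ((norm z)\<^sup>2)" by (simp only: complex_norm_square mult.commute)
    ultimately show ?thesis by (simp add: F_def)
  qed
  finally show ?thesis .
qed

lemma poisson_extension_closed_disk_pair:
  assumes gh: "closed_disk_pair g h" and z: "norm z < 1"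
  shows "poisson_extension (\<lambda>\<zeta>. g \<zeta> + cnj (h \<zeta>)) z = g z + cnj (h z)"
proof -
  obtain R where R: "R > 1" "g holomorphic_on ball 0 R" "h holomorphic_on ball 0 R"
    using gh by (auto simp: closed_disk_pair_def)
  note cont = closed_disk_pair_continuous_circle[OF gh]
  have cK: "continuous_on (sphere 0 1) (\<lambda>\<zeta>. complex_of_real (poisson_kernel z \<zeta>))"
    by (intro continuous_intros continuous_on_poisson_kernel z)
  have "poisson_extension (\<lambda>\<zeta>. g \<zeta> + cnj (h \<zeta>)) z
      = (\<integral>\<zeta>. of_real (poisson_kernel z \<zeta>) * g \<zeta> + cnj (of_real (poisson_kernel z \<zeta>) * h \<zeta>) \<partial>circle_measure)"
    unfolding poisson_extension_eq by (intro Bochner_Integration.integral_cong refl) (simp add: algebra_simps)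
  also have "\<dots> = poisson_extension g z + cnj (poisson_extension h z)"
    unfolding poisson_extension_eq
    by (subst Bochner_Integration.integral_add, intro integrable_circle_continuous continuous_intros cK cont,
        intro integrable_circle_continuous continuous_intros cK cont)
       (simp only: Bochner_Integration.integral_cnj)
  finally show ?thesis using poisson_extension_holomorphic[OF R(2,1) z] poisson_extension_holomorphic[OF R(3,1) z] by simp
qed

lemma integral_poisson_kernel:
  assumes z: "norm z < 1"
  shows "(\<integral>\<zeta>. poisson_kernel z \<zeta> \<partial>circle_measure) = 1"
proof -
  have "complex_of_real (\<integral>\<zeta>. poisson_kernel z \<zeta> \<partial>circle_measure) = poisson_extension (\<lambda>_. 1) z"
    unfolding poisson_extension_eq by simp
  also have "\<dots> = 1" using poisson_extension_holomorphic[of "\<lambda>_. 1" 2 z] z by simp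
  finally show ?thesis by (simp only: of_real_eq_1_iff)
qed

text \<open>
The graph of \<open>s powr p\<close> lies above its tangent at \<open>m\<close>. Integrated against a probability density
with mean \<open>m\<close>, this is Jensen's inequality.
\<close>

lemma powr_tangent:
  fixes s m p :: real
  assumes "p > 1" "s \<ge> 0" "m \<ge> 0"
  shows "m powr p + p * m powr (p - 1) * (s - m) \<le> s powr p"
proof -
  define q where "q = p / (p - 1)"
  have q: "q > 1" "1 / p + 1 / q = 1" "(p - 1) * q = p" using assms by (auto simp: q_def field_simps)
  have "s * m powr (p - 1) \<le> s powr p / p + (m powr (p - 1)) powr q / q"
    using assms q by (intro Youngs_inequality) auto
  then have "p * (s * m powr (p - 1)) \<le> p * (s powr p / p + m powr p / q)"
    using assms q by (intro mult_left_mono) (auto simp: powr_powr)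
  also have "\<dots> = s powr p + (p - 1) * m powr p" using assms by (simp add: q_def field_simps)
  also have "m powr p = m powr (p - 1) * m" using assms powr_add[of m "p - 1" 1] by (cases "m = 0") auto
  finally show ?thesis
    using \<open>m powr p = m powr (p - 1) * m\<close> by (simp add: algebra_simps)
qed

lemma Lp_circle_integrable:
  assumes p: "p > 1" and \<phi>: "\<phi> \<in> Lp_circle p"
  shows "integrable circle_measure \<phi>"
proof (rule Bochner_Integration.integrable_bound)
  show "integrable circle_measure (\<lambda>\<zeta>. 1 + norm (\<phi> \<zeta>) powr p)"
    using \<phi> by (auto simp: Lp_circle_def)
  show "\<phi> \<in> borel_measurable circle_measure" using \<phi> by (simp add: Lp_circle_def)
  have "x \<le> 1 + x powr p" if "x \<ge> 0" for x :: real
    using powr_mono[of 1 p x] p that by (cases "x \<le> 1") (auto simp: add_increasing2)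
  then show "AE \<zeta> in circle_measure. norm (\<phi> \<zeta>) \<le> norm (1 + norm (\<phi> \<zeta>) powr p)"
    by (intro AE_I2) simp
qed

lemma poisson_extension_powr_le:
  assumes p: "p > 1" and \<phi>: "\<phi> \<in> Lp_circle p" and z: "norm z < 1"
  shows "norm (poisson_extension \<phi> z) powr p \<le> (\<integral>\<zeta>. poisson_kernel z \<zeta> * norm (\<phi> \<zeta>) powr p \<partial>circle_measure)"
    and "integrable circle_measure (\<lambda>\<zeta>. poisson_kernel z \<zeta> * norm (\<phi> \<zeta>) powr p)"
proof -
  note i = Lp_circle_integrable[OF p \<phi>]
  have rm: "integrable circle_measure (\<lambda>\<zeta>. poisson_kernel z \<zeta> * f \<zeta>)" if "integrable circle_measure f" for f
  proof -
    have "integrable circle_measure (\<lambda>\<zeta>. complex_of_real (poisson_kernel z \<zeta>) * complex_of_real (f \<zeta>))"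
      using that by (intro integrable_circle_mult continuous_intros continuous_on_poisson_kernel z) auto
    from integrable_Re[OF this] show ?thesis by simp
  qed
  have ip: "integrable circle_measure (\<lambda>\<zeta>. norm (\<phi> \<zeta>) powr p)" using \<phi> by (simp add: Lp_circle_def)
  then show "integrable circle_measure (\<lambda>\<zeta>. poisson_kernel z \<zeta> * norm (\<phi> \<zeta>) powr p)" by (rule rm)
  define M where "M = (\<integral>\<zeta>. poisson_kernel z \<zeta> * norm (\<phi> \<zeta>) \<partial>circle_measure)"
  have M0: "M \<ge> 0" unfolding M_def by (intro integral_nonneg_AE AE_I2 mult_nonneg_nonneg poisson_kernel_nonneg z) auto
  have "norm (poisson_extension \<phi> z) \<le> (\<integral>\<zeta>. norm (of_real (poisson_kernel z \<zeta>) * \<phi> \<zeta>) \<partial>circle_measure)"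
    unfolding poisson_extension_eq by (rule integral_norm_bound)
  also have "\<dots> = M" unfolding M_def using poisson_kernel_nonneg[OF z] by (simp add: norm_mult)
  finally have "norm (poisson_extension \<phi> z) powr p \<le> M powr p" using p by (intro powr_mono2) auto
  also have "M powr p = (\<integral>\<zeta>. (M powr p - p * M powr (p - 1) * M) * poisson_kernel z \<zeta> + p * M powr (p - 1) * (poisson_kernel z \<zeta> * norm (\<phi> \<zeta>)) \<partial>circle_measure)"
    using rm[OF integrable_norm[OF i]] integrable_circle_continuous[OF continuous_on_poisson_kernel[OF z]]
    by (simp add: integral_poisson_kernel[OF z] M_def[symmetric])
  also have "\<dots> \<le> (\<integral>\<zeta>. poisson_kernel z \<zeta> * norm (\<phi> \<zeta>) powr p \<partial>circle_measure)"
  proof (rule integral_mono)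
    show "integrable circle_measure (\<lambda>\<zeta>. (M powr p - p * M powr (p - 1) * M) * poisson_kernel z \<zeta> + p * M powr (p - 1) * (poisson_kernel z \<zeta> * norm (\<phi> \<zeta>)))"
      using rm[OF integrable_norm[OF i]] integrable_circle_continuous[OF continuous_on_poisson_kernel[OF z]] by simp
    show "integrable circle_measure (\<lambda>\<zeta>. poisson_kernel z \<zeta> * norm (\<phi> \<zeta>) powr p)" by (rule rm[OF ip])
    fix \<zeta>
    have "poisson_kernel z \<zeta> * (M powr p + p * M powr (p - 1) * (norm (\<phi> \<zeta>) - M)) \<le> poisson_kernel z \<zeta> * norm (\<phi> \<zeta>) powr p"
      using powr_tangent[OF p _ M0, of "norm (\<phi> \<zeta>)"] by (intro mult_left_mono poisson_kernel_nonneg z) auto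
    then show "(M powr p - p * M powr (p - 1) * M) * poisson_kernel z \<zeta> + p * M powr (p - 1) * (poisson_kernel z \<zeta> * norm (\<phi> \<zeta>)) \<le> poisson_kernel z \<zeta> * norm (\<phi> \<zeta>) powr p"
      by (simp add: algebra_simps)
  qed
  finally show "norm (poisson_extension \<phi> z) powr p \<le> (\<integral>\<zeta>. poisson_kernel z \<zeta> * norm (\<phi> \<zeta>) powr p \<partial>circle_measure)" .
qed

lemma poisson_kernel_symmetric:
  assumes "norm \<zeta> = 1" "norm \<eta> = 1"
  shows "poisson_kernel (of_real r * \<eta>) \<zeta> = poisson_kernel (of_real r * \<zeta>) \<eta>"
proof -
  have "(norm (\<zeta> - of_real r * \<eta>))\<^sup>2 = (norm (\<eta> - of_real r * \<zeta>))\<^sup>2"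
  proof -
    have n: "(Re \<zeta>)\<^sup>2 + (Im \<zeta>)\<^sup>2 = 1" "(Re \<eta>)\<^sup>2 + (Im \<eta>)\<^sup>2 = 1"
      using assms by (simp_all flip: cmod_power2)
    have sq: "(norm (a - of_real r * b))\<^sup>2 = ((Re a)\<^sup>2 + (Im a)\<^sup>2) + r\<^sup>2 * ((Re b)\<^sup>2 + (Im b)\<^sup>2) - 2 * r * (Re a * Re b + Im a * Im b)" for a b
      unfolding cmod_power2 by (simp add: power2_eq_square algebra_simps)
    show ?thesis unfolding sq n by (simp add: mult.commute)
  qed
  then show ?thesis using assms by (simp add: poisson_kernel_def norm_mult)
qed

text \<open>
Integrate the pointwise Jensen estimate over \<open>\<eta>\<close> and exchange the integrals; the kernel is
symmetric in \<open>\<eta>\<close> and \<open>\<zeta>\<close>, and so has mean 1 in \<open>\<eta>\<close> as well.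
\<close>

lemma poisson_extension_mean_le:
  assumes p: "p > 1" and \<phi>: "\<phi> \<in> Lp_circle p" and r: "0 \<le> r" "r < 1"
  shows "circle_power p (\<lambda>\<eta>. poisson_extension \<phi> (of_real r * \<eta>)) \<le> circle_power p \<phi>"
proof -
  interpret pair_sigma_finite circle_measure circle_measure ..
  have [measurable]: "\<phi> \<in> borel_measurable circle_measure" using \<phi> by (simp add: Lp_circle_def)
  have ip: "integrable circle_measure (\<lambda>\<zeta>. norm (\<phi> \<zeta>) powr p)" using \<phi> by (simp add: Lp_circle_def)
  have nr: "norm (of_real r * \<eta>) < 1" if "\<eta> \<in> space circle_measure" for \<eta> :: complex
    using that r by (simp add: norm_mult)
  have [measurable]: "(\<lambda>(\<eta>, \<zeta>). poisson_kernel (of_real r * \<eta>) \<zeta>) \<in> borel_measurable (circle_measure \<Otimes>\<^sub>M circle_measure)"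
    unfolding poisson_kernel_def by measurable
  have "(\<integral>\<^sup>+\<eta>. ennreal (norm (poisson_extension \<phi> (of_real r * \<eta>)) powr p) \<partial>circle_measure)
      \<le> (\<integral>\<^sup>+\<eta>. (\<integral>\<^sup>+\<zeta>. ennreal (poisson_kernel (of_real r * \<eta>) \<zeta> * norm (\<phi> \<zeta>) powr p) \<partial>circle_measure) \<partial>circle_measure)"
  proof (rule nn_integral_mono)
    fix \<eta> assume \<eta>: "\<eta> \<in> space circle_measure"
    have "ennreal (norm (poisson_extension \<phi> (of_real r * \<eta>)) powr p) \<le> ennreal (\<integral>\<zeta>. poisson_kernel (of_real r * \<eta>) \<zeta> * norm (\<phi> \<zeta>) powr p \<partial>circle_measure)"
      by (intro ennreal_leI poisson_extension_powr_le p \<phi> nr \<eta>)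
    also have "\<dots> = (\<integral>\<^sup>+\<zeta>. ennreal (poisson_kernel (of_real r * \<eta>) \<zeta> * norm (\<phi> \<zeta>) powr p) \<partial>circle_measure)"
      by (intro nn_integral_eq_integral[symmetric] poisson_extension_powr_le p \<phi> nr \<eta> AE_I2 mult_nonneg_nonneg poisson_kernel_nonneg) auto
    finally show "ennreal (norm (poisson_extension \<phi> (of_real r * \<eta>)) powr p) \<le> (\<integral>\<^sup>+\<zeta>. ennreal (poisson_kernel (of_real r * \<eta>) \<zeta> * norm (\<phi> \<zeta>) powr p) \<partial>circle_measure)" .
  qed
  also have "\<dots> = (\<integral>\<^sup>+\<zeta>. (\<integral>\<^sup>+\<eta>. ennreal (poisson_kernel (of_real r * \<eta>) \<zeta> * norm (\<phi> \<zeta>) powr p) \<partial>circle_measure) \<partial>circle_measure)"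
    by (rule Fubini'[symmetric]) measurable
  also have "\<dots> = (\<integral>\<^sup>+\<zeta>. ennreal (norm (\<phi> \<zeta>) powr p) \<partial>circle_measure)"
  proof (rule nn_integral_cong)
    fix \<zeta> assume \<zeta>: "\<zeta> \<in> space circle_measure"
    have "(\<integral>\<^sup>+\<eta>. ennreal (poisson_kernel (of_real r * \<eta>) \<zeta> * norm (\<phi> \<zeta>) powr p) \<partial>circle_measure)
      = (\<integral>\<^sup>+\<eta>. ennreal (norm (\<phi> \<zeta>) powr p * poisson_kernel (of_real r * \<zeta>) \<eta>) \<partial>circle_measure)"
      using \<zeta> poisson_kernel_symmetric[of \<zeta>] by (intro nn_integral_cong) (simp add: mult.commute)
    also have "\<dots> = ennreal (\<integral>\<eta>. norm (\<phi> \<zeta>) powr p * poisson_kernel (of_real r * \<zeta>) \<eta> \<partial>circle_measure)"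
      using integrable_circle_continuous[OF continuous_on_poisson_kernel[OF nr[OF \<zeta>]]]
      by (intro nn_integral_eq_integral integrable_mult_right AE_I2 mult_nonneg_nonneg poisson_kernel_nonneg nr \<zeta>) auto
    also have "\<dots> = ennreal (norm (\<phi> \<zeta>) powr p)"
      by (simp add: integral_poisson_kernel[OF nr[OF \<zeta>]])
    finally show "(\<integral>\<^sup>+\<eta>. ennreal (poisson_kernel (of_real r * \<eta>) \<zeta> * norm (\<phi> \<zeta>) powr p) \<partial>circle_measure) = ennreal (norm (\<phi> \<zeta>) powr p)" .
  qed
  also have "\<dots> = ennreal (circle_power p \<phi>)"
    using ip by (intro nn_integral_eq_integral) auto
  finally have le: "(\<integral>\<^sup>+\<eta>. ennreal (norm (poisson_extension \<phi> (of_real r * \<eta>)) powr p) \<partial>circle_measure) \<le> ennreal (circle_power p \<phi>)" .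
  show ?thesis
  proof (cases "integrable circle_measure (\<lambda>\<eta>. norm (poisson_extension \<phi> (of_real r * \<eta>)) powr p)")
    case True
    then show ?thesis using le by (subst (asm) nn_integral_eq_integral) (auto simp: ennreal_le_iff)
  next
    case False
    then show ?thesis by (simp add: not_integrable_integral_eq)
  qed
qed

section \<open>Radial boundary values\<close>

text \<open>
The Cauchy criterion for the radial limit, with radii restricted to the rationals so that only
countably many conditions are involved.
\<close>

definition radial_cauchy :: "(complex \<Rightarrow> complex) \<Rightarrow> complex \<Rightarrow> bool" where
  "radial_cauchy F \<zeta> \<longleftrightarrow> (\<forall>k. \<exists>N. \<forall>s t :: rat.
     1 - inverse (real (Suc N)) < of_rat s \<and> of_rat s < (1::real) \<longrightarrow>
     1 - inverse (real (Suc N)) < of_rat t \<and> of_rat t < (1::real) \<longrightarrow>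
     dist (F (of_real (of_rat s) * \<zeta>)) (F (of_real (of_rat t) * \<zeta>)) \<le> inverse (real (Suc k)))"

lemma radial_limit_iff_cauchy:
  fixes F :: "complex \<Rightarrow> complex"
  assumes F: "continuous_on (ball 0 1) F" and \<zeta>: "norm \<zeta> = 1"
  shows "(\<exists>L. ((\<lambda>r. F (of_real r * \<zeta>)) \<longlongrightarrow> L) (at_left (1::real))) \<longleftrightarrow> radial_cauchy F \<zeta>"
proof
  assume "\<exists>L. ((\<lambda>r. F (of_real r * \<zeta>)) \<longlongrightarrow> L) (at_left (1::real))"
  then obtain L where L: "((\<lambda>r. F (of_real r * \<zeta>)) \<longlongrightarrow> L) (at_left (1::real))" by blast
  show "radial_cauchy F \<zeta>"
    unfolding radial_cauchy_def
  proof (intro allI)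
    fix k
    have "\<forall>\<^sub>F r in at_left (1::real). dist (F (of_real r * \<zeta>)) L < inverse (real (Suc k)) / 2"
      using L by (rule tendstoD) simp
    then obtain b where b: "b < 1" "\<And>r. b < r \<Longrightarrow> r < 1 \<Longrightarrow> dist (F (of_real r * \<zeta>)) L < inverse (real (Suc k)) / 2"
      unfolding eventually_at_left_field by blast
    obtain N where N: "inverse (real (Suc N)) < 1 - b" using reals_Archimedean[of "1 - b"] b(1) by auto
    show "\<exists>N. \<forall>s t :: rat.
     1 - inverse (real (Suc N)) < of_rat s \<and> of_rat s < (1::real) \<longrightarrow>
     1 - inverse (real (Suc N)) < of_rat t \<and> of_rat t < (1::real) \<longrightarrow>
     dist (F (of_real (of_rat s) * \<zeta>)) (F (of_real (of_rat t) * \<zeta>)) \<le> inverse (real (Suc k))"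
    proof (intro exI[of _ N] allI impI)
      fix s t :: rat
      assume "1 - inverse (real (Suc N)) < of_rat s \<and> of_rat s < (1::real)"
        "1 - inverse (real (Suc N)) < of_rat t \<and> of_rat t < (1::real)"
      then have "dist (F (of_real (of_rat s) * \<zeta>)) L < inverse (real (Suc k)) / 2"
        "dist (F (of_real (of_rat t) * \<zeta>)) L < inverse (real (Suc k)) / 2"
        using N by (intro b(2); linarith)+
      then show "dist (F (of_real (of_rat s) * \<zeta>)) (F (of_real (of_rat t) * \<zeta>)) \<le> inverse (real (Suc k))"
        by (metis dist_triangle_half_l less_imp_le)
    qed
  qed
next
  assume cauchy: "radial_cauchy F \<zeta>"
  have cont: "continuous_on {0<..<1} (\<lambda>r::real. F (of_real r * \<zeta>))"
    using \<zeta> by (intro continuous_on_compose2[OF F] continuous_intros) (auto simp: norm_mult)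
  have all: "\<exists>b<1. \<forall>s t. b < s \<longrightarrow> s < 1 \<longrightarrow> b < t \<longrightarrow> t < 1 \<longrightarrow> dist (F (of_real s * \<zeta>)) (F (of_real t * \<zeta>)) \<le> e"
    if e: "e > 0" for e
  proof -
    obtain k where k: "inverse (real (Suc k)) < e" using reals_Archimedean[OF e] by auto
    obtain N where N: "\<And>s t :: rat. 1 - inverse (real (Suc N)) < of_rat s \<Longrightarrow> of_rat s < (1::real) \<Longrightarrow>
     1 - inverse (real (Suc N)) < of_rat t \<Longrightarrow> of_rat t < (1::real) \<Longrightarrow>
     dist (F (of_real (of_rat s) * \<zeta>)) (F (of_real (of_rat t) * \<zeta>)) \<le> inverse (real (Suc k))"
      using cauchy unfolding radial_cauchy_def by meson
    define b where "b = 1 - inverse (real (Suc N))"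
    have b: "0 \<le> b" "b < 1" by (auto simp: b_def inverse_le_1_iff)
    define I where "I = {b<..<1::real}"
    define Q where "Q = range (of_rat :: rat \<Rightarrow> real) \<inter> I"
    have dense: "I \<subseteq> closure Q"
    proof
      fix s assume s: "s \<in> I"
      show "s \<in> closure Q"
        unfolding closure_approachable
      proof (intro allI impI)
        fix d :: real assume d: "d > 0"
        obtain q where q: "s < of_rat q" "of_rat q < min 1 (s + d)"
          using of_rat_dense[of s "min 1 (s + d)"] s d by (auto simp: I_def)
        then have "of_rat q \<in> Q" "dist (of_rat q) s < d" using s by (auto simp: Q_def I_def dist_real_def)
        then show "\<exists>y\<in>Q. dist y s < d" by blast
      qed
    qed
    have cI: "isCont (\<lambda>r::real. F (of_real r * \<zeta>)) s" if "s \<in> I" for s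
      using cont that b by (simp add: continuous_on_eq_continuous_at I_def)
    have approx: "\<exists>x. (\<forall>n. x n \<in> Q) \<and> (\<lambda>n. F (of_real (x n) * \<zeta>)) \<longlonglongrightarrow> F (of_real s * \<zeta>)" if s: "s \<in> I" for s
    proof -
      have "s \<in> closure Q" using dense s by blast
      then obtain x where x: "\<And>n. x n \<in> Q" "x \<longlonglongrightarrow> s"
        unfolding closure_sequential by blast
      have "(\<lambda>n. F (of_real (x n) * \<zeta>)) \<longlonglongrightarrow> F (of_real s * \<zeta>)"
        using isCont_tendsto_compose[OF cI[OF s] x(2)] .
      with x(1) show ?thesis by blast
    qed
    have "dist (F (of_real s * \<zeta>)) (F (of_real t * \<zeta>)) \<le> e" if st: "s \<in> I" "t \<in> I" for s t
    proof -
      obtain x y where x: "\<And>n. x n \<in> Q" "(\<lambda>n. F (of_real (x n) * \<zeta>)) \<longlonglongrightarrow> F (of_real s * \<zeta>)"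
        and y: "\<And>n. y n \<in> Q" "(\<lambda>n. F (of_real (y n) * \<zeta>)) \<longlonglongrightarrow> F (of_real t * \<zeta>)"
        using approx[OF st(1)] approx[OF st(2)] by blast
      have "dist (F (of_real (x n) * \<zeta>)) (F (of_real (y n) * \<zeta>)) \<le> inverse (real (Suc k))" for n
      proof -
        obtain q1 q2 where "x n = of_rat q1" "y n = of_rat q2" using x(1)[of n] y(1)[of n] by (auto simp: Q_def)
        then show ?thesis using N[of q1 q2] x(1)[of n] y(1)[of n] by (simp add: Q_def I_def b_def)
      qed
      then have "dist (F (of_real s * \<zeta>)) (F (of_real t * \<zeta>)) \<le> inverse (real (Suc k))"
        by (intro LIMSEQ_le_const2[OF tendsto_dist[OF x(2) y(2)]]) auto
      then show ?thesis using k by simp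
    qed
    then show ?thesis using b(2) by (intro exI[of _ b]) (auto simp: I_def)
  qed
  define rr where "rr n = 1 - inverse (real (Suc n))" for n
  have rr: "rr \<longlonglongrightarrow> 1" unfolding rr_def using tendsto_diff[OF tendsto_const[of 1] LIMSEQ_inverse_real_of_nat] by simp
  have rr1: "rr n < 1" for n by (simp add: rr_def)
  have "Cauchy (\<lambda>n. F (of_real (rr n) * \<zeta>))"
  proof (rule metric_CauchyI)
    fix e :: real assume e: "e > 0"
    obtain b where b: "b < 1" "\<And>s t. b < s \<Longrightarrow> s < 1 \<Longrightarrow> b < t \<Longrightarrow> t < 1 \<Longrightarrow> dist (F (of_real s * \<zeta>)) (F (of_real t * \<zeta>)) \<le> e / 2"
      using all[of "e / 2"] e by auto
    obtain M where M: "\<And>n. n \<ge> M \<Longrightarrow> b < rr n" using order_tendstoD(1)[OF rr b(1)] by (auto simp: eventually_sequentially)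
    have "dist (F (of_real (rr m) * \<zeta>)) (F (of_real (rr n) * \<zeta>)) < e" if "m \<ge> M" "n \<ge> M" for m n
      using b(2)[OF M[OF that(1)] rr1 M[OF that(2)] rr1] e by linarith
    then show "\<exists>M. \<forall>m\<ge>M. \<forall>n\<ge>M. dist (F (of_real (rr m) * \<zeta>)) (F (of_real (rr n) * \<zeta>)) < e" by blast
  qed
  then obtain L where L: "(\<lambda>n. F (of_real (rr n) * \<zeta>)) \<longlonglongrightarrow> L" using Cauchy_convergent convergent_def by blast
  have "((\<lambda>r. F (of_real r * \<zeta>)) \<longlongrightarrow> L) (at_left (1::real))"
  proof (rule tendstoI)
    fix e :: real assume e: "e > 0"
    obtain b where b: "b < 1" "\<And>s t. b < s \<Longrightarrow> s < 1 \<Longrightarrow> b < t \<Longrightarrow> t < 1 \<Longrightarrow> dist (F (of_real s * \<zeta>)) (F (of_real t * \<zeta>)) \<le> e / 2"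
      using all[of "e / 2"] e by auto
    have "dist (F (of_real s * \<zeta>)) L < e" if s: "b < s" "s < 1" for s
    proof -
      have "\<forall>\<^sub>F n in sequentially. dist (F (of_real s * \<zeta>)) (F (of_real (rr n) * \<zeta>)) \<le> e / 2"
        using order_tendstoD(1)[OF rr b(1)] by eventually_elim (use b(2) s rr1 in auto)
      then have "dist (F (of_real s * \<zeta>)) L \<le> e / 2"
        by (intro tendsto_upperbound[OF tendsto_dist[OF tendsto_const L]]) auto
      then show ?thesis using e by simp
    qed
    then show "\<forall>\<^sub>F r in at_left 1. dist (F (of_real r * \<zeta>)) L < e"
      unfolding eventually_at_left_field using b(1) by blast
  qed
  then show "\<exists>L. ((\<lambda>r. F (of_real r * \<zeta>)) \<longlongrightarrow> L) (at_left (1::real))" by blast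
qed

definition radial_seq :: "nat \<Rightarrow> real" where "radial_seq n = 1 - inverse (real (Suc (Suc n)))"

lemma radial_seq: "0 < radial_seq n" "radial_seq n < 1" "radial_seq \<longlonglongrightarrow> 1"
proof -
  show "0 < radial_seq n" "radial_seq n < 1" by (auto simp: radial_seq_def inverse_less_1_iff)
  have "(\<lambda>n. inverse (real (Suc (Suc n)))) \<longlonglongrightarrow> 0" using LIMSEQ_inverse_real_of_nat by (rule LIMSEQ_Suc)
  from tendsto_diff[OF tendsto_const[of 1] this] show "radial_seq \<longlonglongrightarrow> 1" by (simp add: radial_seq_def[abs_def])
qed

lemma filterlim_radial_seq: "filterlim radial_seq (at_left 1) sequentially"
  unfolding filterlim_at using radial_seq by (auto intro!: always_eventually simp: less_imp_neq)

lemma boundary_function_tendsto: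
  assumes "boundary_function F \<zeta> \<noteq> 0"
  shows "((\<lambda>r. F (of_real r * \<zeta>)) \<longlongrightarrow> boundary_function F \<zeta>) (at_left (1::real))"
proof -
  obtain L where L: "((\<lambda>r. F (of_real r * \<zeta>)) \<longlongrightarrow> L) (at_left (1::real))"
    using assms unfolding boundary_function_def by (auto split: if_splits)
  then have "Lim (at_left (1::real)) (\<lambda>r. F (of_real r * \<zeta>)) = L" by (intro tendsto_Lim) auto
  then show ?thesis using L by (auto simp: boundary_function_def)
qed

lemma boundary_function_eqI:
  assumes "((\<lambda>r. F (of_real r * \<zeta>)) \<longlongrightarrow> L) (at_left (1::real))"
  shows "boundary_function F \<zeta> = L"
  using assms tendsto_Lim[OF _ assms] by (auto simp: boundary_function_def)

text \<open>
The set of points at which the radial limit exists is measurable by the Cauchy criterion, and on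
it the boundary function is the limit along one fixed sequence of radii.
\<close>

lemma borel_measurable_boundary_function:
  assumes F: "continuous_on (ball 0 1) F"
  shows "boundary_function F \<in> borel_measurable circle_measure"
proof -
  have cr: "(\<lambda>\<zeta>. F (of_real r * \<zeta>)) \<in> borel_measurable circle_measure" if "\<bar>r\<bar> < 1" for r
    using that by (intro borel_measurable_circle_continuous continuous_on_compose2[OF F] continuous_intros)
      (auto simp: norm_mult)
  \<comment> \<open>The values of \<open>F\<close> outside the disk are arbitrary and possibly not measurable; they are cut off.\<close>
  define G where "G q \<zeta> = (if \<bar>of_rat q :: real\<bar> < 1 then F (of_real (of_rat q) * \<zeta>) else 0)" for q \<zeta>
  have [measurable]: "G q \<in> borel_measurable circle_measure" for q
    unfolding G_def[abs_def] using cr by (cases "\<bar>of_rat q :: real\<bar> < 1") auto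
  define E where "E = {\<zeta> \<in> space circle_measure. radial_cauchy F \<zeta>}"
  have "E = {\<zeta> \<in> space circle_measure. \<forall>k. \<exists>N. \<forall>s t :: rat.
     1 - inverse (real (Suc N)) < of_rat s \<and> of_rat s < (1::real) \<longrightarrow>
     1 - inverse (real (Suc N)) < of_rat t \<and> of_rat t < (1::real) \<longrightarrow>
     dist (G s \<zeta>) (G t \<zeta>) \<le> inverse (real (Suc k))}"
  proof -
    have "\<bar>of_rat s :: real\<bar> < 1" if "1 - inverse (real (Suc N)) < of_rat s" "of_rat s < (1::real)" for s N
    proof -
      have "inverse (real (Suc N)) \<le> 1" by (simp add: inverse_le_1_iff)
      then show ?thesis using that by linarith
    qed
    then show ?thesis unfolding E_def radial_cauchy_def G_def by (intro Collect_cong conj_cong refl all_cong1 ex_cong1) auto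
  qed
  also have "\<dots> \<in> sets circle_measure" by measurable
  finally have E: "E \<in> sets circle_measure" .
  have "(\<lambda>\<zeta>. if \<zeta> \<in> E then F (of_real (radial_seq n) * \<zeta>) else 0) \<in> borel_measurable circle_measure" for n
    using radial_seq(1,2)[of n] E by (intro measurable_If_set cr measurable_const sets.Int sets.top) auto
  then show ?thesis
  proof (rule borel_measurable_LIMSEQ_metric)
    fix \<zeta> :: complex assume \<zeta>: "\<zeta> \<in> space circle_measure"
    show "(\<lambda>n. if \<zeta> \<in> E then F (of_real (radial_seq n) * \<zeta>) else 0) \<longlonglongrightarrow> boundary_function F \<zeta>"
    proof (cases "\<zeta> \<in> E")
      case True
      then obtain L where L: "((\<lambda>r. F (of_real r * \<zeta>)) \<longlongrightarrow> L) (at_left (1::real))"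
        using radial_limit_iff_cauchy[OF F, of \<zeta>] by (auto simp: E_def)
      then show ?thesis using True filterlim_compose[OF L filterlim_radial_seq] boundary_function_eqI[OF L] by simp
    next
      case False
      then have "\<nexists>L. ((\<lambda>r. F (of_real r * \<zeta>)) \<longlongrightarrow> L) (at_left (1::real))"
        using radial_limit_iff_cauchy[OF F, of \<zeta>] \<zeta> by (auto simp: E_def)
      then have "boundary_function F \<zeta> = 0" unfolding boundary_function_def by (simp only: if_False)
      then show ?thesis using False by simp
    qed
  qed
qed

text \<open>
Where the radial limit exists, the boundary function is bounded by the lower limit of the
dilations; elsewhere it is 0. So Fatou's lemma applies.
\<close>

lemma boundary_function_powr_integral_le:
  assumes F: "continuous_on (ball 0 1) F" and p: "p > 0" and B: "B \<ge> 0"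
    and le: "\<And>r. 0 < r \<Longrightarrow> r < 1 \<Longrightarrow> circle_power p (\<lambda>\<zeta>. F (of_real r * \<zeta>)) \<le> B"
  shows "integrable circle_measure (\<lambda>\<zeta>. norm (boundary_function F \<zeta>) powr p)"
    and "circle_power p (\<lambda>\<zeta>. boundary_function F \<zeta>) \<le> B"
proof -
  have [measurable]: "boundary_function F \<in> borel_measurable circle_measure"
    by (rule borel_measurable_boundary_function[OF F])
  define u where "u n \<zeta> = norm (F (of_real (radial_seq n) * \<zeta>)) powr p" for n \<zeta>
  have cu: "continuous_on (sphere 0 1) (\<lambda>\<zeta>. F (of_real (radial_seq n) * \<zeta>))" for n
    using radial_seq(1,2)[of n] by (intro continuous_on_compose2[OF F] continuous_intros) (auto simp: norm_mult)
  have iu: "integrable circle_measure (u n)" for n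
    unfolding u_def[abs_def] by (intro integrable_circle_powr cu p)
  have [measurable]: "u n \<in> borel_measurable circle_measure" for n using iu by auto
  have "(\<integral>\<^sup>+\<zeta>. ennreal (norm (boundary_function F \<zeta>) powr p) \<partial>circle_measure) \<le> (\<integral>\<^sup>+\<zeta>. liminf (\<lambda>n. ennreal (u n \<zeta>)) \<partial>circle_measure)"
  proof (rule nn_integral_mono)
    fix \<zeta>
    show "ennreal (norm (boundary_function F \<zeta>) powr p) \<le> liminf (\<lambda>n. ennreal (u n \<zeta>))"
    proof (cases "boundary_function F \<zeta> = 0")
      case False
      have "(\<lambda>n. F (of_real (radial_seq n) * \<zeta>)) \<longlonglongrightarrow> boundary_function F \<zeta>"
        by (rule filterlim_compose[OF boundary_function_tendsto[OF False] filterlim_radial_seq])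
      then have "(\<lambda>n. ennreal (u n \<zeta>)) \<longlonglongrightarrow> ennreal (norm (boundary_function F \<zeta>) powr p)"
        unfolding u_def using p by (intro tendsto_ennrealI tendsto_powr' tendsto_norm tendsto_const) auto
      then show ?thesis by (simp add: lim_imp_Liminf)
    qed simp
  qed
  also have "\<dots> \<le> liminf (\<lambda>n. \<integral>\<^sup>+\<zeta>. ennreal (u n \<zeta>) \<partial>circle_measure)"
    by (rule nn_integral_liminf) measurable
  also have "\<dots> \<le> ennreal B"
  proof -
    have "(\<integral>\<^sup>+\<zeta>. ennreal (u n \<zeta>) \<partial>circle_measure) \<le> ennreal B" for n
      using le[OF radial_seq(1,2)] by (subst nn_integral_eq_integral[OF iu]) (auto simp: u_def[abs_def] intro!: ennreal_leI)
    then have "liminf (\<lambda>n. \<integral>\<^sup>+\<zeta>. ennreal (u n \<zeta>) \<partial>circle_measure) \<le> liminf (\<lambda>n. ennreal B)"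
      by (intro Liminf_mono always_eventually allI)
    then show ?thesis by (simp add: Liminf_const)
  qed
  finally have fin: "(\<integral>\<^sup>+\<zeta>. ennreal (norm (boundary_function F \<zeta>) powr p) \<partial>circle_measure) \<le> ennreal B" .
  show int: "integrable circle_measure (\<lambda>\<zeta>. norm (boundary_function F \<zeta>) powr p)"
  proof (rule integrableI_bounded)
    show "(\<integral>\<^sup>+\<zeta>. ennreal (norm (norm (boundary_function F \<zeta>) powr p)) \<partial>circle_measure) < \<infinity>"
      using order.strict_trans1[OF fin, of \<infinity>] by simp
  qed measurable
  show "circle_power p (\<lambda>\<zeta>. boundary_function F \<zeta>) \<le> B"
    using fin B by (subst (asm) nn_integral_eq_integral[OF int]) (auto simp: ennreal_le_iff)
qed

section \<open>From pairs on the closed disk to h^p and L^p\<close>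

lemma conjugation_boundD_norm:
  assumes "conjugation_bound p C" "closed_disk_pair g h" "C \<ge> 0" "p > 1"
  shows "circle_power p (\<lambda>\<zeta>. - \<i> * (g \<zeta> - cnj (h \<zeta>))) powr (1 / p)
      \<le> C * circle_power p (\<lambda>\<zeta>. g \<zeta> + cnj (h \<zeta>)) powr (1 / p)"
proof -
  have "circle_power p (\<lambda>\<zeta>. - \<i> * (g \<zeta> - cnj (h \<zeta>))) powr (1 / p)
      \<le> (C powr p * circle_power p (\<lambda>\<zeta>. g \<zeta> + cnj (h \<zeta>))) powr (1 / p)"
    using assms unfolding conjugation_bound_def norm_mult norm_minus_cancel norm_ii mult_1 by (intro powr_mono2) auto
  also have "\<dots> = C * circle_power p (\<lambda>\<zeta>. g \<zeta> + cnj (h \<zeta>)) powr (1 / p)"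
    using assms by (simp add: powr_mult powr_powr)
  finally show ?thesis .
qed

lemma conjugation_boundI_norm:
  assumes "\<And>g h. closed_disk_pair g h \<Longrightarrow>
      circle_power p (\<lambda>\<zeta>. - \<i> * (g \<zeta> - cnj (h \<zeta>))) powr (1 / p)
      \<le> C * circle_power p (\<lambda>\<zeta>. g \<zeta> + cnj (h \<zeta>)) powr (1 / p)" "C \<ge> 0" "p > 1"
  shows "conjugation_bound p C"
  unfolding conjugation_bound_def
proof (intro allI impI)
  fix g h assume "closed_disk_pair g h"
  from powr_mono2[OF _ _ assms(1)[OF this], of p] assms(2,3)
  show "circle_power p (\<lambda>\<zeta>. g \<zeta> - cnj (h \<zeta>))
       \<le> C powr p * circle_power p (\<lambda>\<zeta>. g \<zeta> + cnj (h \<zeta>))"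
    by (simp add: norm_mult powr_powr powr_mult)
qed

text \<open>
Dilation makes the estimates on the closed disk available for arbitrary harmonic functions on
the open disk.
\<close>

lemma canonical_decomp_dilate_closed_disk_pair:
  assumes "canonical_decomp f g h" "0 < r" "r < 1"
  shows "closed_disk_pair (\<lambda>z. g (of_real r * z)) (\<lambda>z. h (of_real r * z))"
proof -
  have hol: "g holomorphic_on ball 0 1" "h holomorphic_on ball 0 1" "h 0 = 0"
    using assms(1) by (auto simp: canonical_decomp_def)
  have "(\<lambda>z. of_real r * z) ` ball 0 (1 / r) \<subseteq> ball (0::complex) 1"
    using assms by (auto simp: norm_mult field_simps)
  then have "(\<lambda>z. k (of_real r * z)) holomorphic_on ball 0 (1 / r)" if "k holomorphic_on ball 0 1" for k
    using holomorphic_on_compose_gen[OF _ that, of "\<lambda>z. of_real r * z" "ball 0 (1 / r)"]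
    by (auto simp: o_def intro!: holomorphic_intros)
  then show ?thesis unfolding closed_disk_pair_def using hol assms by (intro exI[of _ "1 / r"]) auto
qed

lemma hp_mean_cong:
  assumes "\<And>z. z \<in> unit_disk \<Longrightarrow> f z = k z" "0 < r" "r < 1"
  shows "hp_mean p f r = hp_mean p k r"
proof -
  have "circle_power p (\<lambda>\<zeta>. f (of_real r * \<zeta>)) = circle_power p (\<lambda>\<zeta>. k (of_real r * \<zeta>))"
    using assms by (intro Bochner_Integration.integral_cong refl) (simp add: norm_mult)
  then show ?thesis by (simp add: hp_mean_def)
qed

lemma hp_norm_cong:
  assumes "\<And>z. z \<in> unit_disk \<Longrightarrow> f z = k z"
  shows "hp_norm p f = hp_norm p k"
  unfolding hp_norm_def using hp_mean_cong[OF assms] by (intro SUP_cong refl) auto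

lemma hp_mean_conjugate_le:
  assumes bound: "conjugation_bound p C" and C: "C \<ge> 0" and p: "p > 1" and d: "canonical_decomp f g h" and r: "0 < r" "r < 1"
  shows "hp_mean p (\<lambda>z. - \<i> * (g z - cnj (h z))) r \<le> C * hp_mean p f r"
proof -
  have "hp_mean p f r = hp_mean p (\<lambda>z. g z + cnj (h z)) r"
    using d r by (intro hp_mean_cong) (auto simp: canonical_decomp_def)
  then show ?thesis
    unfolding hp_mean_def using conjugation_boundD_norm[OF bound canonical_decomp_dilate_closed_disk_pair[OF d r] C p] by simp
qed

lemma hp_mean_le_hp_norm: "f \<in> hp_space p \<Longrightarrow> 0 < r \<Longrightarrow> r < 1 \<Longrightarrow> hp_mean p f r \<le> hp_norm p f"
  unfolding hp_norm_def hp_space_def by (auto intro!: cSUP_upper)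

lemma hp_norm_le: "(\<And>r. 0 < r \<Longrightarrow> r < 1 \<Longrightarrow> hp_mean p f r \<le> B) \<Longrightarrow> hp_norm p f \<le> B"
  unfolding hp_norm_def by (rule cSUP_least) auto

lemma hp_spaceI:
  assumes d: "canonical_decomp f g h" and b: "\<And>r. 0 < r \<Longrightarrow> r < 1 \<Longrightarrow> hp_mean p f r \<le> B"
  shows "f \<in> hp_space p"
proof -
  have "complex_harmonic_on f unit_disk"
    using d by (intro complex_harmonic_on_holomorphic_plus_cnj[of _ g h]) (auto simp: canonical_decomp_def)
  moreover have "bdd_above (hp_mean p f ` {0<..<1})" using b by (intro bdd_aboveI[of _ B]) auto
  ultimately show ?thesis by (simp add: hp_space_def)
qed

lemma canonical_decomp_conjugate:
  assumes d: "canonical_decomp f g h"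
  shows "canonical_decomp (\<lambda>z. - \<i> * (g z - cnj (h z))) (\<lambda>z. - \<i> * g z) (\<lambda>z. - \<i> * h z)"
  using d unfolding canonical_decomp_def by (auto intro!: holomorphic_intros simp: algebra_simps)

lemma hp_conjugate:
  assumes bound: "conjugation_bound p C" and C: "C \<ge> 0" and p: "p > 1" and f: "f \<in> hp_space p" and d: "canonical_decomp f g h"
  shows "(\<lambda>z. - \<i> * (g z - cnj (h z))) \<in> hp_space p"
    and "hp_norm p (\<lambda>z. - \<i> * (g z - cnj (h z))) \<le> C * hp_norm p f"
proof -
  have le: "hp_mean p (\<lambda>z. - \<i> * (g z - cnj (h z))) r \<le> C * hp_norm p f" if "0 < r" "r < 1" for r
    using hp_mean_conjugate_le[OF bound C p d that] mult_left_mono[OF hp_mean_le_hp_norm[OF f that] C] by linarith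
  show "(\<lambda>z. - \<i> * (g z - cnj (h z))) \<in> hp_space p" by (rule hp_spaceI[OF canonical_decomp_conjugate[OF d] le])
  show "hp_norm p (\<lambda>z. - \<i> * (g z - cnj (h z))) \<le> C * hp_norm p f" by (rule hp_norm_le[OF le])
qed

lemma closed_disk_pair_canonical_decomp:
  assumes "closed_disk_pair g h"
  shows "canonical_decomp (\<lambda>z. g z + cnj (h z)) g h"
proof -
  obtain R where R: "R > 1" "g holomorphic_on ball 0 R" "h holomorphic_on ball 0 R" "h 0 = 0"
    using assms by (auto simp: closed_disk_pair_def)
  have "ball (0::complex) 1 \<subseteq> ball 0 R" using R by auto
  then show ?thesis using R by (auto simp: canonical_decomp_def intro: holomorphic_on_subset)
qed

lemma closed_disk_pair_Lp_circle:
  assumes "closed_disk_pair g h" "p > 1"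
  shows "(\<lambda>z. g z + cnj (h z)) \<in> Lp_circle p"
proof -
  have "continuous_on (sphere 0 1) (\<lambda>z. g z + cnj (h z))"
    by (intro continuous_intros closed_disk_pair_continuous_circle[OF assms(1)])
  then show ?thesis using assms(2)
    by (auto simp: Lp_circle_def intro: borel_measurable_circle_continuous integrable_circle_powr)
qed

text \<open>
Such a function is the Poisson integral of its own boundary values, and the Poisson integral
does not increase the mean.
\<close>

lemma closed_disk_pair_hp:
  assumes n: "closed_disk_pair g h" and p: "p > 1"
  shows "(\<lambda>z. g z + cnj (h z)) \<in> hp_space p"
    and "hp_norm p (\<lambda>z. g z + cnj (h z)) \<le> circle_power p (\<lambda>\<zeta>. g \<zeta> + cnj (h \<zeta>)) powr (1 / p)"
proof -
  let ?f = "\<lambda>z. g z + cnj (h z)"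
  have le: "hp_mean p ?f r \<le> circle_power p (\<lambda>\<zeta>. g \<zeta> + cnj (h \<zeta>)) powr (1 / p)" if r: "0 < r" "r < 1" for r
  proof -
    have "circle_power p (\<lambda>\<eta>. ?f (of_real r * \<eta>)) = circle_power p (\<lambda>\<eta>. poisson_extension ?f (of_real r * \<eta>))"
      using r by (intro Bochner_Integration.integral_cong refl) (simp add: poisson_extension_closed_disk_pair[OF n] norm_mult)
    also have "\<dots> \<le> circle_power p ?f"
      using r by (intro poisson_extension_mean_le p closed_disk_pair_Lp_circle n) auto
    finally show ?thesis unfolding hp_mean_def using p by (intro powr_mono2) auto
  qed
  show "?f \<in> hp_space p" by (rule hp_spaceI[OF closed_disk_pair_canonical_decomp[OF n] le])
  show "hp_norm p ?f \<le> circle_power p (\<lambda>\<zeta>. g \<zeta> + cnj (h \<zeta>)) powr (1 / p)"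
    by (rule hp_norm_le[OF le])
qed

lemma hp_mean_tendsto_boundary:
  assumes F: "continuous_on (cball 0 1) F" and p: "p > 1"
  shows "(\<lambda>n. hp_mean p F (radial_seq n)) \<longlonglongrightarrow> circle_power p F powr (1 / p)"
proof -
  have in_ball: "of_real (radial_seq n) * \<zeta> \<in> cball 0 1" if "\<zeta> \<in> sphere 0 1" for n and \<zeta> :: complex
    using that radial_seq(1,2)[of n] by (simp add: norm_mult)
  have cs: "continuous_on (sphere 0 1) F" by (rule continuous_on_subset[OF F]) auto
  have "bounded (F ` cball 0 1)" by (intro compact_imp_bounded compact_continuous_image F) auto
  then obtain B where B: "\<And>z. z \<in> cball 0 1 \<Longrightarrow> norm (F z) \<le> B" unfolding bounded_iff by blast
  have "(\<lambda>n. \<integral>\<zeta>. norm (F (of_real (radial_seq n) * \<zeta>)) powr p \<partial>circle_measure) \<longlonglongrightarrow> circle_power p F"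
  proof (rule integral_dominated_convergence[where w = "\<lambda>_. B powr p"])
    show "(\<lambda>\<zeta>. norm (F \<zeta>) powr p) \<in> borel_measurable circle_measure"
      using p by (intro borel_measurable_integrable integrable_circle_powr cs) simp
    show "(\<lambda>\<zeta>. norm (F (of_real (radial_seq n) * \<zeta>)) powr p) \<in> borel_measurable circle_measure" for n
      using p in_ball by (intro borel_measurable_integrable integrable_circle_powr continuous_on_compose2[OF F] continuous_intros) auto
    show "AE \<zeta> in circle_measure. norm (norm (F (of_real (radial_seq n) * \<zeta>)) powr p) \<le> B powr p" for n
      using p in_ball B by (intro AE_I2) (auto intro!: powr_mono2)
    show "AE \<zeta> in circle_measure. (\<lambda>n. norm (F (of_real (radial_seq n) * \<zeta>)) powr p) \<longlonglongrightarrow> norm (F \<zeta>) powr p"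
    proof (rule AE_I2)
      fix \<zeta> :: complex assume "\<zeta> \<in> space circle_measure"
      then have \<zeta>: "\<zeta> \<in> sphere 0 1" by simp
      have "(\<lambda>n. of_real (radial_seq n) * \<zeta>) \<longlonglongrightarrow> of_real 1 * \<zeta>"
        by (intro tendsto_intros radial_seq(3))
      then have "(\<lambda>n. F (of_real (radial_seq n) * \<zeta>)) \<longlonglongrightarrow> F \<zeta>"
        using \<zeta> in_ball[OF \<zeta>] by (intro continuous_on_tendsto_compose[OF F]) auto
      then show "(\<lambda>n. norm (F (of_real (radial_seq n) * \<zeta>)) powr p) \<longlonglongrightarrow> norm (F \<zeta>) powr p"
        using p by (intro tendsto_powr' tendsto_norm tendsto_const) auto
    qed
  qed auto
  then show ?thesis unfolding hp_mean_def using p by (intro tendsto_powr' tendsto_const) auto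
qed

text \<open>
The means of the conjugate over circles of radius \<open>r\<close> tend to the mean over the unit circle, and
the norm of the function itself is at most its mean over the unit circle. Boundedness of the conjugate, with some
constant \<open>c\<close>, is used to compare its means with its norm: a supremum of reals only dominates the
means if they are bounded.
\<close>

lemma hp_bound_imp_conjugation_bound:
  assumes p: "p > 1" and C: "C \<ge> 0"
    and bound: "\<And>f g h. f \<in> hp_space p \<Longrightarrow> canonical_decomp f g h \<Longrightarrow> hp_norm p (\<lambda>z. - \<i> * (g z - cnj (h z))) \<le> C * hp_norm p f"
  shows "conjugation_bound p C"
proof (rule conjugation_boundI_norm[OF _ C p])
  fix g h assume n: "closed_disk_pair g h"
  let ?V = "\<lambda>z. - \<i> * (g z - cnj (h z))"
  define B where "B = C * circle_power p (\<lambda>\<zeta>. g \<zeta> + cnj (h \<zeta>)) powr (1 / p)"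
  obtain c where c: "c \<ge> 0" "conjugation_bound p c"
    using conjugation_bound_iff[OF p, of "\<bar>if p \<le> 2 then tan (pi / (2 * p)) else cot (pi / (2 * p))\<bar>"] by (metis abs_ge_self abs_ge_zero)
  have V: "?V \<in> hp_space p"
    by (rule hp_conjugate(1)[OF c(2,1) p closed_disk_pair_hp(1)[OF n p] closed_disk_pair_canonical_decomp[OF n]])
  have "hp_norm p ?V \<le> B"
    using bound[OF closed_disk_pair_hp(1)[OF n p] closed_disk_pair_canonical_decomp[OF n]] mult_left_mono[OF closed_disk_pair_hp(2)[OF n p] C]
    unfolding B_def by linarith
  then have "hp_mean p ?V (radial_seq k) \<le> B" for k
    using hp_mean_le_hp_norm[OF V radial_seq(1,2), of k] by linarith
  moreover have "(\<lambda>k. hp_mean p ?V (radial_seq k)) \<longlonglongrightarrow> circle_power p ?V powr (1 / p)"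
    by (intro hp_mean_tendsto_boundary continuous_intros closed_disk_pair_continuous[OF n] p)
  ultimately show "circle_power p ?V powr (1 / p) \<le> B"
    by (intro LIMSEQ_le_const2) auto
qed

text \<open>
The means of the conjugate of the Poisson integral are bounded by the estimate for dilations and
by the contraction property of the Poisson integral; Fatou's lemma passes to the boundary.
\<close>

lemma hilbert_transform_Lp:
  assumes bound: "conjugation_bound p C" and C: "C \<ge> 0" and p: "p > 1" and \<phi>: "\<phi> \<in> Lp_circle p"
  shows "hilbert_transform \<phi> \<in> Lp_circle p" and "Lp_circle_norm p (hilbert_transform \<phi>) \<le> C * Lp_circle_norm p \<phi>"
proof -
  obtain g h where d: "canonical_decomp (poisson_extension \<phi>) g h"
    using poisson_extension_decomposition[OF Lp_circle_integrable[OF p \<phi>]] by blast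
  define V where "V = harmonic_conjugate (poisson_extension \<phi>)"
  have V: "V z = - \<i> * (g z - cnj (h z))" if "z \<in> unit_disk" for z
    unfolding V_def by (rule harmonic_conjugate_eq[OF d that])
  have hol: "g holomorphic_on unit_disk" "h holomorphic_on unit_disk" using d by (auto simp: canonical_decomp_def)
  have "continuous_on unit_disk (\<lambda>z. - \<i> * (g z - cnj (h z)))"
    by (intro continuous_intros holomorphic_on_imp_continuous_on hol)
  then have cV: "continuous_on unit_disk V" by (rule continuous_on_eq) (simp add: V)
  define A where "A = circle_power p \<phi>"
  have le: "circle_power p (\<lambda>\<zeta>. V (of_real r * \<zeta>)) \<le> C powr p * A" if r: "0 < r" "r < 1" for r
  proof -
    have inD: "of_real r * \<zeta> \<in> unit_disk" if "\<zeta> \<in> space circle_measure" for \<zeta> :: complex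
      using that r by (simp add: norm_mult)
    have "circle_power p (\<lambda>\<zeta>. V (of_real r * \<zeta>))
        = circle_power p (\<lambda>\<zeta>. g (of_real r * \<zeta>) - cnj (h (of_real r * \<zeta>)))"
      by (intro Bochner_Integration.integral_cong refl) (simp only: V[OF inD] norm_mult norm_minus_cancel norm_ii mult_1)
    also have "\<dots> \<le> C powr p * circle_power p (\<lambda>\<zeta>. g (of_real r * \<zeta>) + cnj (h (of_real r * \<zeta>)))"
      using bound canonical_decomp_dilate_closed_disk_pair[OF d r] unfolding conjugation_bound_def by blast
    also have "circle_power p (\<lambda>\<zeta>. g (of_real r * \<zeta>) + cnj (h (of_real r * \<zeta>)))
        = circle_power p (\<lambda>\<zeta>. poisson_extension \<phi> (of_real r * \<zeta>))"
      using d inD by (intro Bochner_Integration.integral_cong refl) (metis canonical_decomp_def)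
    also have "C powr p * \<dots> \<le> C powr p * A"
      unfolding A_def using r by (intro mult_left_mono poisson_extension_mean_le p \<phi>) auto
    finally show ?thesis .
  qed
  have A: "A \<ge> 0" by (simp add: A_def)
  have "C powr p * A \<ge> 0" using A by simp
  note b = boundary_function_powr_integral_le[OF cV _ this le]
  show "hilbert_transform \<phi> \<in> Lp_circle p"
    unfolding hilbert_transform_def V_def[symmetric] Lp_circle_def
    using b(1) borel_measurable_boundary_function[OF cV] p by simp
  have "Lp_circle_norm p (hilbert_transform \<phi>) \<le> (C powr p * A) powr (1 / p)"
    unfolding hilbert_transform_def V_def[symmetric] Lp_circle_norm_def
    using b(2) p by (intro powr_mono2) auto
  also have "\<dots> = C * Lp_circle_norm p \<phi>" using A C p by (simp add: Lp_circle_norm_def A_def powr_mult powr_powr)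
  finally show "Lp_circle_norm p (hilbert_transform \<phi>) \<le> C * Lp_circle_norm p \<phi>" .
qed

lemma hilbert_transform_closed_disk_pair:
  assumes n: "closed_disk_pair g h" and \<zeta>: "\<zeta> \<in> sphere 0 1"
  shows "hilbert_transform (\<lambda>z. g z + cnj (h z)) \<zeta> = - \<i> * (g \<zeta> - cnj (h \<zeta>))"
  unfolding hilbert_transform_def
proof (rule boundary_function_eqI)
  let ?f = "\<lambda>z. g z + cnj (h z)" and ?V = "\<lambda>z. - \<i> * (g z - cnj (h z))"
  have d: "canonical_decomp (poisson_extension ?f) g h"
    using closed_disk_pair_canonical_decomp[OF n] by (simp add: canonical_decomp_def poisson_extension_closed_disk_pair[OF n])
  have inb: "of_real r * \<zeta> \<in> unit_disk" if "0 < r" "r < 1" for r using that \<zeta> by (simp add: norm_mult)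
  have c: "continuous_on (cball 0 1) ?V" by (intro continuous_intros closed_disk_pair_continuous[OF n])
  have ev: "\<forall>\<^sub>F r in at_left (1::real). 0 < r \<and> r < 1"
    unfolding eventually_at_left_field by (intro exI[of _ 0]) auto
  have "((\<lambda>r. of_real r * \<zeta>) \<longlongrightarrow> of_real 1 * \<zeta>) (at_left (1::real))" by (intro tendsto_intros)
  then have "((\<lambda>r. ?V (of_real r * \<zeta>)) \<longlongrightarrow> ?V \<zeta>) (at_left (1::real))"
  proof (intro continuous_on_tendsto_compose[OF c])
    show "\<forall>\<^sub>F r in at_left (1::real). of_real r * \<zeta> \<in> cball 0 1"
      using ev by eventually_elim (metis inb ball_subset_cball subsetD)
  qed (use \<zeta> in auto)
  moreover have "\<forall>\<^sub>F r in at_left (1::real). ?V (of_real r * \<zeta>) = harmonic_conjugate (poisson_extension ?f) (of_real r * \<zeta>)"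
    using ev by eventually_elim (simp only: harmonic_conjugate_eq[OF d inb])
  ultimately show "((\<lambda>r. harmonic_conjugate (poisson_extension ?f) (of_real r * \<zeta>)) \<longlongrightarrow> ?V \<zeta>) (at_left (1::real))"
    by (rule Lim_transform_eventually)
qed

lemma Lp_bound_imp_conjugation_bound:
  assumes p: "p > 1" and C: "C \<ge> 0"
    and bound: "\<And>\<phi>. \<phi> \<in> Lp_circle p \<Longrightarrow> Lp_circle_norm p (hilbert_transform \<phi>) \<le> C * Lp_circle_norm p \<phi>"
  shows "conjugation_bound p C"
proof (rule conjugation_boundI_norm[OF _ C p])
  fix g h assume n: "closed_disk_pair g h"
  have "circle_power p (\<lambda>\<zeta>. - \<i> * (g \<zeta> - cnj (h \<zeta>)))
      = circle_power p (\<lambda>\<zeta>. hilbert_transform (\<lambda>z. g z + cnj (h z)) \<zeta>)"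
    using hilbert_transform_closed_disk_pair[OF n] by (intro Bochner_Integration.integral_cong refl) simp
  then show "circle_power p (\<lambda>\<zeta>. - \<i> * (g \<zeta> - cnj (h \<zeta>))) powr (1 / p)
      \<le> C * circle_power p (\<lambda>\<zeta>. g \<zeta> + cnj (h \<zeta>)) powr (1 / p)"
    using bound[OF closed_disk_pair_Lp_circle[OF n p]] by (simp only: Lp_circle_norm_def)
qed

lemma operator_norm_on_eqI:
  assumes "c \<ge> 0" "\<And>f. f \<in> X \<Longrightarrow> N (T f) \<le> c * N f"
    and "\<And>C. 0 \<le> C \<Longrightarrow> (\<And>f. f \<in> X \<Longrightarrow> N (T f) \<le> C * N f) \<Longrightarrow> c \<le> C"
  shows "operator_norm_on X N T = ereal c"
  unfolding operator_norm_on_def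
  by (rule antisym) (use assms in \<open>auto intro!: Inf_lower Inf_greatest\<close>)

theorem theorem2p6:
  fixes p p_bar :: real
  assumes "p > 1"
    and "p_bar = max p (p / (p - 1))"
  shows
    "(\<forall>f g h. f \<in> hp_space p \<longrightarrow>
        g holomorphic_on unit_disk \<longrightarrow> h holomorphic_on unit_disk \<longrightarrow> h 0 = 0 \<longrightarrow>
        (\<forall>z\<in>unit_disk. f z = g z + cnj (h z)) \<longrightarrow>
          (\<lambda>z. - \<i> * (g z - cnj (h z))) \<in> hp_space p \<and>
          hp_norm p (\<lambda>z. - \<i> * (g z - cnj (h z))) \<le> cot (pi / (2 * p_bar)) * hp_norm p f) \<and>
     (\<forall>C. (\<forall>f g h. f \<in> hp_space p \<longrightarrow>
             g holomorphic_on unit_disk \<longrightarrow> h holomorphic_on unit_disk \<longrightarrow> h 0 = 0 \<longrightarrow>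
             (\<forall>z\<in>unit_disk. f z = g z + cnj (h z)) \<longrightarrow>
               hp_norm p (\<lambda>z. - \<i> * (g z - cnj (h z))) \<le> C * hp_norm p f)
          \<longrightarrow> cot (pi / (2 * p_bar)) \<le> C) \<and>
     harmonic_conjugate ` hp_space p \<subseteq> hp_space p \<and>
     operator_norm_on (hp_space p) (hp_norm p) harmonic_conjugate =
       ereal (if p \<le> 2 then tan (pi / (2 * p)) else cot (pi / (2 * p))) \<and>
     hilbert_transform ` Lp_circle p \<subseteq> Lp_circle p \<and>
     operator_norm_on (Lp_circle p) (Lp_circle_norm p) hilbert_transform =
       ereal (if p \<le> 2 then tan (pi / (2 * p)) else cot (pi / (2 * p)))"
proof -
  note p = assms(1)
  define c where "c = (if p \<le> 2 then tan (pi / (2 * p)) else cot (pi / (2 * p)))"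
  have cot_c: "cot (pi / (2 * p_bar)) = c"
  proof (cases "p \<le> 2")
    case True
    have "p * (p - 1) \<le> p * 1" using True p by (intro mult_left_mono) auto
    then have "p \<le> p / (p - 1)" using p by (simp add: field_simps)
    then have pb: "p_bar = p / (p - 1)" using assms(2) by simp
    have "pi / (2 * p_bar) = pi / 2 - pi / (2 * p)" using p unfolding pb by (simp add: field_simps)
    then show ?thesis using True tan_cot'[of "pi / (2 * p_bar)"] by (simp add: c_def)
  next
    case False
    have "p * 1 \<le> p * (p - 1)" using False by (intro mult_left_mono) auto
    then have "p / (p - 1) \<le> p" using p by (simp add: field_simps)
    then show ?thesis using False assms(2) by (simp add: c_def max_absorb1)
  qed
  have c0: "c \<ge> 0"
  proof -
    have "0 < pi / (2 * p)" "pi / (2 * p) < pi / 2" using p by (auto simp: divide_simps)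
    then show ?thesis using tan_gt_zero[of "pi / (2 * p)"] by (simp add: c_def cot_altdef less_imp_le)
  qed
  have bound: "conjugation_bound p c" using conjugation_bound_iff[OF p c0] by (simp add: c_def)
  have sharp: "c \<le> C" if "C \<ge> 0" "conjugation_bound p C" for C
    using conjugation_bound_iff[OF p that(1)] that(2) by (simp add: c_def)
  have decomp: "canonical_decomp f g h" if "g holomorphic_on unit_disk" "h holomorphic_on unit_disk" "h 0 = 0"
    "\<forall>z\<in>unit_disk. f z = g z + cnj (h z)" for f g h
    using that by (simp add: canonical_decomp_def)
  have conj: "harmonic_conjugate f \<in> hp_space p"
    "hp_norm p (harmonic_conjugate f) = hp_norm p (\<lambda>z. - \<i> * (g z - cnj (h z)))"
    if f: "f \<in> hp_space p" and d: "canonical_decomp f g h" for f g h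
  proof -
    note hc = harmonic_conjugate_eq[OF d]
    show "hp_norm p (harmonic_conjugate f) = hp_norm p (\<lambda>z. - \<i> * (g z - cnj (h z)))"
      by (rule hp_norm_cong[OF hc])
    have d': "canonical_decomp (harmonic_conjugate f) (\<lambda>z. - \<i> * g z) (\<lambda>z. - \<i> * h z)"
      using canonical_decomp_conjugate[OF d] hc by (simp add: canonical_decomp_def)
    show "harmonic_conjugate f \<in> hp_space p"
    proof (rule hp_spaceI[OF d'])
      fix r :: real assume r: "0 < r" "r < 1"
      show "hp_mean p (harmonic_conjugate f) r \<le> hp_norm p (\<lambda>z. - \<i> * (g z - cnj (h z)))"
        using hp_mean_cong[OF hc r, where p = p] hp_mean_le_hp_norm[OF hp_conjugate(1)[OF bound c0 p f d] r] by simp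
    qed
  qed
  have ex_decomp: "\<exists>g h. canonical_decomp f g h" if "f \<in> hp_space p" for f
  proof -
    have "complex_harmonic_on f unit_disk" using that by (simp add: hp_space_def)
    then show ?thesis by (metis complex_harmonic_on_decomposition)
  qed
  have hp_sharp: "c \<le> C"
    if C: "\<And>f g h. f \<in> hp_space p \<Longrightarrow> canonical_decomp f g h \<Longrightarrow> hp_norm p (\<lambda>z. - \<i> * (g z - cnj (h z))) \<le> C * hp_norm p f" for C
  proof -
    \<comment> \<open>A constant function has a conjugate of the same norm, so \<open>C\<close> is at least 1.\<close>
    have n1: "closed_disk_pair (\<lambda>z. 1) (\<lambda>z. 0)" by (auto simp: closed_disk_pair_def intro!: exI[of _ 2])
    have one: "hp_norm p (\<lambda>z. k) = 1" if "norm k = 1" for k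
      using that by (simp add: hp_norm_def hp_mean_def circle.prob_space[simplified])
    have "C \<ge> 1" using C[OF closed_disk_pair_hp(1)[OF n1 p] closed_disk_pair_canonical_decomp[OF n1]] by (simp add: one)
    then show ?thesis by (intro sharp hp_bound_imp_conjugation_bound p C) auto
  qed
  have "operator_norm_on (hp_space p) (hp_norm p) harmonic_conjugate = ereal c"
  proof (rule operator_norm_on_eqI[OF c0])
    fix f assume f: "f \<in> hp_space p"
    then obtain g h where d: "canonical_decomp f g h" using ex_decomp by blast
    show "hp_norm p (harmonic_conjugate f) \<le> c * hp_norm p f"
      using hp_conjugate(2)[OF bound c0 p f d] conj(2)[OF f d] by simp
  next
    fix C assume "\<And>f. f \<in> hp_space p \<Longrightarrow> hp_norm p (harmonic_conjugate f) \<le> C * hp_norm p f"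
    then show "c \<le> C" using conj(2) by (intro hp_sharp) metis
  qed
  moreover have "operator_norm_on (Lp_circle p) (Lp_circle_norm p) hilbert_transform = ereal c"
    using hilbert_transform_Lp(2)[OF bound c0 p] sharp Lp_bound_imp_conjugation_bound[OF p]
    by (intro operator_norm_on_eqI[OF c0]) auto
  moreover have "harmonic_conjugate ` hp_space p \<subseteq> hp_space p"
    using conj(1) ex_decomp by blast
  moreover have "hilbert_transform ` Lp_circle p \<subseteq> Lp_circle p"
    using hilbert_transform_Lp(1)[OF bound c0 p] by blast
  moreover have "c \<le> C" if "\<forall>f g h. f \<in> hp_space p \<longrightarrow>
             g holomorphic_on unit_disk \<longrightarrow> h holomorphic_on unit_disk \<longrightarrow> h 0 = 0 \<longrightarrow>
             (\<forall>z\<in>unit_disk. f z = g z + cnj (h z)) \<longrightarrow>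
               hp_norm p (\<lambda>z. - \<i> * (g z - cnj (h z))) \<le> C * hp_norm p f" for C
  proof (rule hp_sharp)
    fix f g h assume "f \<in> hp_space p" "canonical_decomp f g h"
    then show "hp_norm p (\<lambda>z. - \<i> * (g z - cnj (h z))) \<le> C * hp_norm p f"
      using that[rule_format, of f g h] by (simp add: canonical_decomp_def)
  qed
  moreover have "(\<lambda>z. - \<i> * (g z - cnj (h z))) \<in> hp_space p \<and>
      hp_norm p (\<lambda>z. - \<i> * (g z - cnj (h z))) \<le> c * hp_norm p f"
    if "f \<in> hp_space p" "g holomorphic_on unit_disk" "h holomorphic_on unit_disk" "h 0 = 0"
      "\<forall>z\<in>unit_disk. f z = g z + cnj (h z)" for f g h
    using hp_conjugate[OF bound c0 p that(1) decomp[OF that(2-5)]] by (rule conjI)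
  ultimately show ?thesis
    unfolding cot_c c_def[symmetric] by (intro conjI allI impI) simp_all
qed

end
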